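(* Fix a prime $p\geq 3$. For every $n\geq 1$, the $\pm$-oriented symplectic Steinberg module $\mathrm{St}^{\omega,\pm}_{2n}(\mathbb{F}_p)$ is isomorphic, as an abelian group, to $$\bigoplus_{\substack{0=\overline V_{-1}\subsetneq \overline V_0\subsetneq\dots\subsetneq\overline V_k\subsetneq\mathbb{F}_p^{2n}\\ \omega|_{\overline V_i}\equiv 0}} \mathrm{St}(\overline V_0)\otimes\mathrm{St}(\overline V_1/\overline V_0)\otimes\dots\otimes\mathrm{St}(\overline V_k/\overline V_{k-1})\otimes\mathrm{St}^\omega(\overline V_k^\perp/\overline V_k)\otimes\widetilde{\mathrm{H}}_0(\mathbb{F}_p^\times/\mathbb{Z}^\times;\mathbb{Z})^{\otimes(k+1)},$$ where the direct sum runs over all $k\ge -1$ and all flags of isotropic subspaces $0=\overline V_{-1}\subsetneq\overline V_0\subsetneq\dots\subsetneq\overline V_k$ of $\mathbb{F}_p^{2n}$; the flag with $k=-1$ contributes $\mathrm{St}^\omega(\mathbb{F}_p^{2n})$. All tensor products are over $\mathbb{Z}$.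
   Context: $\mathbb{F}_p^{2n}$ carries the standard symplectic form $\omega$; a subspace $\overline U$ is isotropic if $\omega|_{\overline U}\equiv0$; $\overline U^\perp$ is the symplectic complement, and for $\overline U$ isotropic $\overline U^\perp/\overline U$ carries the induced symplectic form. A $\pm$-orientation on a finite-dimensional $\mathbb{F}_p$-vector space $\overline V$ is a set $\pm\alpha=\{\alpha,-\alpha\}$ with $\alpha$ a generator of the top exterior power $\wedge^{\mathrm{top}}\overline V$. The poset $\mathbb{T}^{\omega,\pm}_{2n}(\mathbb{F}_p)$ consists of pairs $(\overline U,\pm\beta)$ with $\overline U$ a proper nonzero isotropic subspace of $\mathbb{F}_p^{2n}$ and $\pm\beta$ a $\pm$-orientation on $\overline U$, with $(\overline U,\pm\beta)<(\overline U',\pm\beta')$ iff $\overline U\subsetneq\overline U'$ (distinct $\pm$-orientations on the same subspace are incomparable). $\mathcal{T}^{\omega,\pm}_{2n}(\mathbb{F}_p)$ is its order complex, and $\mathrm{St}^{\omega,\pm}_{2n}(\mathbb{F}_p):=\widetilde{\mathrm{H}}_{n-1}(\mathcal{T}^{\omega,\pm}_{2n}(\mathbb{F}_p);\mathbb{Z})$. For an $r$-dimensional $\mathbb{F}_p$-vector space $\overline V$, $\mathrm{St}(\overline V):=\widetilde{\mathrm{H}}_{r-2}$ (with $\mathbb{Z}$ coefficients) of the order complex of the poset of proper nonzero subspaces of $\overline V$ ordered by inclusion. For a $2m$-dimensional symplectic $\mathbb{F}_p$-vector space $\overline W$, $\mathrm{St}^\omega(\overline W):=\widetilde{\mathrm{H}}_{m-1}$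 (with $\mathbb{Z}$ coefficients) of the order complex of the poset of proper nonzero isotropic subspaces of $\overline W$. Conventions: $\mathrm{St}(0)=\mathrm{St}^\omega(0)=\mathbb{Z}$ and $\mathrm{St}(\overline V)=\mathbb{Z}$ if $\dim\overline V=1$. $\mathbb{F}_p^\times/\mathbb{Z}^\times=\mathbb{F}_p^\times/\{\pm1\}$ is regarded as a discrete space with $\frac{p-1}{2}$ points. The $0$-th tensor power of an abelian group is $\mathbb{Z}$. *)

theory Defs
  imports
    "HOL-Homology.Homology"
    "HOL-Algebra.Free_Abelian_Groups"
    "HOL-Algebra.Generated_Groups"
    "HOL-Number_Theory.Residues"
    "Jordan_Normal_Form.Missing_VectorSpace"
begin

section \<open>Tensor products of abelian groups\<close>

text \<open>
  Abelian groups are multiplicatively written HOL-Algebra groups, so the group operation of a factor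
  is \<open>\<otimes>\<close>, whereas free abelian groups consist of finitely supported integer-valued functions,
  written additively. Biadditivity suffices as relations, since the base ring is the ring of integers.
\<close>

definition tensor_group ::
  "('a, 'c) monoid_scheme \<Rightarrow> ('b, 'd) monoid_scheme \<Rightarrow> ('a \<times> 'b \<Rightarrow>\<^sub>0 int) set monoid" where
  "tensor_group G H =
     (let F = free_Abelian_group (carrier G \<times> carrier H) in
      F Mod generate F
        ({frag_of (x \<otimes>\<^bsub>G\<^esub> x', y) - frag_of (x, y) - frag_of (x', y) | x x' y.
            x \<in> carrier G \<and> x' \<in> carrier G \<and> y \<in> carrier H} \<union>
         {frag_of (x, y \<otimes>\<^bsub>H\<^esub> y') - frag_of (x, y) - frag_of (x, y') | x y y'.
            x \<in> carrier G \<and> y \<in> carrier H \<and> y' \<in> carrier H}))"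

text \<open>
  The tensor product of a finite family. For the empty family there is a single pure tensor and no
  relation, so the result is infinite cyclic.
\<close>

definition tensor_family ::
  "'i set \<Rightarrow> ('i \<Rightarrow> ('a, 'c) monoid_scheme) \<Rightarrow> (('i \<Rightarrow> 'a) \<Rightarrow>\<^sub>0 int) set monoid" where
  "tensor_family I G =
     (let F = free_Abelian_group (\<Pi>\<^sub>E i\<in>I. carrier (G i)) in
      F Mod generate F
        {frag_of (f(i := x \<otimes>\<^bsub>G i\<^esub> y)) - frag_of (f(i := x)) - frag_of (f(i := y)) | f i x y.
           f \<in> (\<Pi>\<^sub>E i\<in>I. carrier (G i)) \<and> i \<in> I \<and> x \<in> carrier (G i) \<and> y \<in> carrier (G i)})"


section \<open>Reduced homology of order complexes\<close>

text \<open>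
  A \<open>q\<close>-simplex of the order complex of a poset \<open>P\<close> (with strict order \<open>lt\<close>) is a chain of \<open>q + 1\<close>
  elements. It is encoded as its increasing enumeration, which also orients it. The empty chain is
  the only simplex of degree \<open>-1\<close>; keeping it makes the complex the augmented one.
\<close>

definition order_simplices :: "'a set \<Rightarrow> ('a \<Rightarrow> 'a \<Rightarrow> bool) \<Rightarrow> int \<Rightarrow> 'a list set" where
  "order_simplices P lt q = {xs. set xs \<subseteq> P \<and> sorted_wrt lt xs \<and> int (length xs) = q + 1}"

definition order_chain_group ::
  "int \<Rightarrow> 'a set \<Rightarrow> ('a \<Rightarrow> 'a \<Rightarrow> bool) \<Rightarrow> ('a list \<Rightarrow>\<^sub>0 int) monoid" where
  "order_chain_group q P lt = free_Abelian_group (order_simplices P lt q)"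

definition order_boundary :: "('a list \<Rightarrow>\<^sub>0 int) \<Rightarrow> ('a list \<Rightarrow>\<^sub>0 int)" where
  "order_boundary =
     frag_extend (\<lambda>xs. \<Sum>i<length xs.
       frag_cmul ((-1) ^ i) (frag_of (take i xs @ drop (Suc i) xs)))"

definition reduced_order_homology ::
  "int \<Rightarrow> 'a set \<Rightarrow> ('a \<Rightarrow> 'a \<Rightarrow> bool) \<Rightarrow> ('a list \<Rightarrow>\<^sub>0 int) set monoid" where
  "reduced_order_homology q P lt =
     subgroup_generated (order_chain_group q P lt)
       {c \<in> carrier (order_chain_group q P lt). order_boundary c = 0}
     Mod (order_boundary ` carrier (order_chain_group (q + 1) P lt))"


section \<open>Quotient modules and exterior powers\<close>

text \<open>The ring multiplication and unit fields of a module record carry no meaning.\<close>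

definition quotient_module ::
  "('k, 'v, 'm) module_scheme \<Rightarrow> 'v set \<Rightarrow> ('k, 'v set) module" where
  "quotient_module M N =
     \<lparr>carrier = a_rcosets\<^bsub>M\<^esub> N,
      monoid.mult = (\<lambda>A B. N),
      one = N,
      zero = N,
      add = set_add M,
      smult = (\<lambda>c A. \<Union>x\<in>A. N +>\<^bsub>M\<^esub> (c \<odot>\<^bsub>M\<^esub> x))\<rparr>"

definition free_module :: "('k, 'r) ring_scheme \<Rightarrow> 's set \<Rightarrow> ('k, 's \<Rightarrow> 'k) module" where
  "free_module K S =
     (ring.func_space K S)
       \<lparr>carrier := {f \<in> S \<rightarrow>\<^sub>E carrier K. finite {s \<in> S. f s \<noteq> \<zero>\<^bsub>K\<^esub>}}\<rparr>"

definition free_gen :: "('k, 'r) ring_scheme \<Rightarrow> 's set \<Rightarrow> 's \<Rightarrow> ('s \<Rightarrow> 'k)" where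
  "free_gen K S s = (\<lambda>t\<in>S. if t = s then \<one>\<^bsub>K\<^esub> else \<zero>\<^bsub>K\<^esub>)"

text \<open>
  The \<open>r\<close>-th exterior power: the free module on \<open>r\<close>-tuples of vectors modulo multilinearity and the
  vanishing of tuples with a repeated entry.
\<close>

definition exterior_power ::
  "('k, 'r) ring_scheme \<Rightarrow> ('k, 'v, 'm) module_scheme \<Rightarrow> nat \<Rightarrow>
     ('k, ((nat \<Rightarrow> 'v) \<Rightarrow> 'k) set) module" where
  "exterior_power K V r =
     (let T = {..<r} \<rightarrow>\<^sub>E carrier V;
          F = free_module K T;
          e = free_gen K T
      in quotient_module F (module.span K F
        ({e (v(i := x \<oplus>\<^bsub>V\<^esub> y)) \<ominus>\<^bsub>F\<^esub> (e (v(i := x)) \<oplus>\<^bsub>F\<^esub> e (v(i := y))) | v i x y.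
            v \<in> T \<and> i < r \<and> x \<in> carrier V \<and> y \<in> carrier V} \<union>
         {e (v(i := c \<odot>\<^bsub>V\<^esub> x)) \<ominus>\<^bsub>F\<^esub> c \<odot>\<^bsub>F\<^esub> e (v(i := x)) | v i c x.
            v \<in> T \<and> i < r \<and> c \<in> carrier K \<and> x \<in> carrier V} \<union>
         {e v | v. v \<in> T \<and> (\<exists>i j. i < r \<and> j < r \<and> i \<noteq> j \<and> v i = v j)})))"

definition pm_orientations ::
  "('k, 'r) ring_scheme \<Rightarrow> ('k, 'v, 'm) module_scheme \<Rightarrow> ((nat \<Rightarrow> 'v) \<Rightarrow> 'k) set set set" where
  "pm_orientations K V =
     (let E = exterior_power K V (vectorspace.dim K V)
      in {{\<alpha>, \<ominus>\<^bsub>E\<^esub> \<alpha>} | \<alpha>. \<alpha> \<in> carrier E \<and> module.span K E {\<alpha>} = carrier E})"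


section \<open>Symplectic spaces\<close>

definition std_symplectic ::
  "('k, 'r) ring_scheme \<Rightarrow> nat \<Rightarrow> (nat \<Rightarrow> 'k) \<Rightarrow> (nat \<Rightarrow> 'k) \<Rightarrow> 'k" where
  "std_symplectic K n x y =
     (\<Oplus>\<^bsub>K\<^esub> i \<in> {..<n}. x i \<otimes>\<^bsub>K\<^esub> y (n + i) \<ominus>\<^bsub>K\<^esub> x (n + i) \<otimes>\<^bsub>K\<^esub> y i)"

definition isotropic :: "('k, 'r) ring_scheme \<Rightarrow> ('v \<Rightarrow> 'v \<Rightarrow> 'k) \<Rightarrow> 'v set \<Rightarrow> bool" where
  "isotropic K \<omega> U \<longleftrightarrow> (\<forall>x\<in>U. \<forall>y\<in>U. \<omega> x y = \<zero>\<^bsub>K\<^esub>)"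

definition symp_complement ::
  "('k, 'r) ring_scheme \<Rightarrow> ('k, 'v, 'm) module_scheme \<Rightarrow> ('v \<Rightarrow> 'v \<Rightarrow> 'k) \<Rightarrow> 'v set \<Rightarrow> 'v set" where
  "symp_complement K V \<omega> U = {x \<in> carrier V. \<forall>y\<in>U. \<omega> x y = \<zero>\<^bsub>K\<^esub>}"

text \<open>
  The value of a form on two cosets; the set below is a singleton for cosets of \<open>U\<close> in its
  symplectic complement.
\<close>

definition induced_form :: "('v \<Rightarrow> 'v \<Rightarrow> 'k) \<Rightarrow> 'v set \<Rightarrow> 'v set \<Rightarrow> 'k" where
  "induced_form \<omega> A B = the_elem ((\<lambda>(x, y). \<omega> x y) ` (A \<times> B))"

definition proper_subspaces ::
  "('k, 'r) ring_scheme \<Rightarrow> ('k, 'v, 'm) module_scheme \<Rightarrow> 'v set set" where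
  "proper_subspaces K V =
     {U. VectorSpace.subspace K U V \<and> U \<noteq> {\<zero>\<^bsub>V\<^esub>} \<and> U \<noteq> carrier V}"

definition proper_isotropics ::
  "('k, 'r) ring_scheme \<Rightarrow> ('k, 'v, 'm) module_scheme \<Rightarrow> ('v \<Rightarrow> 'v \<Rightarrow> 'k) \<Rightarrow> 'v set set" where
  "proper_isotropics K V \<omega> = {U \<in> proper_subspaces K V. isotropic K \<omega> U}"


section \<open>Steinberg modules\<close>

text \<open>
  For \<open>dim V \<ge> 1\<close> the degree is \<open>dim V - 2\<close>. The maximum only matters for \<open>V = 0\<close>, where it yields
  the reduced homology of the empty complex in degree \<open>-1\<close>, that is, the convention that the
  Steinberg module of the zero space is infinite cyclic. The same group arises without any case
  distinction if \<open>dim V = 1\<close>, and for the symplectic Steinberg module of the zero space.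
\<close>

definition steinberg ::
  "('k, 'r) ring_scheme \<Rightarrow> ('k, 'v, 'm) module_scheme \<Rightarrow> ('v set list \<Rightarrow>\<^sub>0 int) set monoid" where
  "steinberg K V =
     reduced_order_homology (max (-1) (int (vectorspace.dim K V) - 2)) (proper_subspaces K V) (\<subset>)"

definition symp_steinberg ::
  "('k, 'r) ring_scheme \<Rightarrow> ('k, 'v, 'm) module_scheme \<Rightarrow> ('v \<Rightarrow> 'v \<Rightarrow> 'k) \<Rightarrow>
     ('v set list \<Rightarrow>\<^sub>0 int) set monoid" where
  "symp_steinberg K W \<omega> =
     reduced_order_homology (int (vectorspace.dim K W div 2) - 1) (proper_isotropics K W \<omega>) (\<subset>)"

definition oriented_isotropics ::
  "('k, 'r) ring_scheme \<Rightarrow> ('k, 'v, 'm) module_scheme \<Rightarrow> ('v \<Rightarrow> 'v \<Rightarrow> 'k) \<Rightarrow>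
     ('v set \<times> ((nat \<Rightarrow> 'v) \<Rightarrow> 'k) set set) set" where
  "oriented_isotropics K V \<omega> =
     (SIGMA U : proper_isotropics K V \<omega>. pm_orientations K (V\<lparr>carrier := U\<rparr>))"


section \<open>The prime field case\<close>

abbreviation Fp :: "nat \<Rightarrow> int ring" where
  "Fp p \<equiv> residue_ring (int p)"

abbreviation Fp_space :: "nat \<Rightarrow> nat \<Rightarrow> (int, nat \<Rightarrow> int) module" where
  "Fp_space p n \<equiv> ring.func_space (Fp p) {..<2 * n}"

abbreviation Fp_form :: "nat \<Rightarrow> nat \<Rightarrow> (nat \<Rightarrow> int) \<Rightarrow> (nat \<Rightarrow> int) \<Rightarrow> int" where
  "Fp_form p n \<equiv> std_symplectic (Fp p) n"

definition pm_oriented_symp_steinberg ::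
  "nat \<Rightarrow> nat \<Rightarrow>
     (((nat \<Rightarrow> int) set \<times> ((nat \<Rightarrow> nat \<Rightarrow> int) \<Rightarrow> int) set set) list \<Rightarrow>\<^sub>0 int) set monoid" where
  "pm_oriented_symp_steinberg p n =
     reduced_order_homology (int n - 1)
       (oriented_isotropics (Fp p) (Fp_space p n) (Fp_form p n))
       (\<lambda>x y. fst x \<subset> fst y)"

text \<open>
  The group of units modulo the image of the units of the ring of integers, as a discrete space.
\<close>

definition Fp_units_mod_sign :: "nat \<Rightarrow> int set topology" where
  "Fp_units_mod_sign p =
     discrete_topology (carrier (units_of (Fp p) Mod {\<one>\<^bsub>Fp p\<^esub>, \<ominus>\<^bsub>Fp p\<^esub> \<one>\<^bsub>Fp p\<^esub>}))"

text \<open>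
  A flag \<open>V\<^sub>0 \<subset> \<dots> \<subset> V\<^sub>k\<close> is the list of its \<open>k + 1\<close> members; the empty list is the flag with
  \<open>k = -1\<close>. In \<open>flag_summand\<close>, \<open>Ws\<close> is the flag with the zero space prepended, so that
  \<open>Ws ! i\<close> is the predecessor of \<open>Vs ! i\<close>, and the last member of \<open>Ws\<close> is \<open>V\<^sub>k\<close> also for \<open>k = -1\<close>.
\<close>

definition isotropic_flags :: "nat \<Rightarrow> nat \<Rightarrow> (nat \<Rightarrow> int) set list set" where
  "isotropic_flags p n =
     {Vs. set Vs \<subseteq> proper_isotropics (Fp p) (Fp_space p n) (Fp_form p n) \<and> sorted_wrt (\<subset>) Vs}"

definition flag_summand where
  "flag_summand p n Vs =
     (let K = Fp p; V = Fp_space p n; \<omega> = Fp_form p n;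
          Ws = {\<zero>\<^bsub>V\<^esub>} # Vs;
          U = last Ws
      in tensor_group
           (tensor_family {..<length Vs}
              (\<lambda>i. steinberg K (quotient_module (V\<lparr>carrier := Vs ! i\<rparr>) (Ws ! i))))
           (tensor_group
              (symp_steinberg K (quotient_module (V\<lparr>carrier := symp_complement K V \<omega> U\<rparr>) U)
                 (induced_form \<omega>))
              (tensor_family {..<length Vs}
                 (\<lambda>i. reduced_homology_group 0 (Fp_units_mod_sign p)))))"

end

(* Both sides are free abelian groups of finite rank, because reduced homology in the top degree is a
   group of cycles; hence it suffices to compare ranks. Let m = (p - 1) / 2 be the number of
   orientations up to sign of a nonzero isotropic subspace. A facet of the oriented complex is a
   maximal isotropic flag together with a choice of one of m labels for each of its members. Splitting
   functions of a label into constant functions and functions of sum zero, independently for each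
   member of the flag, shows that the rank of the top cycles is the sum over all flags \<sigma> of
   (m - 1)^|\<sigma>| times the rank of the top homology of the link of \<sigma>. This link is the join of the
   Tits buildings of the successive quotients of \<sigma> and of the symplectic building of the last
   complement, so its rank is the product of the ranks of the Steinberg modules, while m - 1 is the rank
   of the reduced zeroth homology of m points. *)

theory Submission
  imports Defs "Jordan_Normal_Form.Determinant"
begin

section \<open>Free abelian groups of finite rank\<close>

text \<open>No map between the two sides is written down: every construction that occurs is shown to
  be free, with a rank that is additive or multiplicative in its ingredients, down to the
  presentations of the tensor products. The number m has two origins that have to agree. On the left
  it counts generators up to sign of a top exterior power, which must first be shown to be a line:
  one basis tuple spans it, and the determinant prevents it from collapsing. On the right it is the
  number of cosets of the signs in the units. The obstacle on the left is that labels sit on the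
  members of a facet, and the members vary. A facet has exactly one member of each rank, so labels
  are indexed by ranks instead; labelled facets become a product of facets and labellings, and the
  ranks can be decoupled one after the other. A link is represented by the functions on the facets
  containing the chain, and its rank is only compared, never evaluated. Dimensions are replaced by
  cardinalities: over a field with q elements |V| = q^dim V, and |U| |U^perp| = |V| by double
  counting.\<close>

definition free_rank :: "('a, 'b) monoid_scheme \<Rightarrow> nat \<Rightarrow> bool" where
  "free_rank G r \<longleftrightarrow> group G \<and> G \<cong> free_Abelian_group {..<r}"

lemma free_rankI:
  assumes "group G" "G \<cong> free_Abelian_group B" "finite B" "card B = r"
  shows "free_rank G r"
proof -
  have "B \<approx> {..<r}"
    using assms by (metis bij_betw_iff_card card_lessThan eqpoll_def finite_lessThan)
  then have "free_Abelian_group B \<cong> free_Abelian_group {..<r}"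
    by (simp add: isomorphic_free_Abelian_groups)
  with assms show ?thesis
    unfolding free_rank_def using iso_trans by blast
qed

lemma free_rank_group: "free_rank G r \<Longrightarrow> group G"
  by (simp add: free_rank_def)

text \<open>The relation \<open>\<cong>\<close> only asks for a bijective multiplicative map;
  reversing it needs the group axioms, which is why \<open>free_rank\<close> records
  \<open>group G\<close>.\<close>

lemma free_rank_iso: "free_rank G r \<Longrightarrow> free_rank H r \<Longrightarrow> G \<cong> H"
  unfolding free_rank_def using iso_trans group.iso_sym by blast

lemma free_rank_cong: "free_rank G r \<Longrightarrow> group H \<Longrightarrow> H \<cong> G \<Longrightarrow> free_rank H r"
  unfolding free_rank_def using iso_trans by blast

lemma free_rank_unique:
  assumes "free_rank G r" "free_rank G s"
  shows "r = s"
proof -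
  have "free_Abelian_group {..<r} \<cong> free_Abelian_group {..<s}"
    using assms unfolding free_rank_def using iso_trans group.iso_sym by blast
  then have "{..<r} \<approx> {..<s}"
    by (simp add: isomorphic_free_Abelian_groups)
  then show ?thesis
    by (metis bij_betw_iff_card card_lessThan eqpoll_def finite_lessThan)
qed

lemma free_rank_comm_group: "free_rank G r \<Longrightarrow> comm_group G"
  by (meson abelian_free_Abelian_group comm_group.iso_imp_comm_group free_rank_def group.iso_sym
      group.is_monoid)

text \<open>\<open>g\<close> is a basis and \<open>c\<close> the dual coordinate functions. That the
  basis generates is encoded as an induction principle over quotients, which spares integer powers
  in a multiplicatively written group and applies directly to congruences.\<close>

definition coordinates ::
  "('a, 'b) monoid_scheme \<Rightarrow> nat \<Rightarrow> ('a \<Rightarrow> nat \<Rightarrow> int) \<Rightarrow> (nat \<Rightarrow> 'a) \<Rightarrow> bool" where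
  "coordinates G r c g \<longleftrightarrow>
     (\<forall>x\<in>carrier G. \<forall>y\<in>carrier G. \<forall>i. c (x \<otimes>\<^bsub>G\<^esub> y) i = c x i + c y i) \<and>
     (\<forall>i<r. g i \<in> carrier G) \<and>
     (\<forall>i<r. \<forall>j. c (g i) j = (if i = j then 1 else 0)) \<and>
     (\<forall>P. P \<one>\<^bsub>G\<^esub> \<longrightarrow> (\<forall>i<r. P (g i)) \<longrightarrow>
        (\<forall>x\<in>carrier G. \<forall>y\<in>carrier G. P x \<longrightarrow> P y \<longrightarrow> P (x \<otimes>\<^bsub>G\<^esub> inv\<^bsub>G\<^esub> y)) \<longrightarrow>
        (\<forall>x\<in>carrier G. P x))"

lemma
  assumes "coordinates G r c g"
  shows coordinates_mult: "x \<in> carrier G \<Longrightarrow> y \<in> carrier G \<Longrightarrow> c (x \<otimes>\<^bsub>G\<^esub> y) i = c x i + c y i"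
    and coordinates_closed: "j < r \<Longrightarrow> g j \<in> carrier G"
    and coordinates_basis: "j < r \<Longrightarrow> c (g j) i = (if j = i then 1 else 0)"
  using assms[unfolded coordinates_def, THEN conjunct1]
    assms[unfolded coordinates_def, THEN conjunct2, THEN conjunct1]
    assms[unfolded coordinates_def, THEN conjunct2, THEN conjunct2, THEN conjunct1]
  by blast+

lemma coordinates_induct:
  assumes "coordinates G r c g" "P \<one>\<^bsub>G\<^esub>" "\<forall>i<r. P (g i)"
    "\<forall>x\<in>carrier G. \<forall>y\<in>carrier G. P x \<longrightarrow> P y \<longrightarrow> P (x \<otimes>\<^bsub>G\<^esub> inv\<^bsub>G\<^esub> y)" "x \<in> carrier G"
  shows "P x"
  by (rule bspec[OF assms(1)[unfolded coordinates_def, THEN conjunct2, THEN conjunct2, THEN conjunct2,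
        THEN spec[of _ P], THEN mp, THEN mp, THEN mp]]) (use assms in blast)+

text \<open>Everything is pulled back along an isomorphism \<open>h\<close> with inverse
  \<open>k\<close>: \<open>c\<close> reads the coefficients of \<open>h x\<close>, \<open>g\<close>
  consists of the images of the standard generators under \<open>k\<close>, and generation is
  \<open>frag_induction\<close> applied to \<open>h x\<close>.\<close>

lemma free_rank_coordinates:
  assumes "free_rank G r"
  shows "\<exists>c g. coordinates G r c g"
proof -
  let ?F = "free_Abelian_group {..<r}"
  interpret G: group G using assms by (rule free_rank_group)
  interpret F: group ?F by simp
  obtain h k where hk: "group_isomorphisms G ?F h k"
    using assms G.iso_iff_group_isomorphisms[of _ ?F] unfolding free_rank_def is_iso_def by blast
  then have h: "h \<in> hom G ?F" and k: "k \<in> hom ?F G"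
    and kh: "\<And>x. x \<in> carrier G \<Longrightarrow> k (h x) = x"
    and hk: "\<And>y. y \<in> carrier ?F \<Longrightarrow> h (k y) = y"
    by (auto simp: group_isomorphisms_def simp del: carrier_free_Abelian_group_iff)
  interpret k: group_hom ?F G k
    by (intro group_hom.intro group_hom_axioms.intro k G.is_group group_free_Abelian_group)
  define c where "c x i = Poly_Mapping.lookup (h x) i" for x i
  define g where "g i = k (frag_of i)" for i
  have hc: "h x \<in> carrier ?F" if "x \<in> carrier G" for x
    by (rule hom_in_carrier[OF h that])
  have 1: "c (x \<otimes>\<^bsub>G\<^esub> y) i = c x i + c y i" if "x \<in> carrier G" "y \<in> carrier G" for x y i
    using hom_mult[OF h that] by (simp add: c_def lookup_add)
  have 2: "g i \<in> carrier G" if "i < r" for i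
    using that by (simp add: g_def)
  have 3: "c (g i) j = (if i = j then 1 else 0)" if "i < r" for i j
    using that by (simp add: c_def g_def hk lookup_single when_def)
  have 4: "P x" if P1: "P \<one>\<^bsub>G\<^esub>" and Pg: "\<forall>i<r. P (g i)"
    and Pd: "\<forall>x\<in>carrier G. \<forall>y\<in>carrier G. P x \<longrightarrow> P y \<longrightarrow> P (x \<otimes>\<^bsub>G\<^esub> inv\<^bsub>G\<^esub> y)"
    and x: "x \<in> carrier G" for P x
  proof -
    have "Poly_Mapping.keys (h x) \<subseteq> {..<r}"
      using hc[OF x] by simp
    then have "P (k (h x)) \<and> Poly_Mapping.keys (h x) \<subseteq> {..<r}"
    proof (induction rule: frag_induction)
      case zero
      then show ?case using P1 k.hom_one by simp
    next
      case (one x)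
      then show ?case using Pg by (simp add: g_def)
    next
      case (diff a b)
      have ab: "a \<in> carrier ?F" "b \<in> carrier ?F"
        using diff by auto
      have "a - b = a \<otimes>\<^bsub>?F\<^esub> inv\<^bsub>?F\<^esub> b"
        using diff by simp
      then have "k (a - b) = k a \<otimes>\<^bsub>G\<^esub> inv\<^bsub>G\<^esub> k b"
        by (simp only: k.hom_mult[OF ab(1) F.inv_closed[OF ab(2)]] k.hom_inv[OF ab(2)])
      moreover have "Poly_Mapping.keys (a - b) \<subseteq> {..<r}"
        using diff keys_diff[of a b] by blast
      ultimately show ?case
        using diff Pd k.hom_closed[OF ab(1)] k.hom_closed[OF ab(2)] by simp
    qed
    then show ?thesis using kh x by simp
  qed
  have "coordinates G r c g"
    unfolding coordinates_def by (intro conjI ballI allI impI; rule 1 2 3 4; assumption)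
  then show ?thesis by blast
qed

text \<open>Congruence modulo relations is expressed below as membership of a difference in such a
  set \<open>N\<close>, rather than as equality of cosets.\<close>

definition frag_subgroup :: "('x \<Rightarrow>\<^sub>0 int) set \<Rightarrow> bool" where
  "frag_subgroup N \<longleftrightarrow> 0 \<in> N \<and> (\<forall>u\<in>N. \<forall>v\<in>N. u - v \<in> N)"

lemma frag_subgroup_zero: "frag_subgroup N \<Longrightarrow> 0 \<in> N"
  by (simp add: frag_subgroup_def)

lemma frag_subgroup_diff: "frag_subgroup N \<Longrightarrow> u \<in> N \<Longrightarrow> v \<in> N \<Longrightarrow> u - v \<in> N"
  by (simp add: frag_subgroup_def)

lemma frag_subgroup_uminus: "frag_subgroup N \<Longrightarrow> u \<in> N \<Longrightarrow> - u \<in> N"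
  using frag_subgroup_diff[of N 0 u] frag_subgroup_zero[of N] by simp

lemma frag_subgroup_add: "frag_subgroup N \<Longrightarrow> u \<in> N \<Longrightarrow> v \<in> N \<Longrightarrow> u + v \<in> N"
  using frag_subgroup_diff[of N u "- v"] frag_subgroup_uminus[of N v] by simp

lemma frag_subgroup_cmul: "frag_subgroup N \<Longrightarrow> u \<in> N \<Longrightarrow> frag_cmul k u \<in> N"
  by (rule frag_closure_minus_cmul[of "\<lambda>u. u \<in> N"])
    (auto intro: frag_subgroup_diff frag_subgroup_zero)

lemma frag_subgroup_sum:
  "frag_subgroup N \<Longrightarrow> (\<And>i. i \<in> I \<Longrightarrow> f i \<in> N) \<Longrightarrow> sum f I \<in> N"
  by (induction I rule: infinite_finite_induct) (auto intro: frag_subgroup_add frag_subgroup_zero)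

lemma frag_subgroup_generate:
  assumes "R \<subseteq> carrier (free_Abelian_group S)"
  shows "frag_subgroup (generate (free_Abelian_group S) R)"
proof -
  let ?F = "free_Abelian_group S"
  have N: "subgroup (generate ?F R) ?F"
    using assms by (rule group.generate_is_subgroup[OF group_free_Abelian_group])
  have "u - v \<in> generate ?F R" if "u \<in> generate ?F R" "v \<in> generate ?F R" for u v
  proof -
    have v: "v \<in> carrier ?F" by (rule subgroup.mem_carrier[OF N that(2)])
    have "u \<otimes>\<^bsub>?F\<^esub> inv\<^bsub>?F\<^esub> v \<in> generate ?F R"
      by (intro subgroup.m_closed[OF N] subgroup.m_inv_closed[OF N] that)
    then show ?thesis using v by simp
  qed
  moreover have "0 \<in> generate ?F R"
    using subgroup.one_closed[OF N] by simp
  ultimately show ?thesis by (simp add: frag_subgroup_def)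
qed

text \<open>
  The criterion by which a tensor product is recognised as free: \<open>\<Phi>\<close> evaluates tensors in a basis,
  and every generator is congruent to the corresponding combination of basis tensors.
\<close>

lemma free_presentation_rank:
  fixes S :: "'x set" and B :: "'y set" and \<Phi> :: "'x \<Rightarrow> ('y \<Rightarrow>\<^sub>0 int)" and \<Psi> :: "'y \<Rightarrow> 'x"
  defines "F \<equiv> free_Abelian_group S"
  assumes R: "R \<subseteq> carrier F"
    and B: "finite B" "card B = r"
    and \<Phi>: "\<And>x. x \<in> S \<Longrightarrow> \<Phi> x \<in> carrier (free_Abelian_group B)"
    and \<Psi>: "\<And>b. b \<in> B \<Longrightarrow> \<Psi> b \<in> S" "\<And>b. b \<in> B \<Longrightarrow> \<Phi> (\<Psi> b) = frag_of b"
    and kill: "\<And>z. z \<in> R \<Longrightarrow> frag_extend \<Phi> z = 0"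
    and red: "\<And>x. x \<in> S \<Longrightarrow> frag_of x - frag_extend (\<lambda>b. frag_of (\<Psi> b)) (\<Phi> x) \<in> generate F R"
  shows "free_rank (F Mod generate F R) r"
proof -
  let ?B = "free_Abelian_group B"
  let ?N = "generate F R"
  interpret F: comm_group F
    unfolding F_def by (rule abelian_free_Abelian_group)
  have F: "group F" by (rule F.is_group)
  have N: "subgroup ?N F"
    using R by (rule F.generate_is_subgroup)
  have Nn: "?N \<lhd> F"
    using N by (rule F.subgroup_imp_normal)
  have carB: "frag_extend \<Phi> z \<in> carrier ?B" if "z \<in> carrier F" for z
  proof -
    have "Poly_Mapping.keys (frag_extend \<Phi> z) \<subseteq> (\<Union>x \<in> Poly_Mapping.keys z. Poly_Mapping.keys (\<Phi> x))"
      by (rule keys_frag_extend)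
    also have "\<dots> \<subseteq> B"
    proof (rule UN_least)
      fix x assume "x \<in> Poly_Mapping.keys z"
      with that have "x \<in> S" unfolding F_def carrier_free_Abelian_group_iff by blast
      from \<Phi>[OF this] show "Poly_Mapping.keys (\<Phi> x) \<subseteq> B" by simp
    qed
    finally show ?thesis unfolding carrier_free_Abelian_group_iff .
  qed
  have hom: "frag_extend \<Phi> \<in> hom F ?B"
  proof (rule homI)
    show "frag_extend \<Phi> (x \<otimes>\<^bsub>F\<^esub> y) = frag_extend \<Phi> x \<otimes>\<^bsub>?B\<^esub> frag_extend \<Phi> y" for x y
      unfolding F_def mult_free_Abelian_group by (rule frag_extend_add)
  qed (rule carB)
  have h: "group_hom F ?B (frag_extend \<Phi>)"
    by (rule group_hom.intro[OF F group_free_Abelian_group group_hom_axioms.intro[OF hom]])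
  have N': "frag_subgroup ?N"
    unfolding F_def using R[unfolded F_def] by (rule frag_subgroup_generate)
  \<comment> \<open>The hypothesis \<open>red\<close> spreads additively from the generators to all
    of \<open>F\<close>. For an element of the kernel of \<open>frag_extend \<Phi>\<close> it says
    that the element lies in \<open>?N\<close>, which is the harder inclusion in
    \<open>ker\<close>.\<close>
  have red': "z - frag_extend (\<lambda>b. frag_of (\<Psi> b)) (frag_extend \<Phi> z) \<in> ?N"
    if "Poly_Mapping.keys z \<subseteq> S" for z
    using that
  proof (induction rule: frag_induction)
    case zero
    then show ?case using frag_subgroup_zero[OF N'] by simp
  next
    case (one x)
    then show ?case using red by simp
  next
    case (diff a b)
    then show ?case
      using frag_subgroup_diff[OF N' diff(1,2)] by (simp add: frag_extend_diff algebra_simps)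
  qed
  have surj: "frag_extend \<Phi> ` carrier F = carrier ?B"
  proof
    show "carrier ?B \<subseteq> frag_extend \<Phi> ` carrier F"
    proof
      fix y assume y: "y \<in> carrier ?B"
      then have keys: "Poly_Mapping.keys y \<subseteq> B" by simp
      then have "frag_extend \<Phi> (frag_extend (\<lambda>b. frag_of (\<Psi> b)) y) = y"
      proof (induction rule: frag_induction)
        case zero
        then show ?case by simp
      next
        case (one x)
        then show ?case using \<Psi> by simp
      next
        case (diff a b)
        then show ?case by (simp add: frag_extend_diff)
      qed
      moreover have "frag_extend (\<lambda>b. frag_of (\<Psi> b)) y \<in> carrier F"
        using keys \<Psi>(1) keys_frag_extend[of "\<lambda>b. frag_of (\<Psi> b)" y] unfolding F_def by fastforce
      ultimately show "y \<in> frag_extend \<Phi> ` carrier F"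
        by (metis imageI)
    qed
  qed (use carB in blast)
  have ker: "kernel F ?B (frag_extend \<Phi>) = ?N"
  proof
    show "kernel F ?B (frag_extend \<Phi>) \<subseteq> ?N"
    proof
      fix z assume "z \<in> kernel F ?B (frag_extend \<Phi>)"
      then have "Poly_Mapping.keys z \<subseteq> S" "frag_extend \<Phi> z = 0"
        by (auto simp: kernel_def F_def)
      with red'[of z] show "z \<in> ?N" by simp
    qed
    have "R \<subseteq> kernel F ?B (frag_extend \<Phi>)"
      using R kill by (auto simp: kernel_def)
    then show "?N \<subseteq> kernel F ?B (frag_extend \<Phi>)"
      using group_hom.subgroup_kernel[OF h] F.generate_subgroup_incl by blast
  qed
  have "(F Mod ?N) \<cong> ?B"
    using group_hom.FactGroup_iso[OF h surj] ker by simp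
  then show ?thesis
    using B normal.factorgroup_is_group[OF Nn] by (intro free_rankI)
qed

section \<open>Tensor products of free groups of finite rank\<close>

lemma frag_cmul_diff_distrib2: "frag_cmul c (a - b) = frag_cmul c a - frag_cmul c b"
  by (rule poly_mapping_eqI) (simp add: lookup_minus right_diff_distrib)

lemma frag_extend_sum_cmul:
  "finite I \<Longrightarrow> frag_extend f (\<Sum>i\<in>I. frag_cmul (c i) (frag_of (x i))) = (\<Sum>i\<in>I. frag_cmul (c i) (f (x i)))"
  by (simp add: frag_extend_sum frag_extend_cmul o_def)

lemma sum_cmul_in_free_Abelian_group:
  assumes "\<And>i. i \<in> I \<Longrightarrow> x i \<in> S"
  shows "(\<Sum>i\<in>I. frag_cmul (c i) (frag_of (x i))) \<in> carrier (free_Abelian_group S)"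
proof -
  have "Poly_Mapping.keys (\<Sum>i\<in>I. frag_cmul (c i) (frag_of (x i))) \<subseteq>
      (\<Union>i\<in>I. Poly_Mapping.keys (frag_cmul (c i) (frag_of (x i))))"
    by (rule keys_sum)
  also have "\<dots> \<subseteq> S"
    using assms by auto
  finally show ?thesis by simp
qed

text \<open>The elements for which the congruence holds contain the basis and are closed under
  quotients, so \<open>coordinates_induct\<close> reaches the whole group. In applications
  \<open>e\<close> is a tensor as a function of one slot, which is additive only modulo
  \<open>N\<close>.\<close>

lemma coordinate_reduction:
  assumes co: "coordinates G r c g" and G: "group G" and N: "frag_subgroup N"
    and e: "\<And>x y. x \<in> carrier G \<Longrightarrow> y \<in> carrier G \<Longrightarrow> e (x \<otimes>\<^bsub>G\<^esub> y) - e x - e y \<in> N"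
    and x: "x \<in> carrier G"
  shows "e x - (\<Sum>i<r. frag_cmul (c x i) (e (g i))) \<in> N"
proof -
  interpret group G by (rule G)
  have cm: "c (x \<otimes>\<^bsub>G\<^esub> y) i = c x i + c y i" if "x \<in> carrier G" "y \<in> carrier G" for x y i
    by (rule coordinates_mult[OF co that])
  have gc: "g i \<in> carrier G" if "i < r" for i
    by (rule coordinates_closed[OF co that])
  have cg: "c (g i) j = (if i = j then 1 else 0)" if "i < r" for i j
    by (rule coordinates_basis[OF co that])
  have c1: "c \<one>\<^bsub>G\<^esub> i = 0" for i
    using cm[of "\<one>\<^bsub>G\<^esub>" "\<one>\<^bsub>G\<^esub>" i] by simp
  have ci: "c (inv\<^bsub>G\<^esub> x) i = - c x i" if "x \<in> carrier G" for x i
    using cm[of x "inv\<^bsub>G\<^esub> x" i] c1[of i] that by simp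
  have e1: "e \<one>\<^bsub>G\<^esub> \<in> N"
    using frag_subgroup_uminus[OF N e[of "\<one>\<^bsub>G\<^esub>" "\<one>\<^bsub>G\<^esub>"]] by simp
  define P where "P x \<longleftrightarrow> e x - (\<Sum>i<r. frag_cmul (c x i) (e (g i))) \<in> N" for x
  have "P \<one>\<^bsub>G\<^esub>"
    using e1 by (simp add: P_def c1)
  moreover have "\<forall>i<r. P (g i)"
  proof (intro allI impI)
    fix i assume i: "i < r"
    have "(\<Sum>j<r. frag_cmul (c (g i) j) (e (g j))) = (\<Sum>j<r. if j = i then e (g j) else 0)"
      using i by (intro sum.cong) (auto simp: cg)
    also have "\<dots> = e (g i)"
      using i by simp
    finally show "P (g i)"
      using frag_subgroup_zero[OF N] by (simp add: P_def)
  qed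
  moreover have "\<forall>x\<in>carrier G. \<forall>y\<in>carrier G. P x \<longrightarrow> P y \<longrightarrow> P (x \<otimes>\<^bsub>G\<^esub> inv\<^bsub>G\<^esub> y)"
  proof (intro ballI impI)
    fix x y assume xy: "x \<in> carrier G" "y \<in> carrier G" and Pxy: "P x" "P y"
    let ?S = "\<lambda>x. \<Sum>i<r. frag_cmul (c x i) (e (g i))"
    have S: "?S (x \<otimes>\<^bsub>G\<^esub> inv\<^bsub>G\<^esub> y) = ?S x - ?S y"
      using xy by (simp add: cm ci frag_cmul_diff_distrib sum_subtractf)
    \<comment> \<open>An inverse is handled by using additivity twice: the relation for
      \<open>y\<close> and its inverse eliminates \<open>e\<close> of the inverse from the relation
      for the quotient, at the cost of \<open>e \<one>\<close>, which lies in
      \<open>N\<close>.\<close>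
    have 1: "e (x \<otimes>\<^bsub>G\<^esub> inv\<^bsub>G\<^esub> y) - e x - e (inv\<^bsub>G\<^esub> y) \<in> N"
      using e[of x "inv\<^bsub>G\<^esub> y"] xy by simp
    have 2: "e \<one>\<^bsub>G\<^esub> - e y - e (inv\<^bsub>G\<^esub> y) \<in> N"
      using e[of y "inv\<^bsub>G\<^esub> y"] xy by simp
    note 3 = frag_subgroup_add[OF N frag_subgroup_diff[OF N 1 2] e1]
    note 4 = frag_subgroup_diff[OF N Pxy[unfolded P_def]]
    note frag_subgroup_add[OF N 3 4]
    then show "P (x \<otimes>\<^bsub>G\<^esub> inv\<^bsub>G\<^esub> y)"
      unfolding P_def S by (simp add: algebra_simps)
  qed
  ultimately have "P x"
    by (intro coordinates_induct[OF co, of P x] x)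
  then show ?thesis
    by (simp add: P_def)
qed

lemma frag_relation_in_free_Abelian_group:
  assumes "u \<in> S" "v \<in> S" "w \<in> S"
  shows "frag_of u - frag_of v - frag_of w \<in> carrier (free_Abelian_group S)"
proof -
  have "Poly_Mapping.keys (frag_of u - frag_of v - frag_of w) \<subseteq> {u, v, w}"
    using keys_diff[of "frag_of u - frag_of v" "frag_of w"] keys_diff[of "frag_of u" "frag_of v"]
    by auto
  with assms show ?thesis
    unfolding carrier_free_Abelian_group_iff by blast
qed

text \<open>Products of coordinates kill the bilinearity relations because each factor is additive;
  conversely a pure tensor is expanded first in its left slot and then, term by term, in its right
  one.\<close>

lemma free_rank_tensor_group:
  assumes "free_rank G a" "free_rank H b"
  shows "free_rank (tensor_group G H) (a * b)"
proof -
  interpret G: group G using assms(1) by (rule free_rank_group)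
  interpret H: group H using assms(2) by (rule free_rank_group)
  obtain c g where co: "coordinates G a c g"
    using free_rank_coordinates[OF assms(1)] by blast
  obtain d h where dh': "coordinates H b d h"
    using free_rank_coordinates[OF assms(2)] by blast
  have cm: "c (x \<otimes>\<^bsub>G\<^esub> y) i = c x i + c y i" if "x \<in> carrier G" "y \<in> carrier G" for x y i
    by (rule coordinates_mult[OF co that])
  have dm: "d (x \<otimes>\<^bsub>H\<^esub> y) i = d x i + d y i" if "x \<in> carrier H" "y \<in> carrier H" for x y i
    by (rule coordinates_mult[OF dh' that])
  have gc: "g i \<in> carrier G" if "i < a" for i
    by (rule coordinates_closed[OF co that])
  have hc: "h i \<in> carrier H" if "i < b" for i
    by (rule coordinates_closed[OF dh' that])
  have cg: "c (g i) j = (if i = j then 1 else 0)" if "i < a" for i j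
    by (rule coordinates_basis[OF co that])
  have dh: "d (h i) j = (if i = j then 1 else 0)" if "i < b" for i j
    by (rule coordinates_basis[OF dh' that])
  let ?S = "carrier G \<times> carrier H"
  let ?R = "{frag_of (x \<otimes>\<^bsub>G\<^esub> x', y) - frag_of (x, y) - frag_of (x', y) | x x' y.
            x \<in> carrier G \<and> x' \<in> carrier G \<and> y \<in> carrier H} \<union>
         {frag_of (x, y \<otimes>\<^bsub>H\<^esub> y') - frag_of (x, y) - frag_of (x, y') | x y y'.
            x \<in> carrier G \<and> y \<in> carrier H \<and> y' \<in> carrier H}"
  let ?N = "generate (free_Abelian_group ?S) ?R"
  define \<Phi> where "\<Phi> = (\<lambda>(x, y). \<Sum>ij\<in>{..<a} \<times> {..<b}. frag_cmul (c x (fst ij) * d y (snd ij)) (frag_of ij))"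
  define \<Psi> where "\<Psi> = (\<lambda>(i, j). (g i, h j))"
  have R: "?R \<subseteq> carrier (free_Abelian_group ?S)"
    by (intro Un_least subsetI; elim CollectE exE conjE)
      (simp_all only: frag_relation_in_free_Abelian_group mem_Sigma_iff G.m_closed H.m_closed)
  have N: "frag_subgroup ?N"
    using R by (rule frag_subgroup_generate)
  have "free_rank (free_Abelian_group ?S Mod ?N) (a * b)"
  proof (rule free_presentation_rank[where B = "{..<a} \<times> {..<b}" and \<Phi> = \<Phi> and \<Psi> = \<Psi>, OF R])
    show "\<Phi> x \<in> carrier (free_Abelian_group ({..<a} \<times> {..<b}))" for x
      unfolding \<Phi>_def by (cases x) (auto simp del: carrier_free_Abelian_group_iff intro!: sum_cmul_in_free_Abelian_group)
    show "\<Psi> k \<in> ?S" if "k \<in> {..<a} \<times> {..<b}" for k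
      using that gc hc by (auto simp: \<Psi>_def)
    show "\<Phi> (\<Psi> k) = frag_of k" if k: "k \<in> {..<a} \<times> {..<b}" for k
    proof -
      obtain i j where ij: "k = (i, j)" "i < a" "j < b"
        using k by auto
      have "\<Phi> (\<Psi> k) = (\<Sum>l\<in>{..<a} \<times> {..<b}. if l = k then frag_of l else 0)"
        unfolding \<Phi>_def \<Psi>_def ij(1) prod.case
        by (rule sum.cong[OF refl]) (auto simp: cg[OF ij(2)] dh[OF ij(3)])
      also have "\<dots> = frag_of k"
        using k by simp
      finally show ?thesis .
    qed
    have \<Phi>1: "\<Phi> (x \<otimes>\<^bsub>G\<^esub> x', y) = \<Phi> (x, y) + \<Phi> (x', y)" if "x \<in> carrier G" "x' \<in> carrier G" for x x' y
      using that by (simp add: \<Phi>_def cm ring_distribs frag_cmul_distrib sum.distrib)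
    have \<Phi>2: "\<Phi> (x, y \<otimes>\<^bsub>H\<^esub> y') = \<Phi> (x, y) + \<Phi> (x, y')" if "y \<in> carrier H" "y' \<in> carrier H" for x y y'
      using that by (simp add: \<Phi>_def dm ring_distribs frag_cmul_distrib sum.distrib)
    show "frag_extend \<Phi> z = 0" if "z \<in> ?R" for z
      using that by (auto simp: frag_extend_diff \<Phi>1 \<Phi>2)
    show "frag_of x - frag_extend (\<lambda>b. frag_of (\<Psi> b)) (\<Phi> x) \<in> ?N" if "x \<in> ?S" for x
    proof (cases x)
      case (Pair u v)
      with that have u: "u \<in> carrier G" and v: "v \<in> carrier H" by auto
      let ?T = "\<Sum>i<a. frag_cmul (c u i) (frag_of (g i, v))"
      have 1: "frag_of (u, v) - ?T \<in> ?N"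
        by (rule coordinate_reduction[OF co G.is_group N _ u, where e = "\<lambda>u. frag_of (u, v)"])
          (use v in \<open>auto intro!: generate.incl\<close>)
      have 2: "frag_of (g i, v) - (\<Sum>j<b. frag_cmul (d v j) (frag_of (g i, h j))) \<in> ?N" if "i < a" for i
        by (rule coordinate_reduction[OF dh' H.is_group N _ v, where e = "\<lambda>v. frag_of (g i, v)"])
          (use gc[OF that] in \<open>auto intro!: generate.incl\<close>)
      have "(\<Sum>i<a. frag_cmul (c u i) (frag_of (g i, v) - (\<Sum>j<b. frag_cmul (d v j) (frag_of (g i, h j))))) \<in> ?N"
        by (intro frag_subgroup_sum[OF N] frag_subgroup_cmul[OF N] 2) simp
      also have "(\<Sum>i<a. frag_cmul (c u i) (frag_of (g i, v) - (\<Sum>j<b. frag_cmul (d v j) (frag_of (g i, h j)))))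
          = ?T - frag_extend (\<lambda>b. frag_of (\<Psi> b)) (\<Phi> (u, v))"
        by (simp add: \<Phi>_def \<Psi>_def frag_extend_sum_cmul frag_cmul_diff_distrib2 sum_subtractf frag_cmul_sum
            sum.cartesian_product split_def)
      finally have "(frag_of (u, v) - ?T) + (?T - frag_extend (\<lambda>b. frag_of (\<Psi> b)) (\<Phi> (u, v))) \<in> ?N"
        using frag_subgroup_add[OF N 1] by blast
      then show ?thesis using Pair by simp
    qed
  qed auto
  then show ?thesis
    by (simp add: tensor_group_def Let_def)
qed

lemma frag_extend_relation:
  "frag_extend \<Phi> (frag_of u - frag_of v - frag_of w) = \<Phi> u - \<Phi> v - \<Phi> w"
  by (simp add: frag_extend_diff)

lemma sum_PiE_insert:
  fixes h :: "('i \<Rightarrow> 'a) \<Rightarrow> 'b::comm_monoid_add"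
  assumes "k \<notin> J"
  shows "(\<Sum>j\<in>Pi\<^sub>E (insert k J) T. h j) = (\<Sum>j\<in>Pi\<^sub>E J T. \<Sum>t\<in>T k. h (j(k := t)))"
proof -
  have "(\<Sum>j\<in>Pi\<^sub>E (insert k J) T. h j) = (\<Sum>(t, j)\<in>T k \<times> Pi\<^sub>E J T. h (j(k := t)))"
    unfolding PiE_insert_eq
    by (subst sum.reindex[OF inj_combinator[OF assms]]) (simp add: o_def split_def)
  also have "\<dots> = (\<Sum>t\<in>T k. \<Sum>j\<in>Pi\<^sub>E J T. h (j(k := t)))"
    by (simp add: sum.cartesian_product)
  also have "\<dots> = (\<Sum>j\<in>Pi\<^sub>E J T. \<Sum>t\<in>T k. h (j(k := t)))"
    by (rule sum.swap)
  finally show ?thesis .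
qed

text \<open>As for two factors, but the slots are expanded one at a time, by induction over the set
  \<open>J\<close> of slots already treated; \<open>J = I\<close> is the congruence wanted. For
  empty \<open>I\<close> the rank is the empty product 1, in accordance with the convention for the
  zeroth tensor power.\<close>

lemma free_rank_tensor_family:
  assumes I: "finite I" and r: "\<And>i. i \<in> I \<Longrightarrow> free_rank (G i) (r i)"
  shows "free_rank (tensor_family I G) (\<Prod>i\<in>I. r i)"
proof -
  have G: "group (G i)" if "i \<in> I" for i
    using r[OF that] by (rule free_rank_group)
  have "\<forall>i\<in>I. \<exists>cg. coordinates (G i) (r i) (fst cg) (snd cg)"
    using free_rank_coordinates[OF r] by simp
  then obtain cg where cg: "\<forall>i\<in>I. coordinates (G i) (r i) (fst (cg i)) (snd (cg i))"
    by (rule bchoice[THEN exE])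
  define c where "c = (\<lambda>i. fst (cg i))"
  define g where "g = (\<lambda>i. snd (cg i))"
  have co: "coordinates (G i) (r i) (c i) (g i)" if "i \<in> I" for i
    using cg that by (simp add: c_def g_def)
  let ?S = "\<Pi>\<^sub>E i\<in>I. carrier (G i)"
  let ?R = "{frag_of (f(i := x \<otimes>\<^bsub>G i\<^esub> y)) - frag_of (f(i := x)) - frag_of (f(i := y)) | f i x y.
           f \<in> ?S \<and> i \<in> I \<and> x \<in> carrier (G i) \<and> y \<in> carrier (G i)}"
  let ?N = "generate (free_Abelian_group ?S) ?R"
  let ?B = "\<lambda>J. \<Pi>\<^sub>E i\<in>J. {..<r i}"
  define \<Phi> where "\<Phi> = (\<lambda>f. \<Sum>j\<in>?B I. frag_cmul (\<Prod>i\<in>I. c i (f i) (j i)) (frag_of j))"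
  define \<Psi> where "\<Psi> = (\<lambda>j. \<lambda>i\<in>I. g i (j i))"
  have fB: "finite (?B J)" if "J \<subseteq> I" for J
    using that I by (intro finite_PiE) (auto intro: finite_subset)
  have upd: "f(i := x) \<in> ?S" if "f \<in> ?S" "i \<in> I" "x \<in> carrier (G i)" for f i x
    using that by (auto simp: PiE_iff extensional_def)
  have R: "?R \<subseteq> carrier (free_Abelian_group ?S)"
  proof (rule subsetI, elim CollectE exE conjE)
    fix z f i x y
    assume z: "z = frag_of (f(i := x \<otimes>\<^bsub>G i\<^esub> y)) - frag_of (f(i := x)) - frag_of (f(i := y))"
      and f: "f \<in> ?S" "i \<in> I" "x \<in> carrier (G i)" "y \<in> carrier (G i)"
    have "x \<otimes>\<^bsub>G i\<^esub> y \<in> carrier (G i)"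
      using G[OF f(2)] f(3,4) by (simp add: group.is_monoid monoid.m_closed)
    with f show "z \<in> carrier (free_Abelian_group ?S)"
      unfolding z by (intro frag_relation_in_free_Abelian_group upd)
  qed
  have N: "frag_subgroup ?N"
    using R by (rule frag_subgroup_generate)
  have "free_rank (free_Abelian_group ?S Mod ?N) (\<Prod>i\<in>I. r i)"
  proof (rule free_presentation_rank[where B = "?B I" and \<Phi> = \<Phi> and \<Psi> = \<Psi>, OF R])
    show "finite (?B I)" by (rule fB) simp
    show "card (?B I) = (\<Prod>i\<in>I. r i)"
      using I by (simp add: card_PiE)
    show "\<Phi> x \<in> carrier (free_Abelian_group (?B I))" for x
      unfolding \<Phi>_def by (rule sum_cmul_in_free_Abelian_group)
    show \<Psi>S: "\<Psi> j \<in> ?S" if "j \<in> ?B I" for j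
      unfolding \<Psi>_def using that by (intro restrict_PiE_iff[THEN iffD2] ballI coordinates_closed[OF co]) auto
    show "\<Phi> (\<Psi> k) = frag_of k" if k: "k \<in> ?B I" for k
    proof -
      have "(\<Prod>i\<in>I. c i (\<Psi> k i) (j i)) = (if j = k then 1 else 0)" if j: "j \<in> ?B I" for j
      proof -
        have "(\<Prod>i\<in>I. c i (\<Psi> k i) (j i)) = (\<Prod>i\<in>I. if k i = j i then 1 else 0)"
        proof (rule prod.cong[OF refl])
          fix i assume i: "i \<in> I"
          then have "k i < r i" using k by auto
          then show "c i (\<Psi> k i) (j i) = (if k i = j i then 1 else 0)"
            using i coordinates_basis[OF co[OF i]] by (simp add: \<Psi>_def)
        qed
        also have "\<dots> = (if j = k then 1 else 0)"
        proof (cases "j = k")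
          case False
          then obtain i where "i \<in> I" "k i \<noteq> j i"
            using PiE_ext[OF j k] by metis
          with False show ?thesis
            using I by (simp add: prod_zero_iff) auto
        qed simp
        finally show ?thesis .
      qed
      then have "\<Phi> (\<Psi> k) = (\<Sum>j\<in>?B I. if j = k then frag_of j else 0)"
        unfolding \<Phi>_def by (intro sum.cong) auto
      also have "\<dots> = frag_of k"
        using k fB[of I] by simp
      finally show ?thesis .
    qed
    show "frag_extend \<Phi> z = 0" if "z \<in> ?R" for z
      using that
    proof (elim CollectE exE conjE)
      fix f i x y
      assume z: "z = frag_of (f(i := x \<otimes>\<^bsub>G i\<^esub> y)) - frag_of (f(i := x)) - frag_of (f(i := y))"
        and f: "f \<in> ?S" "i \<in> I" "x \<in> carrier (G i)" "y \<in> carrier (G i)"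
      have p: "(\<Prod>k\<in>I. c k ((f(i := u)) k) (j k)) = c i u (j i) * (\<Prod>k\<in>I - {i}. c k (f k) (j k))" for u j
        using I f(2) by (subst prod.remove[of I i]) (auto intro!: prod.cong)
      have "\<Phi> (f(i := x \<otimes>\<^bsub>G i\<^esub> y)) = \<Phi> (f(i := x)) + \<Phi> (f(i := y))"
        unfolding \<Phi>_def p coordinates_mult[OF co[OF f(2)] f(3,4)]
        by (simp add: ring_distribs frag_cmul_distrib sum.distrib)
      then show ?thesis unfolding z frag_extend_relation by simp
    qed
    show "frag_of f - frag_extend (\<lambda>b. frag_of (\<Psi> b)) (\<Phi> f) \<in> ?N" if f: "f \<in> ?S" for f
    proof -
      \<comment> \<open>\<open>e J j\<close> carries basis vectors in the slots \<open>J\<close> and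
        the original entries of \<open>f\<close> elsewhere; \<open>S J\<close> is the partial
        expansion of \<open>f\<close> over these mixed tensors.\<close>
      define e where "e J j = (\<lambda>i\<in>I. if i \<in> J then g i (j i) else f i)" for J j
      define S where "S J = (\<Sum>j\<in>?B J. frag_cmul (\<Prod>i\<in>J. c i (f i) (j i)) (frag_of (e J j)))" for J
      have "frag_of f - S J \<in> ?N" if "J \<subseteq> I" for J
        using finite_subset[OF that I] that
      proof (induction J rule: finite_induct)
        case empty
        \<comment> \<open>The only function in the product over the empty set is constantly
          \<open>undefined\<close>, so \<open>S {}\<close> has the single term
          \<open>f\<close>.\<close>
        have "e {} (\<lambda>x. undefined) = f"
          using f by (auto simp: e_def fun_eq_iff PiE_iff extensional_def)
        then have "S {} = frag_of f"
          by (simp add: S_def)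
        then show ?case
          using frag_subgroup_zero[OF N] by (simp only: diff_self)
      next
        case (insert k J)
        then have k: "k \<in> I" and J: "J \<subseteq> I" by auto
        have eS: "e J j \<in> ?S" if "j \<in> ?B J" for j
          unfolding e_def using that f J
          by (intro restrict_PiE_iff[THEN iffD2] ballI) (auto intro!: coordinates_closed[OF co])
        \<comment> \<open>Writing the entry \<open>f k\<close> as an update exposes slot
          \<open>k\<close> as the variable in which \<open>coordinate_reduction\<close>
          works.\<close>
        have ek: "(e J j)(k := f k) = e J j" for j
          using insert.hyps k by (auto simp: e_def fun_eq_iff)
        have e': "e (insert k J) (j(k := t)) = (e J j)(k := g k t)" for j t
          using insert.hyps k by (auto simp: e_def fun_eq_iff)
        have p: "(\<Prod>i\<in>insert k J. c i (f i) ((j(k := t)) i)) = (\<Prod>i\<in>J. c i (f i) (j i)) * c k (f k) t" for j t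
          using insert.hyps by (simp add: mult.commute) (intro disjI2 prod.cong, auto)
        have S': "S (insert k J) = (\<Sum>j\<in>?B J. frag_cmul (\<Prod>i\<in>J. c i (f i) (j i))
            (\<Sum>t<r k. frag_cmul (c k (f k) t) (frag_of ((e J j)(k := g k t)))))"
          unfolding S_def sum_PiE_insert[OF insert.hyps(2)] e' p
          by (simp add: frag_cmul_sum)
        have "frag_of ((e J j)(k := f k)) - (\<Sum>t<r k. frag_cmul (c k (f k) t) (frag_of ((e J j)(k := g k t)))) \<in> ?N"
          if j: "j \<in> ?B J" for j
        proof (rule coordinate_reduction[OF co[OF k] G[OF k] N, where e = "\<lambda>x. frag_of ((e J j)(k := x))"])
          show "f k \<in> carrier (G k)" using f k by auto
          show "frag_of ((e J j)(k := x \<otimes>\<^bsub>G k\<^esub> y)) - frag_of ((e J j)(k := x)) - frag_of ((e J j)(k := y)) \<in> ?N"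
            if "x \<in> carrier (G k)" "y \<in> carrier (G k)" for x y
            by (rule generate.incl) (use eS[OF j] k that in blast)
        qed
        then have "S J - S (insert k J) \<in> ?N"
          unfolding S' unfolding S_def sum_subtractf[symmetric] frag_cmul_diff_distrib2[symmetric]
          by (intro frag_subgroup_sum[OF N] frag_subgroup_cmul[OF N]) (simp add: ek)
        then have "(frag_of f - S J) + (S J - S (insert k J)) \<in> ?N"
          using insert.IH[OF J] by (intro frag_subgroup_add[OF N])
        moreover have "(frag_of f - S J) + (S J - S (insert k J)) = frag_of f - S (insert k J)"
          by simp
        ultimately show ?case by (simp only:)
      qed
      note this[OF order_refl]
      moreover have "S I = frag_extend (\<lambda>b. frag_of (\<Psi> b)) (\<Phi> f)"
        unfolding \<Phi>_def frag_extend_sum_cmul[OF fB[OF order_refl]] S_def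
        by (intro sum.cong refl arg_cong2[where f = frag_cmul] arg_cong[where f = frag_of])
          (auto simp: e_def \<Psi>_def)
      ultimately show ?thesis by (simp only:)
    qed
  qed
  then show ?thesis
    by (simp add: tensor_family_def Let_def)
qed

lemma free_rank_sum_group:
  assumes I: "finite I" and r: "\<And>i. i \<in> I \<Longrightarrow> free_rank (G i) (r i)"
  shows "free_rank (sum_group I G) (\<Sum>i\<in>I. r i)"
proof (rule free_rankI)
  let ?S = "\<lambda>i. {i} \<times> {..<r i}"
  show "group (sum_group I G)"
    using r by (intro sum_group) (rule free_rank_group)
  have "G i \<cong> free_Abelian_group (?S i)" if "i \<in> I" for i
  proof -
    have "free_rank (free_Abelian_group (?S i)) (r i)"
      by (rule free_rankI[OF _ iso_refl]) auto
    then show ?thesis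
      using free_rank_iso[OF r[OF that]] by blast
  qed
  then have "sum_group I G \<cong> sum_group I (\<lambda>i. free_Abelian_group (?S i))"
    using r by (intro iso_sum_groupI) (auto intro: free_rank_group)
  also have "\<dots> \<cong> free_Abelian_group (\<Union>(?S ` I))"
    by (rule is_isoI[OF iso_free_Abelian_group_sum]) (auto simp: pairwise_def disjnt_def)
  finally show "sum_group I G \<cong> free_Abelian_group (\<Union>i\<in>I. ?S i)" .
  show "finite (\<Union>i\<in>I. ?S i)"
    using I by auto
  show "card (\<Union>i\<in>I. ?S i) = (\<Sum>i\<in>I. r i)"
    using I by (subst card_UN_disjoint) auto
qed

section \<open>Groups of integer-valued functions cut out by linear relations\<close>

definition fun_group :: "('x \<Rightarrow> int) set \<Rightarrow> ('x \<Rightarrow> int) monoid" where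
  "fun_group Z = \<lparr>carrier = Z, monoid.mult = (\<lambda>u v x. u x + v x), one = (\<lambda>x. 0)\<rparr>"

lemma fun_group_simps [simp]:
  "carrier (fun_group Z) = Z" "u \<otimes>\<^bsub>fun_group Z\<^esub> v = (\<lambda>x. u x + v x)" "\<one>\<^bsub>fun_group Z\<^esub> = (\<lambda>x. 0)"
  by (simp_all add: fun_group_def)

lemma group_fun_group:
  assumes zero: "(\<lambda>x. 0) \<in> Z"
    and diff: "\<And>u v. u \<in> Z \<Longrightarrow> v \<in> Z \<Longrightarrow> (\<lambda>x. u x - v x) \<in> Z"
  shows "group (fun_group Z)"
proof (rule groupI; unfold fun_group_simps)
  have neg: "(\<lambda>x. - u x) \<in> Z" if "u \<in> Z" for u
    using diff[OF zero that] by simp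
  show "(\<lambda>x. u x + v x) \<in> Z" if "u \<in> Z" "v \<in> Z" for u v
    using diff[OF that(1) neg[OF that(2)]] by simp
  show "\<exists>v\<in>Z. (\<lambda>x. v x + u x) = (\<lambda>x. 0)" if "u \<in> Z" for u
    using neg[OF that] by (intro bexI[of _ "\<lambda>x. - u x"]) auto
qed (use zero in \<open>auto simp: add.assoc\<close>)

lemma fun_group_isoI:
  assumes "\<And>v. v \<in> Z \<Longrightarrow> \<phi> v \<in> carrier H"
    and "\<And>u v. u \<in> Z \<Longrightarrow> v \<in> Z \<Longrightarrow> \<phi> (\<lambda>x. u x + v x) = \<phi> u \<otimes>\<^bsub>H\<^esub> \<phi> v"
    and "\<And>w. w \<in> carrier H \<Longrightarrow> \<psi> w \<in> Z"
    and "\<And>v. v \<in> Z \<Longrightarrow> \<psi> (\<phi> v) = v"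
    and "\<And>w. w \<in> carrier H \<Longrightarrow> \<phi> (\<psi> w) = w"
  shows "fun_group Z \<cong> H"
proof (rule is_isoI[of \<phi>], rule isoI)
  show "\<phi> \<in> hom (fun_group Z) H"
    using assms by (intro homI) auto
  show "bij_betw \<phi> (carrier (fun_group Z)) (carrier H)"
    using assms by (intro bij_betw_byWitness[where f' = \<psi>]) auto
qed

lemma
  fixes Z :: "('x \<Rightarrow> int) set"
  assumes "(\<lambda>x. 0) \<in> Z \<and> (\<forall>u\<in>Z. \<forall>v\<in>Z. (\<lambda>x. u x - v x) \<in> Z)"
  shows fun_group_neg: "u \<in> Z \<Longrightarrow> (\<lambda>x. - u x) \<in> Z"
    and fun_group_add: "u \<in> Z \<Longrightarrow> v \<in> Z \<Longrightarrow> (\<lambda>x. u x + v x) \<in> Z"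
    and fun_group_cmul: "u \<in> Z \<Longrightarrow> (\<lambda>x. k * u x) \<in> Z"
proof -
  have zero: "(\<lambda>x. 0) \<in> Z"
    using assms by blast
  have diff: "(\<lambda>x. u x - v x) \<in> Z" if "u \<in> Z" "v \<in> Z" for u v
    using assms that by blast
  show neg: "(\<lambda>x. - u x) \<in> Z" if "u \<in> Z" for u
    using diff[OF zero that] by simp
  show add: "(\<lambda>x. u x + v x) \<in> Z" if "u \<in> Z" "v \<in> Z" for u v
    using diff[OF that(1) neg[OF that(2)]] by simp
  show "(\<lambda>x. k * u x) \<in> Z" if u: "u \<in> Z" for u
  proof (induction k rule: int_induct[where k = 0])
    case base
    then show ?case using zero by simp
  next
    case (step1 i)
    then show ?case using add[OF step1(2) u] by (simp add: ring_distribs)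
  next
    case (step2 i)
    then show ?case using diff[OF step2(2) u] by (simp add: ring_distribs)
  qed
qed

text \<open>\<open>v0\<close> splits the map \<open>q\<close> onto the integers: every
  \<open>v\<close> is its part \<open>v - q v * v0\<close> in the kernel plus a multiple of
  \<open>v0\<close>. The isomorphism sends the kernel part to the old generators below
  \<open>r\<close> and records \<open>q v\<close> at the new index \<open>r\<close>.\<close>

lemma free_rank_fun_group_extend:
  assumes zero: "(\<lambda>x. 0) \<in> Z"
    and diff: "\<And>u v. u \<in> Z \<Longrightarrow> v \<in> Z \<Longrightarrow> (\<lambda>x. u x - v x) \<in> Z"
    and q_add: "\<And>u v. u \<in> Z \<Longrightarrow> v \<in> Z \<Longrightarrow> q (\<lambda>x. u x + v x) = q u + q v"
    and v0: "v0 \<in> Z" "q v0 = (1::int)"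
    and r: "free_rank (fun_group {v \<in> Z. q v = 0}) r"
  shows "free_rank (fun_group Z) (Suc r)"
proof -
  let ?Z' = "{v \<in> Z. q v = 0}"
  have closed: "(\<lambda>x. 0) \<in> Z \<and> (\<forall>u\<in>Z. \<forall>v\<in>Z. (\<lambda>x. u x - v x) \<in> Z)"
    using zero diff by blast
  note neg = fun_group_neg[OF closed] and add = fun_group_add[OF closed] and cmul = fun_group_cmul[OF closed]
  have q0: "q (\<lambda>x. 0) = 0"
    using q_add[OF zero zero] by simp
  have q_neg: "q (\<lambda>x. - u x) = - q u" if "u \<in> Z" for u
    using q_add[OF that neg[OF that]] q0 by simp
  have q_cmul: "q (\<lambda>x. k * u x) = k * q u" if u: "u \<in> Z" for k u
  proof (induction k rule: int_induct[where k = 0])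
    case base
    then show ?case using q0 by simp
  next
    case (step1 i)
    then show ?case using q_add[OF cmul[OF u, of i] u] by (simp add: ring_distribs)
  next
    case (step2 i)
    then show ?case using q_add[OF cmul[OF u, of i] neg[OF u]] q_neg[OF u] by (simp add: ring_distribs)
  qed
  interpret Z': group "fun_group ?Z'" using r by (rule free_rank_group)
  let ?F = "free_Abelian_group {..<r}"
  obtain \<phi> \<psi> where "group_isomorphisms (fun_group ?Z') ?F \<phi> \<psi>"
    using r Z'.iso_iff_group_isomorphisms[of _ ?F] unfolding free_rank_def is_iso_def by blast
  then have \<phi>: "\<phi> \<in> hom (fun_group ?Z') ?F" and \<psi>: "\<psi> \<in> hom ?F (fun_group ?Z')"
    and \<psi>\<phi>: "\<And>v. v \<in> ?Z' \<Longrightarrow> \<psi> (\<phi> v) = v"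
    and \<phi>\<psi>: "\<And>c. c \<in> carrier ?F \<Longrightarrow> \<phi> (\<psi> c) = c"
    by (auto simp: group_isomorphisms_def simp del: carrier_free_Abelian_group_iff)
  have \<phi>c: "\<phi> v \<in> carrier ?F" if "v \<in> ?Z'" for v
    using hom_in_carrier[OF \<phi>, of v] that by simp
  have \<psi>c: "\<psi> c \<in> ?Z'" if "c \<in> carrier ?F" for c
    using hom_in_carrier[OF \<psi> that] unfolding fun_group_simps .
  have \<phi>add: "\<phi> (\<lambda>x. u x + v x) = \<phi> u + \<phi> v" if "u \<in> ?Z'" "v \<in> ?Z'" for u v
    using hom_mult[OF \<phi>, of u v] that by simp
  define p where "p v = (\<lambda>x. v x - q v * v0 x)" for v
  have pZ': "p v \<in> ?Z'" if v: "v \<in> Z" for v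
  proof -
    have "q (\<lambda>x. v x + (- q v) * v0 x) = 0"
      using q_add[OF v cmul[OF v0(1)], of "- q v"] q_cmul[OF v0(1), of "- q v"] v0(2) by simp
    then show ?thesis
      unfolding p_def using add[OF v cmul[OF v0(1)], of "- q v"] by simp
  qed
  have p_add: "p (\<lambda>x. u x + v x) = (\<lambda>x. p u x + p v x)" if "u \<in> Z" "v \<in> Z" for u v
    unfolding p_def q_add[OF that] by (simp add: algebra_simps)
  let ?F' = "free_Abelian_group {..<Suc r}"
  define h where "h v = \<phi> (p v) + frag_cmul (q v) (frag_of r)" for v
  define c' where "c' c = c - frag_cmul (Poly_Mapping.lookup c r) (frag_of r)" for c :: "nat \<Rightarrow>\<^sub>0 int"
  define k where "k c = (\<lambda>x. \<psi> (c' c) x + Poly_Mapping.lookup c r * v0 x)" for c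
  have c'F: "c' c \<in> carrier ?F" if "c \<in> carrier ?F'" for c
  proof -
    have "i < r" if i: "Poly_Mapping.lookup (c' c) i \<noteq> 0" for i
    proof -
      have "i \<noteq> r" using i by (auto simp: c'_def lookup_minus)
      moreover from this i have "i \<in> Poly_Mapping.keys c"
        by (simp add: c'_def lookup_minus lookup_single in_keys_iff when_def)
      ultimately show ?thesis
        using \<open>c \<in> carrier ?F'\<close> by (auto simp: less_Suc_eq)
    qed
    then show ?thesis by (auto simp: in_keys_iff)
  qed
  have \<phi>r: "Poly_Mapping.lookup (\<phi> v) r = 0" if "v \<in> ?Z'" for v
    using \<phi>c[OF that] by (auto simp: in_keys_iff)
  have "fun_group Z \<cong> ?F'"
  proof (rule fun_group_isoI[where \<phi> = h and \<psi> = k])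
    show "h v \<in> carrier ?F'" if "v \<in> Z" for v
    proof -
      have "Poly_Mapping.keys (h v) \<subseteq> Poly_Mapping.keys (\<phi> (p v)) \<union> {r}"
        unfolding h_def using keys_add[of "\<phi> (p v)" "frag_cmul (q v) (frag_of r)"] by auto
      then show ?thesis using \<phi>c[OF pZ'[OF that]] by auto
    qed
    show "h (\<lambda>x. u x + v x) = h u \<otimes>\<^bsub>?F'\<^esub> h v" if "u \<in> Z" "v \<in> Z" for u v
      unfolding h_def p_add[OF that] q_add[OF that] \<phi>add[OF pZ'[OF that(1)] pZ'[OF that(2)]]
      by (simp add: frag_cmul_distrib)
    show "k c \<in> Z" if "c \<in> carrier ?F'" for c
      unfolding k_def using \<psi>c[OF c'F[OF that]] by (intro add cmul v0(1)) simp
    show "k (h v) = v" if v: "v \<in> Z" for v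
    proof -
      have 1: "Poly_Mapping.lookup (h v) r = q v"
        by (simp add: h_def lookup_add \<phi>r[OF pZ'[OF v]])
      have 2: "c' (h v) = \<phi> (p v)"
        by (simp add: c'_def 1) (simp add: h_def)
      show ?thesis
        unfolding k_def 1 2 \<psi>\<phi>[OF pZ'[OF v]] by (simp add: p_def)
    qed
    show "h (k c) = c" if c: "c \<in> carrier ?F'" for c
    proof -
      let ?l = "Poly_Mapping.lookup c r"
      have \<psi>Z: "\<psi> (c' c) \<in> Z" "q (\<psi> (c' c)) = 0" using \<psi>c[OF c'F[OF c]] by simp_all
      have 1: "q (k c) = ?l"
        unfolding k_def using q_add[OF \<psi>Z(1) cmul[OF v0(1)], of ?l] q_cmul[OF v0(1), of ?l] \<psi>Z(2) v0(2)
        by simp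
      have "p (k c) = \<psi> (c' c)"
        unfolding p_def 1 by (simp add: k_def)
      then have "\<phi> (p (k c)) = c' c"
        using \<phi>\<psi>[OF c'F[OF c]] by simp
      then show ?thesis
        unfolding h_def 1 by (simp add: c'_def)
    qed
  qed
  then show ?thesis
    by (intro free_rankI[of _ "{..<Suc r}"] group_fun_group zero diff) auto
qed

text \<open>Subgroups of a free group of finite rank are free, proved one point of the support at a
  time: the values at \<open>a\<close> form a subgroup of the integers, and either it is zero or its
  positive generator splits off one rank.\<close>

lemma free_rank_fun_group:
  assumes "finite X"
    and supp: "\<And>v x. v \<in> Z \<Longrightarrow> x \<notin> X \<Longrightarrow> v x = 0"
    and zero: "(\<lambda>x. 0) \<in> Z"
    and diff: "\<And>u v. u \<in> Z \<Longrightarrow> v \<in> Z \<Longrightarrow> (\<lambda>x. u x - v x) \<in> Z"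
  shows "\<exists>r. free_rank (fun_group Z) r"
  using assms
proof (induction X arbitrary: Z rule: finite_induct)
  case empty
  have "v = (\<lambda>x. 0)" if "v \<in> Z" for v
    using empty.prems(1)[OF that] by auto
  with empty.prems(2) have Z: "Z = {\<lambda>x. 0}" by blast
  have "fun_group Z \<cong> free_Abelian_group {}"
    by (rule fun_group_isoI[where \<phi> = "\<lambda>_. 0" and \<psi> = "\<lambda>_ _. 0"]) (auto simp: Z)
  then have "free_rank (fun_group Z) 0"
    by (intro free_rankI[of _ "{}"] group_fun_group) (auto simp: Z)
  then show ?case by blast
next
  case (insert a X)
  define Z' where "Z' = {v \<in> Z. v a = 0}"
  have zero: "(\<lambda>x. 0) \<in> Z" by (rule insert.prems(2))
  have diff: "(\<lambda>x. u x - v x) \<in> Z" if "u \<in> Z" "v \<in> Z" for u v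
    using that by (rule insert.prems(3))
  have closed: "(\<lambda>x. 0) \<in> Z \<and> (\<forall>u\<in>Z. \<forall>v\<in>Z. (\<lambda>x. u x - v x) \<in> Z)"
    using zero diff by blast
  note neg = fun_group_neg[OF closed] and cmul = fun_group_cmul[OF closed]
  have "\<exists>r. free_rank (fun_group Z') r"
  proof (rule insert.IH)
    show "v x = 0" if "v \<in> Z'" "x \<notin> X" for v x
      using that insert.prems(1)[of v x] by (cases "x = a") (auto simp: Z'_def)
  qed (use zero diff in \<open>auto simp: Z'_def\<close>)
  then obtain r where r: "free_rank (fun_group Z') r" ..
  show ?case
  proof (cases "\<forall>v\<in>Z. v a = 0")
    case True
    then have "Z' = Z" by (auto simp: Z'_def)
    with r show ?thesis by blast
  next
    case False
    then obtain v1 where v1: "v1 \<in> Z" "v1 a \<noteq> 0" by blast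
    \<comment> \<open>The least element \<open>d\<close> of this set generates the values at
      \<open>a\<close>. A value not divisible by \<open>d\<close> would leave a smaller positive
      remainder, which is attained as well after subtracting a multiple of
      \<open>v0\<close>.\<close>
    define D where "D = {k. k > 0 \<and> (\<exists>v\<in>Z. v a = int k)}"
    have "nat \<bar>v1 a\<bar> \<in> D"
    proof (cases "v1 a > 0")
      case True
      then show ?thesis using v1 unfolding D_def by (intro CollectI conjI bexI[of _ v1]) auto
    next
      case False
      then show ?thesis using v1 neg[OF v1(1)] unfolding D_def
        by (intro CollectI conjI bexI[of _ "\<lambda>x. - v1 x"]) auto
    qed
    define d where "d = (LEAST k. k \<in> D)"
    have "d \<in> D"
      unfolding d_def by (rule LeastI) fact
    then obtain v0 where d: "d > 0" and v0: "v0 \<in> Z" "v0 a = int d"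
      by (auto simp: D_def)
    define q where "q v = v a div int d" for v :: "'a \<Rightarrow> int"
    have dvd: "v a = q v * int d" if v: "v \<in> Z" for v
    proof (rule ccontr)
      assume neq: "v a \<noteq> q v * int d"
      let ?w = "\<lambda>x. v x - q v * v0 x"
      have wZ: "?w \<in> Z" by (intro diff v cmul v0)
      have w: "?w a = v a mod int d"
        by (simp add: v0 q_def minus_div_mult_eq_mod)
      have "v a mod int d > 0"
        using neq d w v0 by (metis eq_iff_diff_eq_0 le_less of_nat_0_less_iff pos_mod_sign)
      then have "nat (v a mod int d) \<in> D"
        unfolding D_def using wZ w by (intro CollectI conjI bexI[of _ ?w]) auto
      then have "d \<le> nat (v a mod int d)"
        unfolding d_def by (rule Least_le)
      moreover have "v a mod int d < int d"
        using d by simp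
      ultimately show False using d by linarith
    qed
    have q_add: "q (\<lambda>x. u x + v x) = q u + q v" if "u \<in> Z" "v \<in> Z" for u v
    proof -
      have "u a + v a = (q u + q v) * int d"
        using dvd[OF that(1)] dvd[OF that(2)] by (simp add: ring_distribs)
      then show ?thesis
        using d unfolding q_def[of "\<lambda>x. u x + v x"] by (simp only:) simp
    qed
    have "v a = 0 \<longleftrightarrow> q v = 0" if "v \<in> Z" for v
      using dvd[OF that] d by auto
    then have "Z' = {v \<in> Z. q v = 0}"
      by (auto simp: Z'_def)
    moreover have "q v0 = 1"
      using d by (simp add: q_def v0)
    ultimately have "free_rank (fun_group Z) (Suc r)"
      using r by (intro free_rank_fun_group_extend[of Z q v0] zero diff q_add v0) simp_all
    then show ?thesis by blast
  qed
qed

text \<open>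
  The top homology of a simplicial complex is its group of top cycles: functions on the set \<open>X\<close> of
  facets whose sum over the facets containing a given ridge vanishes. A family \<open>FF\<close> of subsets of
  \<open>X\<close> stands for the ridges. No signs occur: in the order complex of a graded poset a ridge misses
  exactly one rank, so all facets around it induce the same sign.
\<close>

definition relker :: "'x set \<Rightarrow> 'x set set \<Rightarrow> ('x \<Rightarrow> int) set" where
  "relker X FF = {v. (\<forall>x. x \<notin> X \<longrightarrow> v x = 0) \<and> (\<forall>F\<in>FF. (\<Sum>x\<in>F. v x) = 0)}"

text \<open>At most one number fits the description, by \<open>free_rank_unique\<close>; for finite
  \<open>X\<close> there is one, by \<open>free_rank_relker\<close>.\<close>

definition relrank :: "'x set \<Rightarrow> 'x set set \<Rightarrow> nat" where
  "relrank X FF = (THE r. free_rank (fun_group (relker X FF)) r)"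

lemma group_relker: "group (fun_group (relker X FF))"
  by (rule group_fun_group) (auto simp: relker_def sum_subtractf)

lemma free_rank_relker:
  assumes "finite X"
  shows "free_rank (fun_group (relker X FF)) (relrank X FF)"
proof -
  have "\<exists>r. free_rank (fun_group (relker X FF)) r"
    using assms by (rule free_rank_fun_group) (auto simp: relker_def sum_subtractf)
  then show ?thesis
    unfolding relrank_def by (blast intro: theI free_rank_unique)
qed

lemma relrank_eqI:
  assumes "free_rank (fun_group (relker X FF)) r"
  shows "relrank X FF = r"
  unfolding relrank_def using assms by (blast intro: the_equality free_rank_unique)

lemma relrank_iso:
  assumes "finite Y" "fun_group (relker X FF) \<cong> fun_group (relker Y GG)"
  shows "relrank X FF = relrank Y GG"
  by (rule relrank_eqI, rule free_rank_cong[OF free_rank_relker[OF assms(1)] group_relker assms(2)])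

text \<open>The empty relation constrains nothing. A set contained in no facet has an empty star, so
  families of stars have to match only up to the empty set, which removes many side conditions
  later.\<close>

lemma relrank_empty_rels:
  "FF \<union> {{}} = GG \<union> {{}} \<Longrightarrow> relrank X FF = relrank X GG"
proof -
  assume "FF \<union> {{}} = GG \<union> {{}}"
  moreover have "relker X FF = relker X (FF \<union> {{}})" for FF :: "'a set set"
    by (auto simp: relker_def)
  ultimately have "relker X FF = relker X GG" by metis
  then show ?thesis by (simp add: relrank_def)
qed

lemma relrank_bij:
  assumes fin: "finite X" and bij: "bij_betw \<phi> X Y" and FF: "FF \<subseteq> Pow X"
    and im: "(`) \<phi> ` FF \<union> {{}} = GG \<union> {{}}"
  shows "relrank Y GG = relrank X FF"
proof -
  define \<psi> where "\<psi> = inv_into X \<phi>"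
  have inj: "inj_on \<phi> X" and Y: "\<phi> ` X = Y"
    using bij by (auto simp: bij_betw_def)
  have \<psi>\<phi>: "\<psi> (\<phi> x) = x" if "x \<in> X" for x
    using that inj by (simp add: \<psi>_def)
  have \<phi>\<psi>: "\<phi> (\<psi> y) = y" "\<psi> y \<in> X" if "y \<in> Y" for y
    using that Y by (auto simp: \<psi>_def f_inv_into_f inv_into_into)
  have s: "(\<Sum>y\<in>\<phi> ` F. v y) = (\<Sum>x\<in>F. v (\<phi> x))" if "F \<subseteq> X" for F and v :: "_ \<Rightarrow> int"
    using that inj by (subst sum.reindex) (auto intro: inj_on_subset)
  have "relrank Y GG = relrank Y ((`) \<phi> ` FF)"
    using im by (intro relrank_empty_rels) simp
  also have "\<dots> = relrank X FF"
  proof (rule relrank_iso[OF fin])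
    let ?f = "\<lambda>v x. if x \<in> X then v (\<phi> x) else 0"
    let ?g = "\<lambda>v y. if y \<in> Y then v (\<psi> y) else 0"
    show "fun_group (relker Y ((`) \<phi> ` FF)) \<cong> fun_group (relker X FF)"
    proof (rule fun_group_isoI[where \<phi> = ?f and \<psi> = ?g]; (unfold fun_group_simps)?)
      show "?f v \<in> relker X FF" if v: "v \<in> relker Y ((`) \<phi> ` FF)" for v
      proof -
        have "(\<Sum>x\<in>F. ?f v x) = 0" if F: "F \<in> FF" for F
        proof -
          have "(\<Sum>x\<in>F. ?f v x) = (\<Sum>x\<in>F. v (\<phi> x))"
            using F FF by (intro sum.cong) auto
          also have "\<dots> = 0"
            using v F FF s[of F v] by (auto simp: relker_def)
          finally show ?thesis .
        qed
        then show ?thesis by (simp add: relker_def)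
      qed
      show "?g v \<in> relker Y ((`) \<phi> ` FF)" if v: "v \<in> relker X FF" for v
      proof -
        have "(\<Sum>y\<in>\<phi> ` F. ?g v y) = 0" if F: "F \<in> FF" for F
        proof -
          have "(\<Sum>y\<in>\<phi> ` F. ?g v y) = (\<Sum>x\<in>F. ?g v (\<phi> x))"
            using F FF by (intro s) auto
          also have "\<dots> = (\<Sum>x\<in>F. v x)"
          proof (rule sum.cong[OF refl])
            fix x assume "x \<in> F"
            then have "x \<in> X" using F FF by auto
            then show "?g v (\<phi> x) = v x" using Y \<psi>\<phi> by auto
          qed
          also have "\<dots> = 0"
            using v F by (auto simp: relker_def)
          finally show ?thesis .
        qed
        then show ?thesis by (simp add: relker_def)
      qed
      show "?g (?f v) = v" if "v \<in> relker Y ((`) \<phi> ` FF)" for v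
        using that \<phi>\<psi> by (auto simp: relker_def fun_eq_iff)
      show "?f (?g v) = v" if "v \<in> relker X FF" for v
        using that \<psi>\<phi> Y by (auto simp: relker_def fun_eq_iff)
    qed auto
  qed
  finally show ?thesis .
qed

lemma relrank_bij':
  assumes fin: "finite X" and bij: "bij_betw \<phi> X Y" and FF: "FF \<subseteq> Pow X"
    and 1: "\<And>F. F \<in> FF \<Longrightarrow> F \<noteq> {} \<Longrightarrow> \<phi> ` F \<in> GG"
    and 2: "\<And>G. G \<in> GG \<Longrightarrow> G \<noteq> {} \<Longrightarrow> \<exists>F\<in>FF. \<phi> ` F = G"
  shows "relrank Y GG = relrank X FF"
proof (rule relrank_bij[OF fin bij FF])
  show "(`) \<phi> ` FF \<union> {{}} = GG \<union> {{}}"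
  proof (intro equalityI subsetI)
    fix G assume "G \<in> (`) \<phi> ` FF \<union> {{}}"
    then show "G \<in> GG \<union> {{}}" using 1 by auto
  next
    fix G assume "G \<in> GG \<union> {{}}"
    then show "G \<in> (`) \<phi> ` FF \<union> {{}}" using 2 by blast
  qed
qed

text \<open>No relation meets two pieces, so a solution is the same as a family of solutions:
  restriction to the pieces in one direction, summation in the other.\<close>

lemma relrank_disjoint_union:
  assumes I: "finite I" and fin: "\<And>i. i \<in> I \<Longrightarrow> finite (X i)"
    and disj: "\<And>i j. i \<in> I \<Longrightarrow> j \<in> I \<Longrightarrow> i \<noteq> j \<Longrightarrow> X i \<inter> X j = {}"
    and FF: "\<And>i. i \<in> I \<Longrightarrow> FF i \<subseteq> Pow (X i)"
  shows "relrank (\<Union>i\<in>I. X i) (\<Union>i\<in>I. FF i) = (\<Sum>i\<in>I. relrank (X i) (FF i))"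
proof (rule relrank_eqI)
  let ?G = "sum_group I (\<lambda>i. fun_group (relker (X i) (FF i)))"
  have rG: "free_rank ?G (\<Sum>i\<in>I. relrank (X i) (FF i))"
    by (intro free_rank_sum_group I free_rank_relker fin)
  have carG: "carrier ?G = (\<Pi>\<^sub>E i\<in>I. relker (X i) (FF i))"
    using I by (subst carrier_sum_group) (auto intro: group_relker)
  let ?f = "\<lambda>v. \<lambda>i\<in>I. \<lambda>x. if x \<in> X i then v x else 0"
  let ?g = "\<lambda>w x. \<Sum>i\<in>I. w i x"
  have supp: "w i x = 0" if "w \<in> carrier ?G" "i \<in> I" "x \<notin> X i" for w i x
    using that unfolding carG by (auto simp: relker_def PiE_iff)
  have g: "?g w x = w i x" if w: "w \<in> carrier ?G" and i: "i \<in> I" and x: "x \<in> X i" for w i x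
  proof -
    have "?g w x = (\<Sum>j\<in>{i}. w j x)"
    proof (rule sum.mono_neutral_right)
      show "\<forall>j\<in>I - {i}. w j x = 0"
      proof
        fix j assume j: "j \<in> I - {i}"
        then have "x \<notin> X j" using disj[of i j] i x by auto
        with j show "w j x = 0" using supp[OF w] by simp
      qed
    qed (use I i in auto)
    then show ?thesis by simp
  qed
  have "fun_group (relker (\<Union>i\<in>I. X i) (\<Union>i\<in>I. FF i)) \<cong> ?G"
  proof (rule fun_group_isoI[where \<phi> = ?f and \<psi> = ?g])
    show "?f v \<in> carrier ?G" if v: "v \<in> relker (\<Union>i\<in>I. X i) (\<Union>i\<in>I. FF i)" for v
    proof -
      have "(\<lambda>x. if x \<in> X i then v x else 0) \<in> relker (X i) (FF i)" if i: "i \<in> I" for i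
      proof -
        have "(\<Sum>x\<in>F. if x \<in> X i then v x else 0) = (\<Sum>x\<in>F. v x)" if "F \<in> FF i" for F
          using that FF[OF i] by (intro sum.cong) auto
        then show ?thesis using v i by (auto simp: relker_def)
      qed
      then show ?thesis unfolding carG by auto
    qed
    show "?f (\<lambda>x. u x + v x) = ?f u \<otimes>\<^bsub>?G\<^esub> ?f v" for u v
      by (auto simp: fun_eq_iff)
    show "?g w \<in> relker (\<Union>i\<in>I. X i) (\<Union>i\<in>I. FF i)" if w: "w \<in> carrier ?G" for w
    proof -
      have "(\<Sum>x\<in>F. ?g w x) = 0" if i: "i \<in> I" and F: "F \<in> FF i" for i F
      proof -
        have "(\<Sum>x\<in>F. ?g w x) = (\<Sum>x\<in>F. w i x)"
          using F FF[OF i] by (intro sum.cong refl g[OF w i]) auto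
        also have "\<dots> = 0"
          using w i F unfolding carG by (auto simp: relker_def PiE_iff)
        finally show ?thesis .
      qed
      then show ?thesis using supp[OF w] by (auto simp: relker_def)
    qed
    show "?g (?f v) = v" if v: "v \<in> relker (\<Union>i\<in>I. X i) (\<Union>i\<in>I. FF i)" for v
    proof
      fix x
      show "?g (?f v) x = v x"
      proof (cases "\<exists>i\<in>I. x \<in> X i")
        case True
        then obtain i where i: "i \<in> I" "x \<in> X i" by blast
        have "(\<Sum>j\<in>I. ?f v j x) = (\<Sum>j\<in>{i}. ?f v j x)"
        proof (rule sum.mono_neutral_right)
          show "\<forall>j\<in>I - {i}. ?f v j x = 0"
            using disj[OF i(1)] i(2) by auto
        qed (use I i in auto)
        then show ?thesis using i by simp
      next
        case False
        then show ?thesis using v by (auto simp: relker_def intro!: sum.neutral)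
      qed
    qed
    show "?f (?g w) = w" if w: "w \<in> carrier ?G" for w
    proof
      fix i
      show "?f (?g w) i = w i"
        using w supp[OF w] g[OF w] unfolding carG by (cases "i \<in> I") (auto simp: fun_eq_iff PiE_iff extensional_def)
    qed
  qed
  then show "free_rank (fun_group (relker (\<Union>i\<in>I. X i) (\<Union>i\<in>I. FF i))) (\<Sum>i\<in>I. relrank (X i) (FF i))"
    by (rule free_rank_cong[OF rG group_relker])
qed

section \<open>Products of systems of relations\<close>

lemma sum_times_singleton: "(\<Sum>p\<in>F \<times> {y}. f p) = (\<Sum>x\<in>F. f (x, y))"
  by (simp add: sum.cartesian_product')

lemma sum_singleton_times: "(\<Sum>p\<in>{x} \<times> G. f p) = (\<Sum>y\<in>G. f (x, y))"
  by (simp add: sum.cartesian_product')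

lemma relker_cmul: "v \<in> relker X FF \<Longrightarrow> (\<lambda>x. k * v x) \<in> relker X FF"
  by (auto simp: relker_def simp flip: sum_distrib_left)

lemma relker_zero: "(\<lambda>x. 0) \<in> relker X FF"
  by (simp add: relker_def)

lemma relker_add: "u \<in> relker X FF \<Longrightarrow> v \<in> relker X FF \<Longrightarrow> (\<lambda>x. u x + v x) \<in> relker X FF"
  by (auto simp: relker_def sum.distrib)

lemma relker_sum:
  "(\<And>i. i \<in> I \<Longrightarrow> u i \<in> relker X FF) \<Longrightarrow> (\<lambda>x. \<Sum>i\<in>I. u i x) \<in> relker X FF"
  by (induction I rule: infinite_finite_induct) (auto intro: relker_zero relker_add)

lemma relker_additive_sum:
  fixes d :: "('x \<Rightarrow> int) \<Rightarrow> int"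
  assumes add: "\<And>u v. u \<in> relker X FF \<Longrightarrow> v \<in> relker X FF \<Longrightarrow> d (\<lambda>x. u x + v x) = d u + d v"
    and u: "\<And>j. j \<in> I \<Longrightarrow> u j \<in> relker X FF"
  shows "d (\<lambda>x. \<Sum>j\<in>I. u j x) = (\<Sum>j\<in>I. d (u j))"
proof -
  have "d (\<lambda>x. 0) = 0"
    using add[OF relker_zero relker_zero] by simp
  then show ?thesis
    using u by (induction I rule: infinite_finite_induct) (simp_all add: add relker_sum)
qed

text \<open>Supplies a basis consisting of functions, with an expansion valid at every point; this
  turns a function on a product into coefficient functions of one variable.\<close>

lemma relker_coordinates:
  assumes "finite X"
  obtains c g where
    "\<And>u v i. u \<in> relker X FF \<Longrightarrow> v \<in> relker X FF \<Longrightarrow> c (\<lambda>x. u x + v x) i = c u i + c v i"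
    "\<And>k v i. v \<in> relker X FF \<Longrightarrow> c (\<lambda>x. k * v x) i = k * c v i"
    "\<And>i. i < relrank X FF \<Longrightarrow> g i \<in> relker X FF"
    "\<And>i j. i < relrank X FF \<Longrightarrow> c (g i) j = (if i = j then 1 else 0)"
    "\<And>v x. v \<in> relker X FF \<Longrightarrow> v x = (\<Sum>i<relrank X FF. c v i * g i x)"
proof -
  let ?K = "relker X FF"
  let ?G = "fun_group ?K"
  let ?a = "relrank X FF"
  interpret K: group ?G by (rule group_relker)
  obtain c g where co: "coordinates ?G ?a c g"
    using free_rank_coordinates[OF free_rank_relker[OF assms]] by blast
  have add: "c (\<lambda>x. u x + v x) i = c u i + c v i" if "u \<in> ?K" "v \<in> ?K" for u v i
    using coordinates_mult[OF co, of u v i] that by simp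
  have gK: "g i \<in> ?K" if "i < ?a" for i
    using coordinates_closed[OF co that] by simp
  have zero: "c (\<lambda>x. 0) i = 0" for i
    using add[OF relker_zero relker_zero, of i] by simp
  have neg: "c (\<lambda>x. - v x) i = - c v i" if "v \<in> ?K" for v i
    using add[OF that relker_cmul[OF that, of "-1"], of i] zero[of i] by simp
  have cmul: "c (\<lambda>x. k * v x) i = k * c v i" if v: "v \<in> ?K" for k v i
  proof (induction k rule: int_induct[where k = 0])
    case base
    then show ?case by (simp add: zero)
  next
    case (step1 k)
    then show ?case
      using add[OF relker_cmul[OF v, of k] v, of i] by (simp add: ring_distribs)
  next
    case (step2 k)
    have "(\<lambda>x. - v x) \<in> ?K" using relker_cmul[OF v, of "-1"] by simp
    then show ?case
      using step2(2) add[OF relker_cmul[OF v, of k], of "\<lambda>x. - v x" i] neg[OF v]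
      by (simp add: ring_distribs)
  qed
  have "\<forall>x. v x = (\<Sum>i<?a. c v i * g i x)" if v: "v \<in> ?K" for v
  proof (rule coordinates_induct[OF co, where P = "\<lambda>v. \<forall>x. v x = (\<Sum>i<?a. c v i * g i x)"])
    show "\<forall>x. \<one>\<^bsub>?G\<^esub> x = (\<Sum>i<?a. c \<one>\<^bsub>?G\<^esub> i * g i x)"
      by (simp add: zero)
    show "\<forall>j<?a. \<forall>x. g j x = (\<Sum>i<?a. c (g j) i * g i x)"
    proof (intro allI impI)
      fix j x assume j: "j < ?a"
      have "(\<Sum>i<?a. c (g j) i * g i x) = (\<Sum>i<?a. if i = j then g i x else 0)"
        by (intro sum.cong refl) (auto simp: coordinates_basis[OF co j])
      then show "g j x = (\<Sum>i<?a. c (g j) i * g i x)"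
        using j by simp
    qed
    show "\<forall>u\<in>carrier ?G. \<forall>v\<in>carrier ?G. (\<forall>x. u x = (\<Sum>i<?a. c u i * g i x)) \<longrightarrow>
        (\<forall>x. v x = (\<Sum>i<?a. c v i * g i x)) \<longrightarrow>
        (\<forall>x. (u \<otimes>\<^bsub>?G\<^esub> inv\<^bsub>?G\<^esub> v) x = (\<Sum>i<?a. c (u \<otimes>\<^bsub>?G\<^esub> inv\<^bsub>?G\<^esub> v) i * g i x))"
    proof (intro ballI impI allI)
      fix u v x assume uv: "u \<in> carrier ?G" "v \<in> carrier ?G"
        and eq: "\<forall>x. u x = (\<Sum>i<?a. c u i * g i x)" "\<forall>x. v x = (\<Sum>i<?a. c v i * g i x)"
      have nv: "(\<lambda>x. - v x) \<in> ?K" using relker_cmul[of v X FF "-1"] uv by simp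
      have "inv\<^bsub>?G\<^esub> v = (\<lambda>x. - v x)"
        using uv nv by (intro K.inv_equality) auto
      then show "(u \<otimes>\<^bsub>?G\<^esub> inv\<^bsub>?G\<^esub> v) x = (\<Sum>i<?a. c (u \<otimes>\<^bsub>?G\<^esub> inv\<^bsub>?G\<^esub> v) i * g i x)"
        using add[OF _ nv, of u] neg[of v] uv eq[rule_format, of x]
        by (simp add: ring_distribs sum_subtractf)
    qed
  qed (use v in simp)
  with add cmul gK coordinates_basis[OF co] show thesis
    by (intro that[of c g]) blast+
qed

text \<open>The Kuenneth argument for top cycles of a join. Each column
  \<open>\<lambda>x. v (x, y)\<close> solves the first system and is expanded in the basis
  \<open>g\<close>; its coefficients, as functions of \<open>y\<close>, solve the second system
  because \<open>c\<close> is additive. What remains is one copy of the second group for every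
  \<open>i < ?a\<close>.\<close>

lemma relrank_prod:
  assumes X: "finite X" and Y: "finite Y" and FF: "FF \<subseteq> Pow X" and GG: "GG \<subseteq> Pow Y"
  shows "relrank (X \<times> Y) ({F \<times> {y} | F y. F \<in> FF \<and> y \<in> Y} \<union> {{x} \<times> G | x G. x \<in> X \<and> G \<in> GG})
    = relrank X FF * relrank Y GG" (is "relrank _ ?RR = _")
proof -
  let ?a = "relrank X FF"
  let ?K = "relker X FF"
  obtain c g where add: "\<And>u v i. u \<in> ?K \<Longrightarrow> v \<in> ?K \<Longrightarrow> c (\<lambda>x. u x + v x) i = c u i + c v i"
    and cmul: "\<And>k v i. v \<in> ?K \<Longrightarrow> c (\<lambda>x. k * v x) i = k * c v i"
    and gK: "\<And>i. i < ?a \<Longrightarrow> g i \<in> ?K"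
    and cg: "\<And>i j. i < ?a \<Longrightarrow> c (g i) j = (if i = j then 1 else 0)"
    and ex: "\<And>v x. v \<in> ?K \<Longrightarrow> v x = (\<Sum>i<?a. c v i * g i x)"
    by (rule relker_coordinates[OF X, of FF]) blast
  have sum: "c (\<lambda>x. \<Sum>j\<in>I. u j x) i = (\<Sum>j\<in>I. c (u j) i)" if "\<And>j. j \<in> I \<Longrightarrow> u j \<in> ?K"
    for I :: "'c set" and u i
    using relker_additive_sum[where d = "\<lambda>v. c v i", OF add that] .
  have zero: "c (\<lambda>x. 0) i = 0" for i
    using add[OF relker_zero relker_zero, of i] by simp
  let ?X' = "{..<?a} \<times> Y"
  let ?RR' = "\<Union>i<?a. {{i} \<times> G | G. G \<in> GG}"
  let ?f = "\<lambda>v (i, y). if i < ?a \<and> y \<in> Y then c (\<lambda>x. v (x, y)) i else 0"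
  let ?g = "\<lambda>w (x, y). \<Sum>i<?a. w (i, y) * g i x"
  have col: "(\<lambda>x. v (x, y)) \<in> ?K" if v: "v \<in> relker (X \<times> Y) ?RR" and y: "y \<in> Y" for v y
  proof -
    have "(\<Sum>x\<in>F. v (x, y)) = 0" if "F \<in> FF" for F
      using v y that unfolding relker_def sum_times_singleton[where f = v, symmetric] by blast
    then show ?thesis using v by (auto simp: relker_def)
  qed
  have "fun_group (relker (X \<times> Y) ?RR) \<cong> fun_group (relker ?X' ?RR')"
  proof (rule fun_group_isoI[where \<phi> = ?f and \<psi> = ?g]; (unfold fun_group_simps)?)
    show "?f v \<in> relker ?X' ?RR'" if v: "v \<in> relker (X \<times> Y) ?RR" for v
    proof -
      have "(\<Sum>p\<in>{i} \<times> G. ?f v p) = 0" if i: "i < ?a" and G: "G \<in> GG" for i G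
      proof -
        have GY: "G \<subseteq> Y" using G GG by auto
        \<comment> \<open>Outside \<open>X\<close> the sum vanishes by support, so the row relation
          holds for every \<open>x\<close>; the sum of the columns over \<open>G\<close> is then the
          zero function, whose coordinates are 0.\<close>
        have row: "(\<Sum>y\<in>G. v (x, y)) = 0" for x
        proof (cases "x \<in> X")
          case True
          then show ?thesis
            using v G unfolding relker_def sum_singleton_times[where f = v, symmetric] by blast
        next
          case False
          then show ?thesis using v by (auto simp: relker_def)
        qed
        have "(\<Sum>p\<in>{i} \<times> G. ?f v p) = (\<Sum>y\<in>G. c (\<lambda>x. v (x, y)) i)"
          unfolding sum_singleton_times using GY i by (intro sum.cong) auto
        also have "\<dots> = c (\<lambda>x. \<Sum>y\<in>G. v (x, y)) i"
          using GY by (intro sum[symmetric] col[OF v]) auto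
        also have "\<dots> = 0"
          by (simp add: row zero)
        finally show ?thesis .
      qed
      then show ?thesis by (auto simp: relker_def)
    qed
    show "?g w \<in> relker (X \<times> Y) ?RR" if w: "w \<in> relker ?X' ?RR'" for w
    proof -
      have F0: "(\<Sum>p\<in>F \<times> {y}. ?g w p) = 0" if F: "F \<in> FF" for F y
      proof -
        have "(\<Sum>p\<in>F \<times> {y}. ?g w p) = (\<Sum>i<?a. w (i, y) * (\<Sum>x\<in>F. g i x))"
          unfolding sum_times_singleton by (simp add: sum_distrib_left sum.swap[of _ F])
        also have "\<dots> = 0"
          using gK F by (intro sum.neutral) (auto simp: relker_def)
        finally show ?thesis .
      qed
      have G0: "(\<Sum>p\<in>{x} \<times> G. ?g w p) = 0" if G: "G \<in> GG" for G x
      proof -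
        have W: "(\<Sum>y\<in>G. w (i, y)) = 0" if "i < ?a" for i
          using w G that unfolding relker_def sum_singleton_times[where f = w, symmetric] by blast
        have "(\<Sum>p\<in>{x} \<times> G. ?g w p) = (\<Sum>i<?a. (\<Sum>y\<in>G. w (i, y)) * g i x)"
          unfolding sum_singleton_times by (simp add: sum_distrib_right sum.swap[of _ G])
        also have "\<dots> = 0"
          using W by (intro sum.neutral) simp
        finally show ?thesis .
      qed
      have Z0: "?g w (x, y) = 0" if "(x, y) \<notin> X \<times> Y" for x y
      proof -
        have "w (i, y) * g i x = 0" if "i < ?a" for i
          using w gK[OF that] \<open>(x, y) \<notin> X \<times> Y\<close> by (auto simp: relker_def)
        then have "(\<Sum>i<?a. w (i, y) * g i x) = 0"
          by (intro sum.neutral ballI) (simp only: lessThan_iff)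
        then show ?thesis by simp
      qed
      show ?thesis
        unfolding relker_def
      proof (intro CollectI conjI allI impI ballI)
        fix q assume "q \<notin> X \<times> Y"
        then show "?g w q = 0" using Z0[of "fst q" "snd q"] by simp
      next
        fix H assume "H \<in> ?RR"
        then show "(\<Sum>p\<in>H. ?g w p) = 0" using F0 G0 by blast
      qed
    qed
    show "?g (?f v) = v" if v: "v \<in> relker (X \<times> Y) ?RR" for v
    proof -
      have "?g (?f v) (x, y) = v (x, y)" for x y
      proof (cases "y \<in> Y")
        case True
        then show ?thesis using ex[OF col[OF v True], of x] by simp
      next
        case False
        then show ?thesis using v by (simp add: relker_def)
      qed
      then show ?thesis by (simp add: fun_eq_iff)
    qed
    show "?f (?g w) = w" if w: "w \<in> relker ?X' ?RR'" for w
    proof -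
      have "?f (?g w) (j, y) = w (j, y)" for j y
      proof (cases "j < ?a \<and> y \<in> Y")
        case True
        have "c (\<lambda>x. \<Sum>i<?a. w (i, y) * g i x) j = (\<Sum>i<?a. w (i, y) * c (g i) j)"
        proof -
          have "c (\<lambda>x. \<Sum>i<?a. w (i, y) * g i x) j = (\<Sum>i<?a. c (\<lambda>x. w (i, y) * g i x) j)"
            by (rule relker_additive_sum[where d = "\<lambda>v. c v j", OF add])
              (auto intro: relker_cmul gK)
          also have "\<dots> = (\<Sum>i<?a. w (i, y) * c (g i) j)"
            by (intro sum.cong refl cmul gK) simp
          finally show ?thesis .
        qed
        also have "\<dots> = (\<Sum>i<?a. if i = j then w (i, y) else 0)"
          by (intro sum.cong refl) (auto simp: cg)
        finally show ?thesis using True by simp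
      next
        case False
        then show ?thesis using w by (auto simp: relker_def)
      qed
      then show ?thesis by (simp add: fun_eq_iff)
    qed
    show "?f (\<lambda>x. u x + v x) = (\<lambda>x. ?f u x + ?f v x)"
      if "u \<in> relker (X \<times> Y) ?RR" "v \<in> relker (X \<times> Y) ?RR" for u v
      using add[OF col[OF that(1)] col[OF that(2)]] by (auto simp: fun_eq_iff)
  qed
  then have "relrank (X \<times> Y) ?RR = relrank ?X' ?RR'"
    using Y by (intro relrank_iso) auto
  also have "?X' = (\<Union>i<?a. {i} \<times> Y)" by auto
  also have "relrank (\<Union>i<?a. {i} \<times> Y) ?RR' = (\<Sum>i<?a. relrank ({i} \<times> Y) {{i} \<times> G | G. G \<in> GG})"
    using Y GG by (intro relrank_disjoint_union) auto
  also have "\<dots> = (\<Sum>i<?a. relrank Y GG)"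
  proof (rule sum.cong[OF refl])
    fix i
    show "relrank ({i} \<times> Y) {{i} \<times> G | G. G \<in> GG} = relrank Y GG"
    proof (rule relrank_bij[where \<phi> = "Pair i"])
      show "bij_betw (Pair i) Y ({i} \<times> Y)"
        by (auto simp: bij_betw_def inj_on_def)
      have "Pair i ` G = {i} \<times> G" for G :: "'b set" by auto
      then show "(`) (Pair i) ` GG \<union> {{}} = {{i} \<times> G | G. G \<in> GG} \<union> {{}}"
        by (simp add: image_def) blast
    qed (use Y GG in auto)
  qed
  finally show ?thesis by simp
qed

text \<open>
  Replacing the value at the label \<open>0\<close> by the sum over all labels decouples the labels: the relations
  \<open>G \<times> {..<m}\<close> then only concern the label \<open>0\<close>.
\<close>

lemma relrank_inflate_step:
  assumes Y: "finite Y" and m: "m \<ge> 1" and FF: "FF \<subseteq> Pow Y" and GG: "GG \<subseteq> Pow Y"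
  shows "relrank (Y \<times> {..<m}) ({F \<times> {t} | F t. F \<in> FF \<and> t < m} \<union> {G \<times> {..<m} | G. G \<in> GG})
    = (m - 1) * relrank Y FF + relrank Y (FF \<union> GG)" (is "relrank ?X ?RR = _")
proof -
  \<comment> \<open>After the substitution the label 0 holds the total over all labels: it satisfies
    \<open>FF\<close> as a sum of solutions of \<open>FF\<close>, and \<open>GG\<close> because
    \<open>GG\<close> constrains exactly that total. The labels from 1 on keep only
    \<open>FF\<close>, which accounts for the factor \<open>m - 1\<close>.\<close>
  let ?H = "\<lambda>t. if t = 0 then FF \<union> GG else FF"
  let ?RR' = "\<Union>t<m. {F \<times> {t} | F. F \<in> ?H t}"
  have X: "?X = (\<Union>t<m. Y \<times> {t})" by auto
  have split: "(\<Sum>s<m. u s) = u 0 + (\<Sum>s\<in>{1..<m}. u s)" for u :: "nat \<Rightarrow> int"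
    using m by (simp add: sum.atLeast_Suc_lessThan lessThan_atLeast0)
  let ?f = "\<lambda>v (y, t). if t = 0 then \<Sum>s<m. v (y, s) else v (y, t)"
  let ?g = "\<lambda>w (y, t). if t = 0 then w (y, 0) - (\<Sum>s\<in>{1..<m}. w (y, s)) else w (y, t)"
  have gsum: "(\<Sum>t<m. ?g w (y, t)) = w (y, 0)" for w :: "'a \<times> nat \<Rightarrow> int" and y
    unfolding split by simp
  have "fun_group (relker ?X ?RR) \<cong> fun_group (relker ?X ?RR')"
  proof (rule fun_group_isoI[where \<phi> = ?f and \<psi> = ?g]; (unfold fun_group_simps)?)
    show "?f v \<in> relker ?X ?RR'" if v: "v \<in> relker ?X ?RR" for v
    proof -
      have F: "(\<Sum>y\<in>F. v (y, t)) = 0" if "F \<in> FF" "t < m" for F t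
        using v that unfolding relker_def sum_times_singleton[where f = v, symmetric] by blast
      have G: "(\<Sum>y\<in>G. \<Sum>t<m. v (y, t)) = 0" if "G \<in> GG" for G
        using v that unfolding relker_def sum.cartesian_product'[where g = v, symmetric] by blast
      have "(\<Sum>p\<in>F \<times> {t}. ?f v p) = 0" if "t < m" "F \<in> ?H t" for t F
      proof (cases "t = 0")
        case True
        have "(\<Sum>y\<in>F. \<Sum>s<m. v (y, s)) = (\<Sum>s<m. \<Sum>y\<in>F. v (y, s))"
          by (rule sum.swap)
        then show ?thesis
          using True that F G by (auto simp: sum_times_singleton)
      next
        case False
        then show ?thesis using that F by (auto simp: sum_times_singleton)
      qed
      then show ?thesis using v m by (auto simp: relker_def)
    qed
    show "?g w \<in> relker ?X ?RR" if w: "w \<in> relker ?X ?RR'" for w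
    proof -
      have W: "(\<Sum>y\<in>F. w (y, t)) = 0" if "F \<in> ?H t" "t < m" for F t
        using w that unfolding relker_def sum_times_singleton[where f = w, symmetric] by blast
      have "(\<Sum>p\<in>F \<times> {t}. ?g w p) = 0" if "t < m" "F \<in> FF" for t F
      proof (cases "t = 0")
        case True
        have "(\<Sum>y\<in>F. \<Sum>s\<in>{1..<m}. w (y, s)) = (\<Sum>s\<in>{1..<m}. \<Sum>y\<in>F. w (y, s))"
          by (rule sum.swap)
        also have "\<dots> = 0"
          using that by (intro sum.neutral ballI W) auto
        finally show ?thesis
          using True that W[of F 0] by (simp add: sum_times_singleton sum_subtractf)
      next
        case False
        then show ?thesis using that W[of F t] by (simp add: sum_times_singleton)
      qed
      moreover have "(\<Sum>p\<in>G \<times> {..<m}. ?g w p) = 0" if "G \<in> GG" for G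
        unfolding sum.cartesian_product' gsum using W[of G 0] that m by simp
      ultimately show ?thesis using w m by (auto simp: relker_def)
    qed
    show "?g (?f v) = v" if "v \<in> relker ?X ?RR" for v
      by (auto simp: fun_eq_iff split)
    show "?f (?g w) = w" if "w \<in> relker ?X ?RR'" for w
    proof -
      have "?f (?g w) (y, t) = w (y, t)" for y t
        using gsum[of w y] by simp
      then show ?thesis by (simp add: fun_eq_iff)
    qed
    show "?f (\<lambda>x. u x + v x) = (\<lambda>x. ?f u x + ?f v x)" for u v :: "'a \<times> nat \<Rightarrow> int"
      by (auto simp: fun_eq_iff sum.distrib)
  qed
  then have "relrank ?X ?RR = relrank ?X ?RR'"
    using Y by (intro relrank_iso) auto
  also have "\<dots> = (\<Sum>t<m. relrank (Y \<times> {t}) {F \<times> {t} | F. F \<in> ?H t})"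
    unfolding X using Y FF GG by (intro relrank_disjoint_union) (auto split: if_splits)
  also have "\<dots> = (\<Sum>t<m. relrank Y (?H t))"
  proof (rule sum.cong[OF refl])
    fix t
    show "relrank (Y \<times> {t}) {F \<times> {t} | F. F \<in> ?H t} = relrank Y (?H t)"
    proof (rule relrank_bij[where \<phi> = "\<lambda>y. (y, t)"])
      show "bij_betw (\<lambda>y. (y, t)) Y (Y \<times> {t})"
        by (auto simp: bij_betw_def inj_on_def)
      have "(`) (\<lambda>y. (y, t)) ` A = (\<lambda>F. F \<times> {t}) ` A" for A :: "'a set set"
        by (intro image_cong) auto
      then show "(`) (\<lambda>y. (y, t)) ` ?H t \<union> {{}} = {F \<times> {t} | F. F \<in> ?H t} \<union> {{}}"
        by (simp only: Setcompr_eq_image)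
    qed (use Y FF GG in auto)
  qed
  also have "\<dots> = relrank Y (FF \<union> GG) + (m - 1) * relrank Y FF"
    using m by (simp add: sum.atLeast_Suc_lessThan lessThan_atLeast0)
  finally show ?thesis by simp
qed

text \<open>
  The facets of a labelled complex are pairs of a facet and a labelling \<open>w\<close> of the ranks \<open>D\<close>. A ridge
  that misses the rank \<open>i\<close> does not see the label \<open>w i\<close>.
\<close>

definition lift_rels ::
  "nat \<Rightarrow> 'i set \<Rightarrow> 'x set set \<Rightarrow> ('i \<Rightarrow> 'x set set) \<Rightarrow> ('x \<times> ('i \<Rightarrow> nat)) set set" where
  "lift_rels m D EE FF =
     {F \<times> {w} | F w. F \<in> EE \<and> w \<in> D \<rightarrow>\<^sub>E {..<m}} \<union>
     {F \<times> {w(i := t) | t. t < m} | F w i. i \<in> D \<and> F \<in> FF i \<and> w \<in> D \<rightarrow>\<^sub>E {..<m}}"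

lemma lift_relsI1: "F \<in> EE \<Longrightarrow> w \<in> D \<rightarrow>\<^sub>E {..<m} \<Longrightarrow> F \<times> {w} \<in> lift_rels m D EE FF"
  by (auto simp: lift_rels_def)

lemma lift_relsI2:
  "i \<in> D \<Longrightarrow> F \<in> FF i \<Longrightarrow> w \<in> D \<rightarrow>\<^sub>E {..<m} \<Longrightarrow> F \<times> {w(i := t) | t. t < m} \<in> lift_rels m D EE FF"
  unfolding lift_rels_def by blast

lemma lift_relsE:
  assumes "G \<in> lift_rels m D EE FF"
  obtains F w where "G = F \<times> {w}" "F \<in> EE" "w \<in> D \<rightarrow>\<^sub>E {..<m}"
  | F w i where "G = F \<times> {w(i := t) | t. t < m}" "i \<in> D" "F \<in> FF i" "w \<in> D \<rightarrow>\<^sub>E {..<m}"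
  using assms unfolding lift_rels_def by blast

text \<open>One rank \<open>d\<close> is separated at a time. \<open>relrank_inflate_step\<close>
  leaves \<open>m - 1\<close> systems without the relations \<open>FF d\<close>, giving the sets
  \<open>S\<close> that contain \<open>d\<close>, and one system in which \<open>FF d\<close> joins
  \<open>EE\<close>, giving the sets without \<open>d\<close>. This is why the induction runs over
  arbitrary \<open>EE\<close>.\<close>

lemma relrank_inflate:
  fixes X :: "'x set" and D :: "'i set"
  assumes X: "finite X" and D: "finite D" and m: "m \<ge> 1"
    and EE: "EE \<subseteq> Pow X" and FF: "\<And>i. i \<in> D \<Longrightarrow> FF i \<subseteq> Pow X"
  shows "relrank (X \<times> (D \<rightarrow>\<^sub>E {..<m})) (lift_rels m D EE FF) =
    (\<Sum>S\<in>Pow D. (m - 1) ^ card S * relrank X (EE \<union> (\<Union>i\<in>D - S. FF i)))"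
  using D EE FF
proof (induction D arbitrary: EE rule: finite_induct)
  case empty
  let ?u = "\<lambda>x. undefined :: nat"
  have "relrank (X \<times> ({} \<rightarrow>\<^sub>E {..<m})) (lift_rels m {} EE FF) = relrank X EE"
  proof (rule relrank_bij'[where \<phi> = "\<lambda>x. (x, ?u)"])
    show "bij_betw (\<lambda>x. (x, ?u)) X (X \<times> ({} \<rightarrow>\<^sub>E {..<m}))"
      by (auto simp: bij_betw_def inj_on_def)
    have im: "(\<lambda>x. (x, ?u)) ` F = F \<times> {?u}" for F :: "'x set" by auto
    show "(\<lambda>x. (x, ?u)) ` F \<in> lift_rels m {} EE FF" if "F \<in> EE" for F
      unfolding im using that by (intro lift_relsI1) auto
    show "\<exists>F\<in>EE. (\<lambda>x. (x, ?u)) ` F = G" if "G \<in> lift_rels m {} EE FF" for G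
      using that by (rule lift_relsE) (auto simp: im)
  qed (use X empty in auto)
  then show ?case by simp
next
  case (insert d D)
  let ?Y = "X \<times> (D \<rightarrow>\<^sub>E {..<m})"
  let ?W = "insert d D \<rightarrow>\<^sub>E {..<m}"
  let ?A = "lift_rels m D EE FF"
  let ?B = "{F \<times> {w} | F w. F \<in> FF d \<and> w \<in> D \<rightarrow>\<^sub>E {..<m}}"
  have d: "d \<notin> D" by (rule insert.hyps)
  have upd: "w(d := t) \<in> ?W" if "w \<in> D \<rightarrow>\<^sub>E {..<m}" "t < m" for w t
    using that by (simp add: PiE_iff extensional_def)
  have dec: "\<exists>w\<in>D \<rightarrow>\<^sub>E {..<m}. \<exists>t<m. w' = w(d := t)" if "w' \<in> ?W" for w'
    using that unfolding PiE_insert_eq by auto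
  \<comment> \<open>Puts the label of \<open>d\<close>, held as a separate last coordinate, back
    into the labelling.\<close>
  define \<phi> where "\<phi> = (\<lambda>((x, w), t). (x, w(d := t)) :: 'x \<times> ('i \<Rightarrow> nat))"
  have fam: "F \<times> {h s | s. s < m} = (\<lambda>(x, s). (x, h s)) ` (F \<times> {..<m})"
    for F :: "'x set" and h :: "nat \<Rightarrow> 'z"
    by (fastforce simp: image_iff)
  have im1: "\<phi> ` ((F \<times> {w}) \<times> {t}) = F \<times> {w(d := t)}" for F w t
  proof -
    have "(F \<times> {w}) \<times> {t} = (\<lambda>x. ((x, w), t)) ` F" "F \<times> {w(d := t)} = (\<lambda>x. (x, w(d := t))) ` F"
      by auto
    then show ?thesis by (simp add: \<phi>_def image_image)
  qed
  have im2: "\<phi> ` ((F \<times> {w(i := s) | s. s < m}) \<times> {t}) = F \<times> {(w(d := t))(i := s) | s. s < m}"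
    if "i \<in> D" for F w t i
  proof -
    have "i \<noteq> d" using that d by auto
    then have "w(i := s, d := t) = w(d := t, i := s)" for s
      by (rule fun_upd_twist)
    moreover have "((\<lambda>(x, s). (x, w(i := s))) ` (F \<times> {..<m})) \<times> {t} =
        (\<lambda>(x, s). ((x, w(i := s)), t)) ` (F \<times> {..<m})"
      by (fastforce simp: image_iff)
    ultimately show ?thesis unfolding fam by (simp add: \<phi>_def image_image split_def)
  qed
  have im3: "\<phi> ` ((F \<times> {w}) \<times> {..<m}) = F \<times> {w(d := t) | t. t < m}" for F w
  proof -
    have "(F \<times> {w}) \<times> {..<m} = (\<lambda>(x, t). ((x, w), t)) ` (F \<times> {..<m})"
      by (fastforce simp: image_iff)
    then show ?thesis unfolding fam by (simp add: \<phi>_def image_image split_def)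
  qed
  have fin: "finite ?Y"
    using X insert.hyps by (intro finite_cartesian_product finite_PiE) auto
  have FFd: "FF d \<subseteq> Pow X" and FFD: "\<And>i. i \<in> D \<Longrightarrow> FF i \<subseteq> Pow X"
    using insert.prems by auto
  have ASub: "lift_rels m D EE FF \<subseteq> Pow ?Y" if "EE \<subseteq> Pow X" for EE
  proof
    fix G assume "G \<in> lift_rels m D EE FF"
    then show "G \<in> Pow ?Y"
    proof (rule lift_relsE)
      fix F w i assume *: "G = F \<times> {w(i := t) | t. t < m}" "i \<in> D" "F \<in> FF i" "w \<in> D \<rightarrow>\<^sub>E {..<m}"
      have "w(i := t) \<in> D \<rightarrow>\<^sub>E {..<m}" if "t < m" for t
        using *(2,4) that by (auto simp: PiE_iff extensional_def)
      moreover have "F \<subseteq> X" using FFD[OF *(2)] *(3) by blast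
      ultimately show ?thesis unfolding *(1) by blast
    next
      fix F w assume *: "G = F \<times> {w}" "F \<in> EE" "w \<in> D \<rightarrow>\<^sub>E {..<m}"
      have "F \<subseteq> X" using that *(2) by blast
      then show ?thesis unfolding *(1) using *(3) by blast
    qed
  qed
  let ?U = "{F \<times> {t} | F t. F \<in> ?A \<and> t < m} \<union> {G \<times> {..<m} | G. G \<in> ?B}"
  have memA: "F \<times> {t} \<in> ?U" if "F \<in> ?A" "t < m" for F t
    using that by (intro UnI1 CollectI exI[of _ F] exI[of _ t] conjI refl)
  have memB: "G \<times> {..<m} \<in> ?U" if "G \<in> ?B" for G
    by (rule UnI2, rule CollectI, rule exI[of _ G], rule conjI, rule refl, rule that)
  have "relrank (X \<times> ?W) (lift_rels m (insert d D) EE FF) =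
      relrank (?Y \<times> {..<m}) ({F \<times> {t} | F t. F \<in> ?A \<and> t < m} \<union> {G \<times> {..<m} | G. G \<in> ?B})"
  proof (rule relrank_bij'[where \<phi> = \<phi>])
    show "bij_betw \<phi> (?Y \<times> {..<m}) (X \<times> ?W)"
      unfolding bij_betw_def
    proof
      show "inj_on \<phi> (?Y \<times> {..<m})"
      proof (rule inj_onI)
        fix q q' assume q: "q \<in> ?Y \<times> {..<m}" "q' \<in> ?Y \<times> {..<m}" and eq: "\<phi> q = \<phi> q'"
        obtain x w t x' w' t' where qq: "q = ((x, w), t)" "q' = ((x', w'), t')"
          by (metis surj_pair)
        have w: "w \<in> D \<rightarrow>\<^sub>E {..<m}" "w' \<in> D \<rightarrow>\<^sub>E {..<m}"
          using q qq by auto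
        note eq = eq[unfolded qq]
        have wd: "w(d := t) = w'(d := t')" and "x = x'" using eq by (auto simp: \<phi>_def)
        moreover have "t = t'" using fun_cong[OF wd, of d] by simp
        moreover have "w = w'"
        proof
          fix i show "w i = w' i"
            using fun_cong[OF wd, of i] w d by (cases "i = d") (auto simp: PiE_iff extensional_def)
        qed
        ultimately show "q = q'" by (simp add: qq)
      qed
      show "\<phi> ` (?Y \<times> {..<m}) = X \<times> ?W"
      proof (intro equalityI subsetI)
        fix z assume "z \<in> \<phi> ` (?Y \<times> {..<m})"
        then show "z \<in> X \<times> ?W" using upd by (auto simp: \<phi>_def simp del: fun_upd_apply)
      next
        fix z assume "z \<in> X \<times> ?W"
        then obtain x w' where z: "z = (x, w')" "x \<in> X" "w' \<in> ?W" by auto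
        from dec[OF z(3)] obtain w t where "w \<in> D \<rightarrow>\<^sub>E {..<m}" "t < m" "w' = w(d := t)" by blast
        then show "z \<in> \<phi> ` (?Y \<times> {..<m})"
          using z by (intro image_eqI[of _ _ "((x, w), t)"]) (auto simp: \<phi>_def)
      qed
    qed
    show "{F \<times> {t} | F t. F \<in> ?A \<and> t < m} \<union> {G \<times> {..<m} | G. G \<in> ?B} \<subseteq> Pow (?Y \<times> {..<m})"
      using ASub[OF insert.prems(1)] FFd by (intro Un_least subsetI; elim CollectE exE conjE) auto
    show "\<phi> ` H \<in> lift_rels m (insert d D) EE FF"
      if "H \<in> {F \<times> {t} | F t. F \<in> ?A \<and> t < m} \<union> {G \<times> {..<m} | G. G \<in> ?B}" for H
      using that
    proof (elim UnE CollectE exE conjE)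
      fix F t assume H: "H = F \<times> {t}" "F \<in> ?A" "t < m"
      from H(2) show ?thesis
      proof (rule lift_relsE)
        fix E w assume *: "F = E \<times> {w}" "E \<in> EE" "w \<in> D \<rightarrow>\<^sub>E {..<m}"
        show ?thesis unfolding H *(1) im1 by (intro lift_relsI1 upd * H)
      next
        fix E w i assume *: "F = E \<times> {w(i := t) | t. t < m}" "i \<in> D" "E \<in> FF i" "w \<in> D \<rightarrow>\<^sub>E {..<m}"
        show ?thesis unfolding H *(1) im2[OF *(2)] by (intro lift_relsI2 upd * H insertI2)
      qed
    next
      fix G F w assume H: "H = G \<times> {..<m}" "G = F \<times> {w}" "F \<in> FF d" "w \<in> D \<rightarrow>\<^sub>E {..<m}"
      \<comment> \<open>The relation must be indexed by a labelling of \<open>insert d D\<close>;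
        the value 0 at \<open>d\<close> is a placeholder that \<open>t\<close> overwrites, and it is
        a legal label since \<open>m \<ge> 1\<close>.\<close>
      have "F \<times> {(w(d := 0))(d := t) | t. t < m} \<in> lift_rels m (insert d D) EE FF"
        using m by (intro lift_relsI2 upd H insertI1) simp
      then show ?thesis unfolding H im3 by simp
    qed
    show "\<exists>H\<in>{F \<times> {t} | F t. F \<in> ?A \<and> t < m} \<union> {G \<times> {..<m} | G. G \<in> ?B}. \<phi> ` H = K"
      if "K \<in> lift_rels m (insert d D) EE FF" for K
      using that
    proof (rule lift_relsE)
      fix E w' assume *: "K = E \<times> {w'}" "E \<in> EE" "w' \<in> ?W"
      from dec[OF *(3)] obtain w t where w: "w \<in> D \<rightarrow>\<^sub>E {..<m}" "t < m" "w' = w(d := t)" by blast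
      have "E \<times> {w} \<in> ?A" using * w by (intro lift_relsI1)
      moreover have "\<phi> ` ((E \<times> {w}) \<times> {t}) = K" unfolding im1 * w ..
      ultimately show ?thesis using w(2) by (intro bexI[OF _ memA])
    next
      fix E w' i assume *: "K = E \<times> {w'(i := t) | t. t < m}" "i \<in> insert d D" "E \<in> FF i" "w' \<in> ?W"
      from dec[OF *(4)] obtain w t where w: "w \<in> D \<rightarrow>\<^sub>E {..<m}" "t < m" "w' = w(d := t)" by blast
      show ?thesis
      proof (cases "i = d")
        case True
        have "\<phi> ` ((E \<times> {w}) \<times> {..<m}) = K" unfolding im3 * w True by simp
        moreover have "E \<times> {w} \<in> ?B" using * w True by blast
        ultimately show ?thesis by (intro bexI[OF _ memB])
      next
        case False
        then have i: "i \<in> D" using * by auto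
        have "E \<times> {w(i := s) | s. s < m} \<in> ?A" using * w i by (intro lift_relsI2)
        moreover have "\<phi> ` ((E \<times> {w(i := s) | s. s < m}) \<times> {t}) = K" unfolding im2[OF i] * w ..
        ultimately show ?thesis using w(2) by (intro bexI[OF _ memA])
      qed
    qed
  qed (use fin in auto)
  also have "\<dots> = (m - 1) * relrank ?Y ?A + relrank ?Y (?A \<union> ?B)"
    using fin m ASub[OF insert.prems(1)] FFd by (intro relrank_inflate_step) auto
  also have "?A \<union> ?B = lift_rels m D (EE \<union> FF d) FF"
  proof -
    have "{f F w | F w. F \<in> EE \<union> FF d \<and> w \<in> W} = {f F w | F w. F \<in> EE \<and> w \<in> W} \<union> {f F w | F w. F \<in> FF d \<and> w \<in> W}"
      for f :: "'x set \<Rightarrow> ('i \<Rightarrow> nat) \<Rightarrow> ('x \<times> ('i \<Rightarrow> nat)) set" and W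
      by blast
    note this[of "\<lambda>F w. F \<times> {w}" "D \<rightarrow>\<^sub>E {..<m}"]
    then show ?thesis
      unfolding lift_rels_def by (simp only: Un_ac)
  qed
  also have "relrank ?Y ?A = (\<Sum>S\<in>Pow D. (m - 1) ^ card S * relrank X (EE \<union> (\<Union>i\<in>D - S. FF i)))"
    by (rule insert.IH[OF insert.prems(1) FFD])
  also have "relrank ?Y (lift_rels m D (EE \<union> FF d) FF) =
      (\<Sum>S\<in>Pow D. (m - 1) ^ card S * relrank X ((EE \<union> FF d) \<union> (\<Union>i\<in>D - S. FF i)))"
    using insert.prems(1) FFd by (intro insert.IH FFD) auto
  also have "(m - 1) * (\<Sum>S\<in>Pow D. (m - 1) ^ card S * relrank X (EE \<union> (\<Union>i\<in>D - S. FF i))) =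
      (\<Sum>S\<in>Pow D. (m - 1) ^ card (insert d S) * relrank X (EE \<union> (\<Union>i\<in>insert d D - insert d S. FF i)))"
    unfolding sum_distrib_left
  proof (rule sum.cong[OF refl])
    fix S assume "S \<in> Pow D"
    then have "d \<notin> S" "finite S" using d insert.hyps by (auto intro: finite_subset)
    moreover from this have "insert d D - insert d S = D - S" using d by auto
    ultimately show "(m - 1) * ((m - 1) ^ card S * relrank X (EE \<union> (\<Union>i\<in>D - S. FF i))) =
      (m - 1) ^ card (insert d S) * relrank X (EE \<union> (\<Union>i\<in>insert d D - insert d S. FF i))"
      by simp
  qed
  also have "(\<Sum>S\<in>Pow D. (m - 1) ^ card S * relrank X ((EE \<union> FF d) \<union> (\<Union>i\<in>D - S. FF i))) =
      (\<Sum>S\<in>Pow D. (m - 1) ^ card S * relrank X (EE \<union> (\<Union>i\<in>insert d D - S. FF i)))"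
  proof (rule sum.cong[OF refl])
    fix S assume "S \<in> Pow D"
    then have "insert d D - S = insert d (D - S)" using d by auto
    then show "(m - 1) ^ card S * relrank X ((EE \<union> FF d) \<union> (\<Union>i\<in>D - S. FF i)) =
      (m - 1) ^ card S * relrank X (EE \<union> (\<Union>i\<in>insert d D - S. FF i))"
      by (simp add: Un_assoc)
  qed
  also have "(\<Sum>S\<in>Pow D. (m - 1) ^ card (insert d S) * relrank X (EE \<union> (\<Union>i\<in>insert d D - insert d S. FF i))) +
      (\<Sum>S\<in>Pow D. (m - 1) ^ card S * relrank X (EE \<union> (\<Union>i\<in>insert d D - S. FF i))) =
      (\<Sum>S\<in>Pow (insert d D). (m - 1) ^ card S * relrank X (EE \<union> (\<Union>i\<in>insert d D - S. FF i)))"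
  proof -
    have inj: "inj_on (insert d) (Pow D)"
      using d by (auto simp: inj_on_def)
    have "finite (Pow D)" "finite (insert d ` Pow D)" "Pow D \<inter> insert d ` Pow D = {}"
      using insert.hyps by auto
    then show ?thesis
      unfolding Pow_insert by (subst sum.union_disjoint) (simp_all add: sum.reindex[OF inj] o_def)
  qed
  finally show ?case .
qed

section \<open>Labelled graded posets\<close>

definition lt_chain :: "('a \<Rightarrow> 'a \<Rightarrow> bool) \<Rightarrow> 'a set \<Rightarrow> bool" where
  "lt_chain lt A \<longleftrightarrow> (\<forall>x\<in>A. \<forall>y\<in>A. x \<noteq> y \<longrightarrow> lt x y \<or> lt y x)"

text \<open>
  \<open>k\<close> is the number of elements of a facet. For a chain \<open>\<sigma>\<close>, \<open>linkrank P lt k \<sigma>\<close> is the rank of the top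
  reduced homology of the link of \<open>\<sigma>\<close>, computed on the facets containing \<open>\<sigma>\<close>.
\<close>

definition star :: "'a set \<Rightarrow> ('a \<Rightarrow> 'a \<Rightarrow> bool) \<Rightarrow> nat \<Rightarrow> 'a set \<Rightarrow> 'a set set" where
  "star P lt k T = {A. A \<subseteq> P \<and> finite A \<and> card A = k \<and> lt_chain lt A \<and> T \<subseteq> A}"

definition star_rels :: "'a set \<Rightarrow> ('a \<Rightarrow> 'a \<Rightarrow> bool) \<Rightarrow> nat \<Rightarrow> 'a set \<Rightarrow> 'a set set set" where
  "star_rels P lt k \<sigma> = {star P lt k T | T. \<sigma> \<subseteq> T \<and> finite T \<and> Suc (card T) = k}"

definition linkrank :: "'a set \<Rightarrow> ('a \<Rightarrow> 'a \<Rightarrow> bool) \<Rightarrow> nat \<Rightarrow> 'a set \<Rightarrow> nat" where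
  "linkrank P lt k \<sigma> = relrank (star P lt k \<sigma>) (star_rels P lt k \<sigma>)"

lemma lt_chain_subset: "lt_chain lt A \<Longrightarrow> B \<subseteq> A \<Longrightarrow> lt_chain lt B"
  by (auto simp: lt_chain_def)

lemma starD:
  assumes "A \<in> star P lt k T"
  shows "A \<subseteq> P" "finite A" "card A = k" "lt_chain lt A" "T \<subseteq> A"
  using assms by (auto simp: star_def)

lemma starI: "A \<subseteq> P \<Longrightarrow> finite A \<Longrightarrow> card A = k \<Longrightarrow> lt_chain lt A \<Longrightarrow> T \<subseteq> A \<Longrightarrow> A \<in> star P lt k T"
  by (simp add: star_def)

lemma finite_star: "finite P \<Longrightarrow> finite (star P lt k T)"
  by (rule finite_subset[of _ "Pow P"]) (auto simp: star_def)

lemma star_rels_subset: "star_rels P lt k \<sigma> \<subseteq> Pow (star P lt k \<sigma>)"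
  by (auto simp: star_rels_def star_def)

lemma star_relsI: "\<sigma> \<subseteq> T \<Longrightarrow> finite T \<Longrightarrow> Suc (card T) = k \<Longrightarrow> star P lt k T \<in> star_rels P lt k \<sigma>"
  unfolding star_rels_def by blast

lemma star_relsE:
  assumes "F \<in> star_rels P lt k \<sigma>"
  obtains T where "F = star P lt k T" "\<sigma> \<subseteq> T" "finite T" "Suc (card T) = k"
  using assms unfolding star_rels_def by blast

lemma linkrank_iso:
  assumes P: "finite P" and f: "bij_betw f P Q"
    and lt: "\<And>x y. x \<in> P \<Longrightarrow> y \<in> P \<Longrightarrow> lt' (f x) (f y) \<longleftrightarrow> lt x y"
  shows "linkrank Q lt' k {} = linkrank P lt k {}"
  unfolding linkrank_def
proof (rule relrank_bij'[where \<phi> = "image f"])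
  have inj: "inj_on f P" and Q: "f ` P = Q"
    using f by (auto simp: bij_betw_def)
  have card: "card (f ` A) = card A" if "A \<subseteq> P" for A
    by (intro card_image inj_on_subset[OF inj that])
  have chain: "lt_chain lt' (f ` A) \<longleftrightarrow> lt_chain lt A" if "A \<subseteq> P" for A
  proof -
    have "(f x \<noteq> f y \<longrightarrow> lt' (f x) (f y) \<or> lt' (f y) (f x)) \<longleftrightarrow> (x \<noteq> y \<longrightarrow> lt x y \<or> lt y x)"
      if "x \<in> A" "y \<in> A" for x y
      using that \<open>A \<subseteq> P\<close> by (simp add: lt subsetD inj_on_eq_iff[OF inj])
    then show ?thesis by (simp add: lt_chain_def)
  qed
  have im: "image f ` star P lt k T = star Q lt' k (f ` T)" if T: "T \<subseteq> P" for T
  proof (intro equalityI subsetI)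
    fix B assume "B \<in> image f ` star P lt k T"
    then obtain A where A: "A \<in> star P lt k T" "B = f ` A" by blast
    note s = starD[OF A(1)]
    show "B \<in> star Q lt' k (f ` T)"
      unfolding A(2) using s card[OF s(1)] chain[OF s(1)] Q by (intro starI) auto
  next
    fix B assume "B \<in> star Q lt' k (f ` T)"
    note s = starD[OF this]
    define A where "A = {x \<in> P. f x \<in> B}"
    have A: "A \<subseteq> P" "B = f ` A" using s(1) Q by (auto simp: A_def)
    have "A \<in> star P lt k T"
    proof (rule starI)
      show "finite A" using P A(1) by (rule finite_subset[rotated])
      show "card A = k" using s(3) card[OF A(1)] A(2) by simp
      show "lt_chain lt A" using s(4) chain[OF A(1)] A(2) by simp
      show "T \<subseteq> A" using s(5) T by (auto simp: A_def)
    qed (rule A(1))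
    then show "B \<in> image f ` star P lt k T" using A by blast
  qed
  show "bij_betw (image f) (star P lt k {}) (star Q lt' k {})"
    unfolding bij_betw_def
  proof
    show "inj_on (image f) (star P lt k {})"
      by (rule inj_on_subset[OF inj_on_image_Pow[OF inj]]) (auto simp: star_def)
    show "image f ` star P lt k {} = star Q lt' k {}"
      using im[of "{}"] by simp
  qed
  show "image f ` F \<in> star_rels Q lt' k {}" if F: "F \<in> star_rels P lt k {}" "F \<noteq> {}" for F
  proof -
    obtain T where T: "F = star P lt k T" "finite T" "Suc (card T) = k"
      using F(1) by (rule star_relsE)
    then have "T \<subseteq> P" using F(2) by (auto simp: star_def)
    then show ?thesis
      unfolding T(1) im[OF \<open>T \<subseteq> P\<close>] using T card by (intro star_relsI) auto
  qed
  show "\<exists>F\<in>star_rels P lt k {}. image f ` F = G" if G: "G \<in> star_rels Q lt' k {}" "G \<noteq> {}" for G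
  proof -
    obtain T' where T': "G = star Q lt' k T'" "finite T'" "Suc (card T') = k"
      using G(1) by (rule star_relsE)
    then have "T' \<subseteq> Q" using G(2) by (auto simp: star_def)
    then obtain T where T: "T \<subseteq> P" "T' = f ` T"
      unfolding Q[symmetric] by (auto simp: subset_image_iff)
    then have "star P lt k T \<in> star_rels P lt k {}"
      using T' card P by (intro star_relsI) (auto intro: finite_subset)
    then show ?thesis using im[OF T(1)] T T' by blast
  qed
qed (rule star_rels_subset finite_star[OF P])+

text \<open>Both bounds \<open>a\<close> and \<open>n\<close> are parameters so that the elements
  above \<open>v\<close> form such a poset again, with \<open>a = \<rho> v\<close> and the same
  \<open>n\<close>. Strict monotonicity makes \<rho> injective on chains, so a chain with
  \<open>n - a\<close> elements meets every rank exactly once.\<close>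

locale graded_poset =
  fixes P :: "'a set" and lt :: "'a \<Rightarrow> 'a \<Rightarrow> bool" and \<rho> :: "'a \<Rightarrow> nat" and a n :: nat
  assumes finite_P: "finite P"
    and rank_bounds: "x \<in> P \<Longrightarrow> \<rho> x \<in> {a<..n}"
    and rank_mono: "x \<in> P \<Longrightarrow> y \<in> P \<Longrightarrow> lt x y \<Longrightarrow> \<rho> x < \<rho> y"
begin

abbreviation "k \<equiv> n - a"

lemma inj_on_rank: "A \<subseteq> P \<Longrightarrow> lt_chain lt A \<Longrightarrow> inj_on \<rho> A"
  unfolding lt_chain_def by (rule inj_onI) (metis nat_neq_iff rank_mono subsetD)

lemma rank_image:
  assumes "A \<in> star P lt k T"
  shows "\<rho> ` A = {a<..n}"
proof (rule card_subset_eq)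
  note s = starD[OF assms]
  show "\<rho> ` A \<subseteq> {a<..n}" using s(1) rank_bounds by auto
  show "card (\<rho> ` A) = card {a<..n}"
    using card_image[OF inj_on_rank[OF s(1,4)]] s(3) by simp
qed simp

lemma missing_rank:
  assumes "A \<in> star P lt k T" "Suc (card T) = k"
  obtains i where "i \<in> {a<..n}" "\<rho> ` T = {a<..n} - {i}"
proof -
  note s = starD[OF assms(1)]
  have inj: "inj_on \<rho> A" by (rule inj_on_rank[OF s(1,4)])
  have "card (\<rho> ` T) = card T"
    using inj_on_subset[OF inj s(5)] by (rule card_image)
  moreover have sub: "\<rho> ` T \<subseteq> {a<..n}" using rank_image[OF assms(1)] s(5) by blast
  ultimately have "card ({a<..n} - \<rho> ` T) = 1"
    using assms(2) by (subst card_Diff_subset) (auto intro: finite_subset)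
  then obtain i where "{a<..n} - \<rho> ` T = {i}"
    by (rule card_1_singletonE)
  then show thesis using sub by (intro that[of i]) auto
qed

text \<open>
  The ridges that miss a rank in \<open>S\<close> being dropped, facets with different restrictions to the ranks in
  \<open>S\<close> no longer share a relation.
\<close>

lemma star_decompose_by_type:
  assumes S: "S \<subseteq> {a<..n}"
  shows "relrank (star P lt k {}) (\<Union>i\<in>{a<..n} - S. {star P lt k T | T.
            finite T \<and> Suc (card T) = k \<and> T \<subseteq> P \<and> lt_chain lt T \<and> i \<notin> \<rho> ` T}) =
    (\<Sum>\<sigma> | \<sigma> \<subseteq> P \<and> lt_chain lt \<sigma> \<and> \<rho> ` \<sigma> = S. linkrank P lt k \<sigma>)" (is "relrank _ ?FF = _")
proof -
  let ?I = "{\<sigma>. \<sigma> \<subseteq> P \<and> lt_chain lt \<sigma> \<and> \<rho> ` \<sigma> = S}"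
  have restr: "\<sigma> = {x \<in> A. \<rho> x \<in> S}" if "\<sigma> \<in> ?I" "A \<in> star P lt k \<sigma>" for \<sigma> A
  proof -
    have inj: "inj_on \<rho> A" using starD[OF that(2)] by (intro inj_on_rank)
    have sub: "\<sigma> \<subseteq> A" using starD[OF that(2)] by simp
    show ?thesis
    proof (intro equalityI subsetI)
      fix x assume "x \<in> {x \<in> A. \<rho> x \<in> S}"
      then have x: "x \<in> A" "\<rho> x \<in> \<rho> ` \<sigma>" using that(1) by auto
      then obtain y where "y \<in> \<sigma>" "\<rho> x = \<rho> y" by auto
      then show "x \<in> \<sigma>" using inj x sub by (metis inj_onD subsetD)
    qed (use that sub in auto)
  qed
  \<comment> \<open>A facet is sorted by its elements with rank in \<open>S\<close>; they form a
    chain whose set of ranks is exactly \<open>S\<close>, since a facet attains every rank.\<close>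
  have U: "star P lt k {} = (\<Union>\<sigma>\<in>?I. star P lt k \<sigma>)"
  proof (intro equalityI subsetI)
    fix A assume A: "A \<in> star P lt k {}"
    note s = starD[OF A]
    let ?\<sigma> = "{x \<in> A. \<rho> x \<in> S}"
    have "?\<sigma> \<in> ?I"
      using s lt_chain_subset[OF s(4), of ?\<sigma>] rank_image[OF A] S by auto
    moreover have "A \<in> star P lt k ?\<sigma>" using s by (intro starI) auto
    ultimately show "A \<in> (\<Union>\<sigma>\<in>?I. star P lt k \<sigma>)" by blast
  qed (auto simp: star_def)
  have "?FF \<union> {{}} = (\<Union>\<sigma>\<in>?I. star_rels P lt k \<sigma>) \<union> {{}}"
  proof (intro equalityI subsetI)
    fix F assume "F \<in> ?FF \<union> {{}}"
    then consider "F = {}" | i T where "F = star P lt k T" "F \<noteq> {}" "i \<in> {a<..n} - S"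
      "finite T" "Suc (card T) = k" "T \<subseteq> P" "lt_chain lt T" "i \<notin> \<rho> ` T"
      by blast
    then show "F \<in> (\<Union>\<sigma>\<in>?I. star_rels P lt k \<sigma>) \<union> {{}}"
    proof cases
      case 2
      then obtain A where A: "A \<in> star P lt k T" by blast
      obtain j where j: "\<rho> ` T = {a<..n} - {j}" by (rule missing_rank[OF A 2(5)])
      let ?\<sigma> = "{x \<in> T. \<rho> x \<in> S}"
      \<comment> \<open>A ridge lying in a facet misses exactly one rank; as that rank is outside
        \<open>S\<close>, the ridge contains the whole part of type \<open>S\<close>.\<close>
      have "i = j" using j 2 by auto
      then have "\<rho> ` ?\<sigma> = S" using j S 2(3) by auto
      then have "?\<sigma> \<in> ?I" using 2 lt_chain_subset[OF 2(7), of ?\<sigma>] by auto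
      moreover have "F \<in> star_rels P lt k ?\<sigma>"
        unfolding 2(1) using 2 by (intro star_relsI) auto
      ultimately show ?thesis by blast
    qed simp
  next
    fix F assume "F \<in> (\<Union>\<sigma>\<in>?I. star_rels P lt k \<sigma>) \<union> {{}}"
    then consider "F = {}" | \<sigma> T where "F = star P lt k T" "F \<noteq> {}" "\<sigma> \<in> ?I" "\<sigma> \<subseteq> T"
      "finite T" "Suc (card T) = k"
      unfolding star_rels_def by blast
    then show "F \<in> ?FF \<union> {{}}"
    proof cases
      case 2
      then obtain A where A: "A \<in> star P lt k T" by blast
      note s = starD[OF A]
      obtain j where j: "j \<in> {a<..n}" "\<rho> ` T = {a<..n} - {j}" by (rule missing_rank[OF A 2(6)])
      have "T \<subseteq> P" "lt_chain lt T" using s lt_chain_subset by auto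
      moreover have "j \<notin> S" using 2(3,4) j by auto
      ultimately show ?thesis using 2 j by blast
    qed simp
  qed
  then have "relrank (star P lt k {}) ?FF = relrank (star P lt k {}) (\<Union>\<sigma>\<in>?I. star_rels P lt k \<sigma>)"
    by (rule relrank_empty_rels)
  also have "\<dots> = (\<Sum>\<sigma>\<in>?I. relrank (star P lt k \<sigma>) (star_rels P lt k \<sigma>))"
    unfolding U
  proof (rule relrank_disjoint_union)
    show "finite ?I" using finite_P by (intro finite_subset[of ?I "Pow P"]) auto
    show "star P lt k \<sigma> \<inter> star P lt k \<tau> = {}" if "\<sigma> \<in> ?I" "\<tau> \<in> ?I" "\<sigma> \<noteq> \<tau>" for \<sigma> \<tau>
      using restr[OF that(1)] restr[OF that(2)] that(3) by blast
    show "finite (star P lt k \<sigma>)" for \<sigma> by (rule finite_star[OF finite_P])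
    show "star_rels P lt k \<sigma> \<subseteq> Pow (star P lt k \<sigma>)" for \<sigma> by (rule star_rels_subset)
  qed
  finally show ?thesis by (simp add: linkrank_def)
qed

text \<open>Labels attached to the members of a facet are indexed by the ranks of these members,
  after every label set has been numbered by \<open>th\<close>. Labelled facets then form the
  product \<open>?C \<times> ?W\<close> that \<open>relrank_inflate\<close> needs, and its sum over
  sets \<open>S\<close> of ranks is refined by \<open>star_decompose_by_type\<close> to a sum over
  chains.\<close>

lemma linkrank_labelled:
  assumes m: "m \<ge> 1" and L: "\<And>x. x \<in> P \<Longrightarrow> card (L x) = m"
  shows "linkrank (Sigma P L) (\<lambda>x y. lt (fst x) (fst y)) k {} =
    (\<Sum>\<sigma> | \<sigma> \<subseteq> P \<and> lt_chain lt \<sigma>. (m - 1) ^ card \<sigma> * linkrank P lt k \<sigma>)"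
proof -
  let ?P = "Sigma P L"
  let ?lt = "\<lambda>x y. lt (fst x) (fst y)"
  let ?D = "{a<..n}"
  let ?W = "?D \<rightarrow>\<^sub>E {..<m}"
  let ?C = "star P lt k {}"
  have "\<exists>h. bij_betw h {..<m} (L x)" if "x \<in> P" for x
  proof -
    have "finite (L x)" using L[OF that] m by (intro card_ge_0_finite) simp
    from ex_bij_betw_nat_finite[OF this] show ?thesis
      using L[OF that] by (simp add: lessThan_atLeast0)
  qed
  then obtain th where th: "\<And>x. x \<in> P \<Longrightarrow> bij_betw (th x) {..<m} (L x)"
    by metis
  have thL: "th x t \<in> L x" if "x \<in> P" "t < m" for x t
    using th[OF that(1)] that(2) by (auto simp: bij_betw_def)
  have th_inj: "s = t" if "x \<in> P" "s < m" "t < m" "th x s = th x t" for x s t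
    using th[OF that(1)] that(2-) by (auto simp: bij_betw_def inj_on_def)
  have th_surj: "\<exists>t<m. s = th x t" if "x \<in> P" "s \<in> L x" for x s
    using th[OF that(1)] that(2) by (auto simp: bij_betw_def)
  define lab where "lab A w = (\<lambda>x. (x, th x (w (\<rho> x)))) ` A" for A and w :: "nat \<Rightarrow> nat"
  have mem_lab: "(x, s) \<in> lab A w \<longleftrightarrow> x \<in> A \<and> s = th x (w (\<rho> x))" for x s A w
    by (auto simp: lab_def)
  have fst_lab: "fst ` lab A w = A" for A w
    by (simp add: lab_def image_image)
  have card_lab: "card (lab A w) = card A" for A w
    unfolding lab_def by (intro card_image) (auto simp: inj_on_def)
  have fin_lab: "finite (lab A w) \<longleftrightarrow> finite A" for A w
    unfolding lab_def by (intro finite_image_iff) (auto simp: inj_on_def)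
  have WI: "w i < m" if "w \<in> ?W" "i \<in> ?D" for w i
    using that by auto
  have lab_star: "lab A w \<in> star ?P ?lt k {}" if A: "A \<in> ?C" and w: "w \<in> ?W" for A w
  proof (rule starI)
    note s = starD[OF A]
    show "lab A w \<subseteq> ?P"
      using s(1) thL WI[OF w rank_bounds] by (auto simp: mem_lab)
    show "lt_chain ?lt (lab A w)"
      unfolding lt_chain_def
    proof (intro ballI impI)
      fix u v assume "u \<in> lab A w" "v \<in> lab A w" "u \<noteq> v"
      then obtain x y where xy: "x \<in> A" "y \<in> A" "u = (x, th x (w (\<rho> x)))" "v = (y, th y (w (\<rho> y)))"
        unfolding lab_def by blast
      with \<open>u \<noteq> v\<close> have "x \<noteq> y" by auto
      then have "lt x y \<or> lt y x"
        using s(4) xy(1,2) unfolding lt_chain_def by blast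
      then show "lt (fst u) (fst v) \<or> lt (fst v) (fst u)"
        by (simp add: xy)
    qed
  qed (use starD[OF A] in \<open>auto simp: card_lab fin_lab\<close>)
  have lab_surj: "\<exists>A\<in>?C. \<exists>w\<in>?W. A' = lab A w" if A': "A' \<in> star ?P ?lt k {}" for A'
  proof -
    note s = starD[OF A']
    have irr: "\<not> lt x x" if "x \<in> P" for x using rank_mono[OF that that] by auto
    have inj: "inj_on fst A'"
    proof (rule inj_onI)
      fix x y assume xy: "x \<in> A'" "y \<in> A'" "fst x = fst y"
      show "x = y"
      proof (rule ccontr)
        assume "x \<noteq> y"
        then have "lt (fst x) (fst y) \<or> lt (fst y) (fst x)"
          using s(4) xy unfolding lt_chain_def by blast
        moreover have "fst x \<in> P" using s(1) xy by auto
        ultimately show False using irr xy by simp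
      qed
    qed
    let ?A = "fst ` A'"
    have AP: "?A \<subseteq> P" using s(1) by auto
    have ch: "lt_chain lt ?A"
      unfolding lt_chain_def
    proof (intro ballI impI)
      fix x y assume "x \<in> ?A" "y \<in> ?A" "x \<noteq> y"
      then obtain x' y' where "x' \<in> A'" "y' \<in> A'" "x = fst x'" "y = fst y'" "x' \<noteq> y'" by auto
      then show "lt x y \<or> lt y x"
        using s(4) unfolding lt_chain_def by blast
    qed
    have A: "?A \<in> ?C"
      using s AP ch card_image[OF inj] by (intro starI) auto
    have inj\<rho>: "inj_on \<rho> ?A" by (rule inj_on_rank[OF AP ch])
    \<comment> \<open>\<open>e i\<close> is the member of rank \<open>i\<close> in the labelled
      facet; its second component determines the value of the labelling at \<open>i\<close>.\<close>
    define e where "e i = (THE x. x \<in> A' \<and> \<rho> (fst x) = i)" for i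
    have e: "e (\<rho> (fst x)) = x" if x: "x \<in> A'" for x
      unfolding e_def
    proof (rule the_equality)
      show "x \<in> A' \<and> \<rho> (fst x) = \<rho> (fst x)" using x by simp
      fix y assume "y \<in> A' \<and> \<rho> (fst y) = \<rho> (fst x)"
      then show "y = x"
        using x inj_onD[OF inj\<rho>, of "fst y" "fst x"] inj_onD[OF inj, of y x] by auto
    qed
    define w where "w = (\<lambda>i\<in>?D. SOME t. t < m \<and> snd (e i) = th (fst (e i)) t)"
    have w: "w (\<rho> (fst x)) < m \<and> snd x = th (fst x) (w (\<rho> (fst x)))" if x: "x \<in> A'" for x
    proof -
      have x1: "fst x \<in> P" "snd x \<in> L (fst x)" using s(1) x by auto
      have "w (\<rho> (fst x)) = (SOME t. t < m \<and> snd x = th (fst x) t)"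
        using rank_bounds[OF x1(1)] by (simp add: w_def e[OF x])
      moreover have "\<exists>t. t < m \<and> snd x = th (fst x) t"
        using th_surj[OF x1] by blast
      ultimately show ?thesis
        using someI_ex[of "\<lambda>t. t < m \<and> snd x = th (fst x) t"] by simp
    qed
    have "w \<in> ?W"
    proof (rule PiE_I)
      fix i assume "i \<in> ?D"
      then have "i \<in> \<rho> ` ?A" using rank_image[OF A] by simp
      then show "w i \<in> {..<m}" using w by auto
    next
      fix i assume "i \<notin> ?D"
      then show "w i = undefined" unfolding w_def restrict_def by (rule if_not_P)
    qed
    moreover have "A' = lab ?A w"
    proof -
      have "lab ?A w = (\<lambda>x. (fst x, th (fst x) (w (\<rho> (fst x))))) ` A'"
        by (simp add: lab_def image_image)
      also have "\<dots> = (\<lambda>x. x) ` A'"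
      proof (rule image_cong[OF refl])
        fix x assume "x \<in> A'"
        then show "(fst x, th (fst x) (w (\<rho> (fst x)))) = x"
          using w[of x] by (cases x) simp
      qed
      finally show ?thesis by simp
    qed
    ultimately show ?thesis using A by blast
  qed
  define FF where "FF i = {star P lt k T | T. finite T \<and> Suc (card T) = k \<and> T \<subseteq> P \<and> lt_chain lt T \<and> i \<notin> \<rho> ` T}" for i
  define \<phi> where "\<phi> q = lab (fst q) (snd q)" for q
  have FF_sub: "FF i \<subseteq> Pow ?C" for i
    unfolding FF_def by (auto simp: star_def)
  \<comment> \<open>The star of a labelled ridge: its facets extend \<open>T\<close> by an element
    of the missing rank \<open>i\<close> with any label, so the labelling is prescribed everywhere
    except at \<open>i\<close>.\<close>
  have key: "\<phi> ` (star P lt k T \<times> {w(i := t) | t. t < m}) = star ?P ?lt k (lab T w)"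
    if T: "finite T" "Suc (card T) = k" "T \<subseteq> P" "lt_chain lt T" "i \<in> ?D" "i \<notin> \<rho> ` T" and w: "w \<in> ?W"
    for T i w
  proof (intro equalityI subsetI)
    fix B' assume "B' \<in> \<phi> ` (star P lt k T \<times> {w(i := t) | t. t < m})"
    then obtain B t where B: "B \<in> star P lt k T" "t < m" "B' = lab B (w(i := t))"
      by (auto simp: \<phi>_def)
    have "w(i := t) \<in> ?W" using w T(5) B(2) by (auto simp: PiE_iff extensional_def)
    moreover have "B \<in> ?C" using starD[OF B(1)] by (intro starI) auto
    ultimately have "B' \<in> star ?P ?lt k {}" unfolding B(3) by (intro lab_star)
    moreover have "lab T w \<subseteq> B'"
    proof
      fix z assume "z \<in> lab T w"
      then obtain x where "x \<in> T" "z = (x, th x (w (\<rho> x)))" by (auto simp: lab_def)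
      moreover from this have "x \<in> B" "\<rho> x \<noteq> i" using starD(5)[OF B(1)] T(6) by auto
      ultimately show "z \<in> B'" by (simp add: B(3) mem_lab)
    qed
    ultimately show "B' \<in> star ?P ?lt k (lab T w)" by (simp add: star_def)
  next
    fix B' assume B': "B' \<in> star ?P ?lt k (lab T w)"
    then have "B' \<in> star ?P ?lt k {}" "lab T w \<subseteq> B'" by (auto simp: star_def)
    then obtain B w' where B: "B \<in> ?C" "w' \<in> ?W" "B' = lab B w'" using lab_surj by blast
    have TB: "T \<subseteq> B" using image_mono[OF \<open>lab T w \<subseteq> B'\<close>, of fst] unfolding B(3) fst_lab .
    then have BT: "B \<in> star P lt k T" using starD[OF B(1)] by (intro starI) auto
    obtain j where j: "j \<in> ?D" "\<rho> ` T = ?D - {j}" by (rule missing_rank[OF BT T(2)])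
    then have ij: "i = j" using T(5,6) by auto
    \<comment> \<open>Every rank other than \<open>i\<close> is attained in \<open>T\<close>, where
      both labellings name the same element of the label set; injectivity of \<open>th\<close> makes
      them agree there.\<close>
    have "w' = w(i := w' i)"
    proof
      fix l
      show "w' l = (w(i := w' i)) l"
      proof (cases "l \<in> ?D - {i}")
        case True
        then have "l \<in> \<rho> ` T" using j ij by simp
        then obtain x where x: "x \<in> T" "\<rho> x = l" by blast
        then have "(x, th x (w l)) \<in> lab T w" by (simp add: mem_lab)
        then have "(x, th x (w l)) \<in> lab B w'"
          using \<open>lab T w \<subseteq> B'\<close> B(3) by blast
        then have "th x (w l) = th x (w' l)" using x by (simp add: mem_lab)
        then have "w l = w' l"
          using th_inj[of x "w l" "w' l"] x T(3) WI[OF w] WI[OF B(2)] True by auto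
        then show ?thesis using True by simp
      next
        case False
        then show ?thesis using PiE_arb[OF w, of l] PiE_arb[OF B(2), of l] by (cases "l = i") auto
      qed
    qed
    moreover have "w' i < m" using WI[OF B(2) T(5)] .
    ultimately have "(B, w') \<in> star P lt k T \<times> {w(i := t) | t. t < m}" using BT by blast
    then show "B' \<in> \<phi> ` (star P lt k T \<times> {w(i := t) | t. t < m})"
      by (rule rev_image_eqI) (simp add: \<phi>_def B(3))
  qed
  have "linkrank ?P ?lt k {} = relrank (?C \<times> ?W) (lift_rels m ?D {} FF)"
    unfolding linkrank_def
  proof (rule relrank_bij'[where \<phi> = \<phi>])
    show "finite (?C \<times> ?W)"
      by (intro finite_cartesian_product finite_star finite_P finite_PiE) auto
    show "bij_betw \<phi> (?C \<times> ?W) (star ?P ?lt k {})"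
      unfolding bij_betw_def
    proof
      show "inj_on \<phi> (?C \<times> ?W)"
      proof (rule inj_onI)
        fix q q' assume q: "q \<in> ?C \<times> ?W" "q' \<in> ?C \<times> ?W" and eq: "\<phi> q = \<phi> q'"
        obtain A w A' w' where qq: "q = (A, w)" "q' = (A', w')" by fastforce
        have eq': "lab A w = lab A' w'" using eq by (simp add: \<phi>_def qq)
        then have A: "A' = A" using fst_lab by metis
        have AC: "A \<in> ?C" and ww: "w \<in> ?W" "w' \<in> ?W" using q qq by auto
        have "w = w'"
        proof (rule PiE_ext[OF ww])
          fix i assume i: "i \<in> ?D"
          then have "i \<in> \<rho> ` A" using rank_image[OF AC] by simp
          then obtain x where x: "x \<in> A" "\<rho> x = i" by blast
          then have "(x, th x (w i)) \<in> lab A w'" unfolding eq'[unfolded A, symmetric] by (simp add: mem_lab)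
          then have "th x (w i) = th x (w' i)" using x by (simp add: mem_lab)
          then show "w i = w' i"
            using th_inj[of x] x starD(1)[OF AC] WI[OF ww(1) i] WI[OF ww(2) i] by auto
        qed
        then show "q = q'" by (simp add: qq A)
      qed
      show "\<phi> ` (?C \<times> ?W) = star ?P ?lt k {}"
      proof (intro equalityI subsetI)
        fix z assume "z \<in> \<phi> ` (?C \<times> ?W)"
        then obtain A w where "A \<in> ?C" "w \<in> ?W" "z = lab A w" by (auto simp: \<phi>_def)
        then show "z \<in> star ?P ?lt k {}" using lab_star by simp
      next
        fix z assume "z \<in> star ?P ?lt k {}"
        from lab_surj[OF this] obtain A w where "A \<in> ?C" "w \<in> ?W" "z = lab A w" by blast
        then show "z \<in> \<phi> ` (?C \<times> ?W)" by (intro image_eqI[of _ _ "(A, w)"]) (auto simp: \<phi>_def)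
      qed
    qed
    have "F \<subseteq> ?C \<times> ?W" if "F \<in> lift_rels m ?D {} FF" for F
      using that
    proof (rule lift_relsE)
      fix F' w i assume *: "F = F' \<times> {w(i := t) | t. t < m}" "i \<in> ?D" "F' \<in> FF i" "w \<in> ?W"
      have "F' \<subseteq> ?C" using FF_sub *(3) by blast
      moreover have "w(i := t) \<in> ?W" if "t < m" for t
        using *(2,4) that by (auto simp: PiE_iff extensional_def)
      ultimately show ?thesis unfolding *(1) by blast
    qed blast
    then show "lift_rels m ?D {} FF \<subseteq> Pow (?C \<times> ?W)" by blast
    show "\<phi> ` F \<in> star_rels ?P ?lt k {}" if "F \<in> lift_rels m ?D {} FF" for F
      using that
    proof (rule lift_relsE)
      fix F' w i assume *: "F = F' \<times> {w(i := t) | t. t < m}" "i \<in> ?D" "F' \<in> FF i" "w \<in> ?W"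
      from *(3) obtain T where T: "F' = star P lt k T" "finite T" "Suc (card T) = k" "T \<subseteq> P" "lt_chain lt T" "i \<notin> \<rho> ` T"
        unfolding FF_def by blast
      show ?thesis
        unfolding *(1) T(1) key[OF T(2-5) *(2) T(6) *(4)]
        using T by (intro star_relsI) (auto simp: card_lab fin_lab)
    qed blast
    show "\<exists>F\<in>lift_rels m ?D {} FF. \<phi> ` F = G" if G: "G \<in> star_rels ?P ?lt k {}" "G \<noteq> {}" for G
    proof -
      obtain T' where T': "G = star ?P ?lt k T'" "finite T'" "Suc (card T') = k"
        using G(1) by (rule star_relsE)
      then obtain B' where B': "B' \<in> star ?P ?lt k T'" using G(2) by blast
      then have "B' \<in> star ?P ?lt k {}" "T' \<subseteq> B'" by (auto simp: star_def)
      then obtain B w where B: "B \<in> ?C" "w \<in> ?W" "B' = lab B w" using lab_surj by blast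
      let ?T = "fst ` T'"
      have T'lab: "T' = lab ?T w"
      proof -
        have "x = (fst x, th (fst x) (w (\<rho> (fst x))))" if "x \<in> T'" for x
          using that \<open>T' \<subseteq> B'\<close> mem_lab[of "fst x" "snd x" B w] by (cases x) (auto simp: B(3))
        then have "(\<lambda>x. x) ` T' = (\<lambda>x. (fst x, th (fst x) (w (\<rho> (fst x))))) ` T'"
          by (intro image_cong refl)
        then show ?thesis by (simp add: lab_def image_image)
      qed
      have cT: "card ?T = card T'" using card_lab[of ?T w] T'lab by simp
      have TB: "?T \<subseteq> B" using \<open>T' \<subseteq> B'\<close> fst_lab[of B w] B(3) by blast
      note s = starD[OF B(1)]
      have BT: "B \<in> star P lt k ?T" using s TB by (intro starI) auto
      obtain i where i: "i \<in> ?D" "\<rho> ` ?T = ?D - {i}"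
        by (rule missing_rank[OF BT]) (use cT T' in auto)
      have T: "finite ?T" "Suc (card ?T) = k" "?T \<subseteq> P" "lt_chain lt ?T" "i \<notin> \<rho> ` ?T"
        using T' cT TB s lt_chain_subset[OF s(4) TB] i by auto
      have "star P lt k ?T \<in> FF i" unfolding FF_def using T by blast
      then have "star P lt k ?T \<times> {w(i := t) | t. t < m} \<in> lift_rels m ?D {} FF"
        using i(1) B(2) by (intro lift_relsI2)
      moreover have "\<phi> ` (star P lt k ?T \<times> {w(i := t) | t. t < m}) = G"
        unfolding key[OF T(1-4) i(1) T(5) B(2)] T'lab[symmetric] T'(1) ..
      ultimately show ?thesis by (intro bexI)
    qed
  qed
  also have "\<dots> = (\<Sum>S\<in>Pow ?D. (m - 1) ^ card S * relrank ?C ({} \<union> (\<Union>i\<in>?D - S. FF i)))"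
    by (rule relrank_inflate[OF finite_star[OF finite_P] _ m _ FF_sub]) auto
  also have "\<dots> = (\<Sum>S\<in>Pow ?D. (m - 1) ^ card S *
      (\<Sum>\<sigma> | \<sigma> \<subseteq> P \<and> lt_chain lt \<sigma> \<and> \<rho> ` \<sigma> = S. linkrank P lt k \<sigma>))"
    using star_decompose_by_type by (intro sum.cong refl) (simp add: FF_def)
  \<comment> \<open>A chain has as many elements as ranks, so \<open>card S\<close> may be replaced
    by \<open>card \<sigma>\<close>; afterwards the double sum is just the sum over all chains,
    sorted by their sets of ranks.\<close>
  also have "\<dots> = (\<Sum>S\<in>Pow ?D. \<Sum>\<sigma> | \<sigma> \<in> {\<sigma>. \<sigma> \<subseteq> P \<and> lt_chain lt \<sigma>} \<and> \<rho> ` \<sigma> = S.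
      (m - 1) ^ card \<sigma> * linkrank P lt k \<sigma>)"
  proof (rule sum.cong[OF refl])
    fix S
    have "card \<sigma> = card S" if "\<sigma> \<subseteq> P" "lt_chain lt \<sigma>" "\<rho> ` \<sigma> = S" for \<sigma>
      using card_image[OF inj_on_rank[OF that(1,2)]] that(3) by simp
    then show "(m - 1) ^ card S * (\<Sum>\<sigma> | \<sigma> \<subseteq> P \<and> lt_chain lt \<sigma> \<and> \<rho> ` \<sigma> = S. linkrank P lt k \<sigma>) =
      (\<Sum>\<sigma> | \<sigma> \<in> {\<sigma>. \<sigma> \<subseteq> P \<and> lt_chain lt \<sigma>} \<and> \<rho> ` \<sigma> = S. (m - 1) ^ card \<sigma> * linkrank P lt k \<sigma>)"
      unfolding sum_distrib_left by (intro sum.cong) auto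
  qed
  also have "\<dots> = (\<Sum>\<sigma> | \<sigma> \<subseteq> P \<and> lt_chain lt \<sigma>. (m - 1) ^ card \<sigma> * linkrank P lt k \<sigma>)"
  proof (rule sum.group)
    show "finite {\<sigma>. \<sigma> \<subseteq> P \<and> lt_chain lt \<sigma>}"
      by (rule finite_subset[of _ "Pow P"]) (use finite_P in auto)
    show "(`) \<rho> ` {\<sigma>. \<sigma> \<subseteq> P \<and> lt_chain lt \<sigma>} \<subseteq> Pow ?D"
      using rank_bounds by blast
  qed simp
  finally show ?thesis .
qed

text \<open>The link of a chain with least element \<open>v\<close> is a join: a facet through it
  consists of a part below \<open>v\<close>, of \<open>v\<close>, and of a part above
  \<open>v\<close> containing \<sigma>, and transitivity makes any two such parts compatible. A
  ridge drops an element of just one part, which is the shape of the relations in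
  \<open>relrank_prod\<close>.\<close>

lemma linkrank_insert:
  assumes v: "v \<in> P" and \<sigma>: "\<sigma> \<subseteq> {x \<in> P. lt v x}"
    and trans: "\<And>x y z. x \<in> P \<Longrightarrow> y \<in> P \<Longrightarrow> z \<in> P \<Longrightarrow> lt x y \<Longrightarrow> lt y z \<Longrightarrow> lt x z"
  shows "linkrank P lt k (insert v \<sigma>) =
    linkrank {x \<in> P. lt x v} lt (\<rho> v - a - 1) {} * linkrank {x \<in> P. lt v x} lt (n - \<rho> v) \<sigma>"
proof -
  let ?L = "{x \<in> P. lt x v}" and ?U = "{x \<in> P. lt v x}"
  let ?kl = "\<rho> v - a - 1" and ?ku = "n - \<rho> v"
  let ?C = "star P lt k (insert v \<sigma>)"
  let ?X = "star ?L lt ?kl {}" and ?Y = "star ?U lt ?ku \<sigma>"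
  have \<rho>v: "a < \<rho> v" "\<rho> v \<le> n" using rank_bounds[OF v] by auto
  then have k: "k = Suc (?kl + ?ku)" by simp
  have irr: "\<not> lt v v" using rank_mono[OF v v] by auto
  have asym: "\<not> lt v x" if "x \<in> P" "lt x v" for x
    using rank_mono[OF that(1) v that(2)] rank_mono[OF v that(1)] by auto
  have LU: "?L \<inter> ?U = {}" "v \<notin> ?L" "v \<notin> ?U" using asym irr by auto
  define \<phi> where "\<phi> q = insert v (fst q \<union> snd q)" for q :: "'a set \<times> 'a set"
  have L: "C \<inter> ?L \<in> ?X" and U: "C \<inter> ?U \<in> ?Y" and split: "C = insert v ((C \<inter> ?L) \<union> (C \<inter> ?U))"
    if C: "C \<in> ?C" for C
  proof -
    note s = starD[OF C]
    have vC: "v \<in> C" using s(5) by auto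
    have cmp: "x = v \<or> lt x v \<or> lt v x" if "x \<in> C" for x
      using s(4) that vC unfolding lt_chain_def by blast
    show split: "C = insert v ((C \<inter> ?L) \<union> (C \<inter> ?U))"
      using cmp s(1) vC by blast
    have inj: "inj_on \<rho> C" by (rule inj_on_rank[OF s(1,4)])
    have im: "\<rho> ` C = {a<..n}" using C s by (intro rank_image[of C "insert v \<sigma>"])
    have CL: "C \<inter> ?L = {x \<in> C. \<rho> x < \<rho> v}"
      using cmp s(1) rank_mono[OF _ v] rank_mono[OF v] by fastforce
    have CU: "C \<inter> ?U = {x \<in> C. \<rho> v < \<rho> x}"
      using cmp s(1) rank_mono[OF _ v] rank_mono[OF v] by fastforce
    \<comment> \<open>Elements of a facet are counted by their ranks; inside a facet, lying below or
      above \<open>v\<close> is a matter of rank, so the two parts have sizes \<open>?kl\<close> and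
      \<open>?ku\<close>.\<close>
    have card: "card {x \<in> C. Q (\<rho> x)} = card {i \<in> {a<..n}. Q i}" for Q
    proof -
      have "\<rho> ` {x \<in> C. Q (\<rho> x)} = {i \<in> {a<..n}. Q i}" unfolding im[symmetric] by auto
      then show ?thesis using card_image[OF inj_on_subset[OF inj, of "{x \<in> C. Q (\<rho> x)}"]] by simp
    qed
    have "{i \<in> {a<..n}. i < \<rho> v} = {a<..<\<rho> v}" "{i \<in> {a<..n}. \<rho> v < i} = {\<rho> v<..n}"
      using \<rho>v by auto
    then have "card (C \<inter> ?L) = ?kl" "card (C \<inter> ?U) = ?ku"
      unfolding CL CU using card[of "\<lambda>i. i < \<rho> v"] card[of "\<lambda>i. \<rho> v < i"] by simp_all
    then show "C \<inter> ?L \<in> ?X" "C \<inter> ?U \<in> ?Y"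
      using s lt_chain_subset[OF s(4), of "C \<inter> ?L"] lt_chain_subset[OF s(4), of "C \<inter> ?U"] \<sigma>
      by (auto intro!: starI)
  qed
  have \<phi>C: "\<phi> (A, B) \<in> ?C" if A: "A \<in> ?X" and B: "B \<in> ?Y" for A B
  proof -
    note sA = starD[OF A] and sB = starD[OF B]
    have AB: "A \<inter> B = {}" "v \<notin> A \<union> B" using sA(1) sB(1) LU by blast+
    show ?thesis
      unfolding \<phi>_def fst_conv snd_conv
    proof (rule starI)
      show "card (insert v (A \<union> B)) = k"
        using AB sA sB k by (simp add: card_Un_disjoint)
      show "lt_chain lt (insert v (A \<union> B))"
        unfolding lt_chain_def
      proof (intro ballI impI)
        fix x y assume xy: "x \<in> insert v (A \<union> B)" "y \<in> insert v (A \<union> B)" "x \<noteq> y"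
        have 1: "x \<in> P" "lt x v" if "x \<in> A" for x using that sA(1) by auto
        have 2: "x \<in> P" "lt v x" if "x \<in> B" for x using that sB(1) by auto
        have 3: "lt x y" if "x \<in> A" "y \<in> B" for x y
          using trans[OF 1(1)[OF that(1)] v 2(1)[OF that(2)] 1(2)[OF that(1)] 2(2)[OF that(2)]] .
        have 4: "lt x y \<or> lt y x" if "x \<in> A" "y \<in> A" "x \<noteq> y" for x y
          using sA(4) that unfolding lt_chain_def by blast
        have 5: "lt x y \<or> lt y x" if "x \<in> B" "y \<in> B" "x \<noteq> y" for x y
          using sB(4) that unfolding lt_chain_def by blast
        show "lt x y \<or> lt y x"
          using xy 1(2) 2(2) 3 4 5 by blast
      qed
    qed (use sA sB v in auto)
  qed
  have \<phi>L: "\<phi> (A, B) \<inter> ?L = A" and \<phi>U: "\<phi> (A, B) \<inter> ?U = B" if "A \<subseteq> ?L" "B \<subseteq> ?U" for A B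
    using that LU unfolding \<phi>_def by auto
  have cardT: "card (\<phi> (A, B)) = Suc (card A + card B)" if "A \<subseteq> ?L" "B \<subseteq> ?U" for A B
  proof -
    have "finite A" "finite B" using that finite_P by (auto intro: finite_subset)
    moreover have "A \<inter> B = {}" "v \<notin> A \<union> B" using that LU by blast+
    ultimately show ?thesis by (simp add: \<phi>_def card_Un_disjoint)
  qed
  have img1: "\<phi> ` (star ?L lt ?kl T \<times> {B}) = star P lt k (\<phi> (T, B))" if B: "B \<in> ?Y" and T: "T \<subseteq> ?L" for T B
  proof (intro equalityI subsetI)
    fix C assume "C \<in> \<phi> ` (star ?L lt ?kl T \<times> {B})"
    then obtain A where A: "A \<in> star ?L lt ?kl T" "C = \<phi> (A, B)" by auto
    have "A \<in> ?X" using A(1) by (simp add: star_def)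
    from \<phi>C[OF this B] show "C \<in> star P lt k (\<phi> (T, B))"
      using starD(5)[OF A(1)] unfolding A(2) by (auto simp: star_def \<phi>_def)
  next
    fix C assume "C \<in> star P lt k (\<phi> (T, B))"
    note s = starD[OF this]
    have C: "C \<in> ?C" using s starD(5)[OF B] by (intro starI) (auto simp: \<phi>_def)
    have "B \<subseteq> C \<inter> ?U" using s(5) starD(1)[OF B] by (auto simp: \<phi>_def)
    then have "B = C \<inter> ?U"
      using starD(2,3)[OF U[OF C]] starD(3)[OF B] by (intro card_subset_eq) auto
    moreover have "C \<inter> ?L \<in> star ?L lt ?kl T"
      using L[OF C] s(5) T by (auto simp: star_def \<phi>_def)
    ultimately have "(C \<inter> ?L, C \<inter> ?U) \<in> star ?L lt ?kl T \<times> {B}" by simp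
    moreover have "C = \<phi> (C \<inter> ?L, C \<inter> ?U)" using split[OF C] by (simp add: \<phi>_def)
    ultimately show "C \<in> \<phi> ` (star ?L lt ?kl T \<times> {B})" by (rule rev_image_eqI)
  qed
  have img2: "\<phi> ` ({A} \<times> star ?U lt ?ku T) = star P lt k (\<phi> (A, T))"
    if A: "A \<in> ?X" and T: "T \<subseteq> ?U" "\<sigma> \<subseteq> T" for T A
  proof (intro equalityI subsetI)
    fix C assume "C \<in> \<phi> ` ({A} \<times> star ?U lt ?ku T)"
    then obtain B where B: "B \<in> star ?U lt ?ku T" "C = \<phi> (A, B)" by auto
    have "B \<in> ?Y" using B(1) T(2) by (auto simp: star_def)
    from \<phi>C[OF A this] show "C \<in> star P lt k (\<phi> (A, T))"
      using starD(5)[OF B(1)] unfolding B(2) by (auto simp: star_def \<phi>_def)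
  next
    fix C assume "C \<in> star P lt k (\<phi> (A, T))"
    note s = starD[OF this]
    have C: "C \<in> ?C" using s T(2) by (intro starI) (auto simp: \<phi>_def)
    have "A \<subseteq> C \<inter> ?L" using s(5) starD(1)[OF A] by (auto simp: \<phi>_def)
    then have "A = C \<inter> ?L"
      using starD(2,3)[OF L[OF C]] starD(3)[OF A] by (intro card_subset_eq) auto
    moreover have "C \<inter> ?U \<in> star ?U lt ?ku T"
      using U[OF C] s(5) T by (auto simp: star_def \<phi>_def)
    ultimately have "(C \<inter> ?L, C \<inter> ?U) \<in> {A} \<times> star ?U lt ?ku T" by simp
    moreover have "C = \<phi> (C \<inter> ?L, C \<inter> ?U)" using split[OF C] by (simp add: \<phi>_def)
    ultimately show "C \<in> \<phi> ` ({A} \<times> star ?U lt ?ku T)" by (rule rev_image_eqI)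
  qed
  let ?FF = "star_rels ?L lt ?kl {}" and ?GG = "star_rels ?U lt ?ku \<sigma>"
  let ?RR = "{F \<times> {B} | F B. F \<in> ?FF \<and> B \<in> ?Y} \<union> {{A} \<times> G | A G. A \<in> ?X \<and> G \<in> ?GG}"
  have fin: "finite ?L" "finite ?U" using finite_P by auto
  have "linkrank P lt k (insert v \<sigma>) = relrank (?X \<times> ?Y) ?RR"
    unfolding linkrank_def
  proof (rule relrank_bij'[where \<phi> = \<phi>])
    show "finite (?X \<times> ?Y)" by (intro finite_cartesian_product finite_star fin)
    show "bij_betw \<phi> (?X \<times> ?Y) ?C"
      unfolding bij_betw_def
    proof
      show "inj_on \<phi> (?X \<times> ?Y)"
      proof (rule inj_onI)
        fix q q' assume q: "q \<in> ?X \<times> ?Y" "q' \<in> ?X \<times> ?Y" and eq: "\<phi> q = \<phi> q'"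
        obtain A B A' B' where qq: "q = (A, B)" "q' = (A', B')" by fastforce
        have sub: "A \<subseteq> ?L" "B \<subseteq> ?U" "A' \<subseteq> ?L" "B' \<subseteq> ?U"
          using q qq by (auto simp: star_def)
        have "A = \<phi> (A, B) \<inter> ?L" "B = \<phi> (A, B) \<inter> ?U"
          by (rule \<phi>L[OF sub(1,2), symmetric], rule \<phi>U[OF sub(1,2), symmetric])
        moreover have "A' = \<phi> (A', B') \<inter> ?L" "B' = \<phi> (A', B') \<inter> ?U"
          by (rule \<phi>L[OF sub(3,4), symmetric], rule \<phi>U[OF sub(3,4), symmetric])
        ultimately have "A = A'" "B = B'" using eq unfolding qq by (simp_all only:)
        then show "q = q'" by (simp add: qq)
      qed
      show "\<phi> ` (?X \<times> ?Y) = ?C"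
      proof (intro equalityI subsetI)
        fix C assume "C \<in> \<phi> ` (?X \<times> ?Y)"
        then obtain A B where "A \<in> ?X" "B \<in> ?Y" "C = \<phi> (A, B)" by blast
        then show "C \<in> ?C" using \<phi>C by simp
      next
        fix C assume C: "C \<in> ?C"
        show "C \<in> \<phi> ` (?X \<times> ?Y)"
          using L[OF C] U[OF C] split[OF C]
          by (intro image_eqI[of _ _ "(C \<inter> ?L, C \<inter> ?U)"]) (auto simp: \<phi>_def)
      qed
    qed
    have "?FF \<subseteq> Pow ?X" "?GG \<subseteq> Pow ?Y" by (rule star_rels_subset)+
    then show "?RR \<subseteq> Pow (?X \<times> ?Y)" by blast
    show "\<phi> ` H \<in> star_rels P lt k (insert v \<sigma>)" if H: "H \<in> ?RR" "H \<noteq> {}" for H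
      using H(1)
    proof
      assume "H \<in> {F \<times> {B} | F B. F \<in> ?FF \<and> B \<in> ?Y}"
      then obtain F B where F: "H = F \<times> {B}" "F \<in> ?FF" "B \<in> ?Y" by blast
      from F(2) obtain T where T: "F = star ?L lt ?kl T" "finite T" "Suc (card T) = ?kl"
        by (rule star_relsE)
      have TL: "T \<subseteq> ?L" using H(2) unfolding F(1) T(1) by (auto simp: star_def)
      have "Suc (card (\<phi> (T, B))) = k"
        using cardT[OF TL starD(1)[OF F(3)]] T(3) starD(3)[OF F(3)] k by simp
      then show ?thesis
        unfolding F(1) T(1) img1[OF F(3) TL]
        using T(2) starD(2,5)[OF F(3)] by (intro star_relsI) (auto simp: \<phi>_def)
    next
      assume "H \<in> {{A} \<times> G | A G. A \<in> ?X \<and> G \<in> ?GG}"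
      then obtain A G where F: "H = {A} \<times> G" "G \<in> ?GG" "A \<in> ?X" by blast
      from F(2) obtain T where T: "G = star ?U lt ?ku T" "\<sigma> \<subseteq> T" "finite T" "Suc (card T) = ?ku"
        by (rule star_relsE)
      have TU: "T \<subseteq> ?U" using H(2) unfolding F(1) T(1) by (auto simp: star_def)
      have "Suc (card (\<phi> (A, T))) = k"
        using cardT[OF starD(1)[OF F(3)] TU] T(4) starD(3)[OF F(3)] k by simp
      then show ?thesis
        unfolding F(1) T(1) img2[OF F(3) TU T(2)]
        using T(2,3) starD(2)[OF F(3)] by (intro star_relsI) (auto simp: \<phi>_def)
    qed
    show "\<exists>H\<in>?RR. \<phi> ` H = G" if G: "G \<in> star_rels P lt k (insert v \<sigma>)" "G \<noteq> {}" for G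
    proof -
      obtain T where T: "G = star P lt k T" "insert v \<sigma> \<subseteq> T" "finite T" "Suc (card T) = k"
        using G(1) by (rule star_relsE)
      then obtain C where CT: "C \<in> star P lt k T" using G(2) by blast
      note s = starD[OF CT]
      have C: "C \<in> ?C" using s T(2) by (intro starI) auto
      let ?A = "T \<inter> ?L" and ?B = "T \<inter> ?U"
      have Tsplit: "T = \<phi> (?A, ?B)"
        using split[OF C] s(5) T(2) unfolding \<phi>_def by auto
      have AB: "?A \<subseteq> ?L" "?B \<subseteq> ?U" "\<sigma> \<subseteq> ?B" using \<sigma> T(2) by auto
      have sum: "card ?A + card ?B + 1 = ?kl + ?ku"
        using cardT[OF AB(1,2)] Tsplit T(4) k by simp
      note sL = starD[OF L[OF C]] and sU = starD[OF U[OF C]]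
      have le: "card ?A \<le> ?kl" "card ?B \<le> ?ku"
        using card_mono[OF sL(2), of ?A] card_mono[OF sU(2), of ?B] s(5) sL(3) sU(3) by auto
      \<comment> \<open>The ridge contains \<open>v\<close> and lacks one element of the facet, so
        exactly one of its two parts is short by one.\<close>
      then consider "Suc (card ?A) = ?kl" "card ?B = ?ku" | "card ?A = ?kl" "Suc (card ?B) = ?ku"
        using sum by linarith
      then show ?thesis
      proof cases
        case 1
        have "?B = C \<inter> ?U"
          using 1(2) sU(2,3) s(5) by (intro card_subset_eq) auto
        then have BY: "?B \<in> ?Y" using U[OF C] by simp
        have "star ?L lt ?kl ?A \<in> ?FF"
          using 1 T(3) by (intro star_relsI) auto
        with BY have "star ?L lt ?kl ?A \<times> {?B} \<in> ?RR" by blast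
        moreover have "\<phi> ` (star ?L lt ?kl ?A \<times> {?B}) = G"
          unfolding img1[OF BY AB(1)] T(1) Tsplit[symmetric] ..
        ultimately show ?thesis by (intro bexI)
      next
        case 2
        have "?A = C \<inter> ?L"
          using 2(1) sL(2,3) s(5) by (intro card_subset_eq) auto
        then have AX: "?A \<in> ?X" using L[OF C] by simp
        have "star ?U lt ?ku ?B \<in> ?GG"
          using 2 T(3) AB(3) by (intro star_relsI) auto
        with AX have "{?A} \<times> star ?U lt ?ku ?B \<in> ?RR" by blast
        moreover have "\<phi> ` ({?A} \<times> star ?U lt ?ku ?B) = G"
          unfolding img2[OF AX AB(2,3)] T(1) Tsplit[symmetric] ..
        ultimately show ?thesis by (intro bexI)
      qed
    qed
  qed
  also have "\<dots> = relrank ?X ?FF * relrank ?Y ?GG"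
    by (intro relrank_prod finite_star fin star_rels_subset)
  finally show ?thesis by (simp add: linkrank_def)
qed

lemma graded_poset_above:
  assumes "v \<in> P"
  shows "graded_poset {x \<in> P. lt v x} lt \<rho> (\<rho> v) n"
  using finite_P rank_bounds rank_mono[OF assms] rank_mono by unfold_locales auto

end

text \<open>The value of \<open>linkrank\<close> on a flag after \<open>linkrank_insert\<close> has
  been applied to every member; \<open>a\<close> is the rank above which the current poset
  starts.\<close>

fun flagrank :: "('a \<Rightarrow> 'a \<Rightarrow> bool) \<Rightarrow> ('a \<Rightarrow> nat) \<Rightarrow> nat \<Rightarrow> 'a set \<Rightarrow> nat \<Rightarrow> 'a list \<Rightarrow> nat" where
  "flagrank lt \<rho> n P a [] = linkrank P lt (n - a) {}"
| "flagrank lt \<rho> n P a (v # vs) =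
     linkrank {x \<in> P. lt x v} lt (\<rho> v - a - 1) {} * flagrank lt \<rho> n {x \<in> P. lt v x} (\<rho> v) vs"

text \<open>Splitting off the least member leaves the poset above it, graded from its rank on, in
  which the rest of the flag lies; hence the induction over arbitrary \<open>P\<close> and
  \<open>a\<close>.\<close>

lemma linkrank_flag:
  assumes "graded_poset P lt \<rho> a n"
    and "\<And>x y z. x \<in> P \<Longrightarrow> y \<in> P \<Longrightarrow> z \<in> P \<Longrightarrow> lt x y \<Longrightarrow> lt y z \<Longrightarrow> lt x z"
    and "set vs \<subseteq> P" "sorted_wrt lt vs"
  shows "linkrank P lt (n - a) (set vs) = flagrank lt \<rho> n P a vs"
  using assms
proof (induction vs arbitrary: P a)
  case Nil
  then show ?case by simp
next
  case (Cons v vs)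
  interpret graded_poset P lt \<rho> a n by fact
  have v: "v \<in> P" and vs: "set vs \<subseteq> {x \<in> P. lt v x}" "sorted_wrt lt vs"
    using Cons.prems(3,4) by auto
  have "linkrank {x \<in> P. lt v x} lt (n - \<rho> v) (set vs) = flagrank lt \<rho> n {x \<in> P. lt v x} (\<rho> v) vs"
    using Cons.prems(2) by (intro Cons.IH[OF graded_poset_above[OF v] _ vs]) blast
  then show ?case
    using linkrank_insert[OF v vs(1) Cons.prems(2)] by simp
qed

section \<open>Top homology of order complexes\<close>

lemma distinct_remove_nth_inj:
  assumes "distinct R" "i < length R" "j < length R"
    and "take i R @ drop (Suc i) R = take j R @ drop (Suc j) R"
  shows "i = j"
proof -
  have "set (take i R @ drop (Suc i) R) = set R - {R ! i}" if "i < length R" for i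
  proof -
    have R: "R = take i R @ R ! i # drop (Suc i) R"
      using that by (rule id_take_nth_drop)
    have "distinct (take i R @ R ! i # drop (Suc i) R)"
      using assms(1) R by simp
    then show ?thesis
      by (subst (3) R) auto
  qed
  with assms have "set R - {R ! i} = set R - {R ! j}" by metis
  then have "R ! i = R ! j" using assms(2,3) nth_mem by blast
  then show ?thesis using assms nth_eq_iff_index_eq by blast
qed

lemma (in comm_group) Mod_one_iso:
  "G Mod {\<one>} \<cong> G"
  using trivial_factor_iso by (rule is_isoI)

context graded_poset
begin

lemma sorted_rank:
  assumes "set xs \<subseteq> P" "sorted_wrt lt xs"
  shows "sorted_wrt (<) (map \<rho> xs)"
  using assms
  by (induction xs) (auto simp: rank_mono)

lemma sorted_chain:
  assumes "sorted_wrt lt xs"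
  shows "lt_chain lt (set xs)"
  using assms by (induction xs) (auto simp: lt_chain_def)

lemma sorted_distinct:
  assumes "set xs \<subseteq> P" "sorted_wrt lt xs"
  shows "distinct xs"
  using sorted_rank[OF assms] by (simp add: strict_sorted_iff distinct_map)

lemma sorted_set_unique:
  assumes xs: "set xs \<subseteq> P" "sorted_wrt lt xs" and ys: "sorted_wrt lt ys" and eq: "set xs = set ys"
  shows "xs = ys"
proof -
  have "map \<rho> xs = map \<rho> ys"
    using sorted_rank[OF xs] sorted_rank[of ys] ys xs(1) eq
    by (intro strict_sorted_equal) auto
  moreover have "inj_on \<rho> (set xs \<union> set ys)"
    using inj_on_rank[OF xs(1) sorted_chain[OF xs(2)]] eq by simp
  ultimately show ?thesis by (rule map_inj_on)
qed

lemma chain_sorted_list: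
  assumes A: "A \<subseteq> P" "lt_chain lt A"
  shows "\<exists>xs. set xs = A \<and> sorted_wrt lt xs"
proof -
  have fin: "finite A" using A(1) finite_P by (rule finite_subset)
  have inj: "inj_on \<rho> A" by (rule inj_on_rank[OF A])
  define xs where "xs = map (inv_into A \<rho>) (sorted_list_of_set (\<rho> ` A))"
  have "set xs = A"
    using fin inj by (simp add: xs_def inv_into_image_cancel)
  moreover have "sorted_wrt lt xs"
    unfolding xs_def sorted_wrt_map
  proof (rule sorted_wrt_mono_rel[OF _ strict_sorted_list_of_set])
    fix i j assume ij: "i \<in> set (sorted_list_of_set (\<rho> ` A))" "j \<in> set (sorted_list_of_set (\<rho> ` A))" "i < j"
    then obtain x y where xy: "x \<in> A" "y \<in> A" "i = \<rho> x" "j = \<rho> y" using fin by auto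
    have "x \<noteq> y" using ij(3) xy by auto
    then have "lt x y \<or> lt y x" using A(2) xy unfolding lt_chain_def by blast
    then have "lt x y" using rank_mono[of y x] A(1) xy ij(3) by auto
    then show "lt (inv_into A \<rho> i) (inv_into A \<rho> j)" using xy inj by simp
  qed
  ultimately show ?thesis by blast
qed

text \<open>No chain has \<open>k + 1\<close> elements, so the boundaries are trivial and the
  homology in degree \<open>k - 1\<close> is the group of cycles itself. A combination of lists and
  a function on facets carry the same data through \<open>set\<close>, and the cycle condition
  becomes the vanishing of star sums. For \<open>k = 0\<close> the only facet is the empty chain and
  the group is infinite cyclic, which covers the conventions for small dimensions.\<close>

lemma free_rank_reduced_order_homology:
  "free_rank (reduced_order_homology (int k - 1) P lt) (linkrank P lt k {})"
proof -
  define Sx where "Sx = order_simplices P lt (int k - 1)"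
  let ?C = "free_Abelian_group Sx"
  let ?Ch = "star P lt k {}"
  let ?K = "relker ?Ch (star_rels P lt k {})"
  interpret C: comm_group ?C by (rule abelian_free_Abelian_group)
  have Sx: "xs \<in> Sx \<longleftrightarrow> set xs \<subseteq> P \<and> sorted_wrt lt xs \<and> length xs = k" for xs
    by (auto simp: Sx_def order_simplices_def)
  have set_star: "set xs \<in> ?Ch" if "xs \<in> Sx" for xs
    using that distinct_card[OF sorted_distinct, of xs] sorted_chain[of xs]
    by (intro starI) (auto simp: Sx)
  have bij: "bij_betw set Sx ?Ch"
    unfolding bij_betw_def
  proof
    show "inj_on set Sx"
      by (rule inj_onI) (rule sorted_set_unique, auto simp: Sx)
    show "set ` Sx = ?Ch"
    proof (intro equalityI subsetI)
      fix A assume A: "A \<in> ?Ch"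
      note s = starD[OF A]
      obtain xs where xs: "set xs = A" "sorted_wrt lt xs" using chain_sorted_list[OF s(1,4)] by blast
      have "xs \<in> Sx"
        using xs s(1,3) distinct_card[OF sorted_distinct, of xs] by (simp add: Sx)
      then show "A \<in> set ` Sx" using xs by blast
    qed (use set_star in auto)
  qed
  have finSx: "finite Sx"
    using bij finite_star[OF finite_P] bij_betw_finite by blast
  \<comment> \<open>All facets have the same list of ranks, so a position in the list is a rank.
    Deleting positions \<open>i\<close> and \<open>j\<close> from two facets can give equal lists
    only if \<open>i = j\<close>; this is \<open>del_inj\<close>, and it gives each ridge a single
    sign.\<close>
  have ranks: "map \<rho> xs = [Suc a..<Suc n]" if xs: "xs \<in> Sx" for xs
  proof -
    have "set (map \<rho> xs) = set [Suc a..<Suc n]"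
      using rank_image[OF set_star[OF xs]] by auto
    then show ?thesis
      using xs by (intro strict_sorted_equal sorted_rank sorted_wrt_upt) (simp_all add: Sx del: upt_Suc)
  qed
  define del where "del i xs = take i xs @ drop (Suc i) xs" for i :: nat and xs :: "'a list"
  have del_sorted: "sorted_wrt lt (del i xs)" "set (del i xs) \<subseteq> P" "length (del i xs) = k - 1"
    "set (del i xs) \<subseteq> set xs"
    if "xs \<in> Sx" "i < k" for xs i
  proof -
    have "xs = take i xs @ xs ! i # drop (Suc i) xs"
      using that by (intro id_take_nth_drop) (simp add: Sx)
    then have "sorted_wrt lt (take i xs @ xs ! i # drop (Suc i) xs)" "set (take i xs @ xs ! i # drop (Suc i) xs) \<subseteq> P"
      using that by (simp_all add: Sx)
    then show "sorted_wrt lt (del i xs)" "set (del i xs) \<subseteq> P"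
      by (auto simp: del_def sorted_wrt_append)
    show "length (del i xs) = k - 1" using that by (simp add: del_def Sx)
    show "set (del i xs) \<subseteq> set xs"
      using set_take_subset[of i xs] set_drop_subset[of "Suc i" xs] by (auto simp: del_def)
  qed
  have map_del: "map \<rho> (del i xs) = take i [Suc a..<Suc n] @ drop (Suc i) [Suc a..<Suc n]"
    if "xs \<in> Sx" for i xs
    unfolding del_def by (simp only: map_append take_map[symmetric] drop_map[symmetric] ranks[OF that])
  have del_inj: "i = j" if "xs \<in> Sx" "ys \<in> Sx" "i < k" "j < k" "del i xs = del j ys" for i j xs ys
  proof (rule distinct_remove_nth_inj[of "[Suc a..<Suc n]"])
    show "take i [Suc a..<Suc n] @ drop (Suc i) [Suc a..<Suc n] = take j [Suc a..<Suc n] @ drop (Suc j) [Suc a..<Suc n]"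
      using map_del[OF that(1), of i] map_del[OF that(2), of j] that(5) by simp
  qed (use that in auto)
  have del_iff: "del i xs = del i ys \<longleftrightarrow> set (del i ys) \<subseteq> set xs"
    if xs: "xs \<in> Sx" and ys: "ys \<in> Sx" and i: "i < k" for i xs ys
  proof
    assume "set (del i ys) \<subseteq> set xs"
    have "set (del i ys) \<subseteq> set (del i xs)"
    proof
      fix x assume x: "x \<in> set (del i ys)"
      then have "x \<in> set xs" using \<open>set (del i ys) \<subseteq> set xs\<close> by blast
      have "\<rho> x \<in> set (map \<rho> (del i xs))"
        using x unfolding map_del[OF xs] map_del[OF ys, symmetric] by simp
      then obtain y where y: "y \<in> set (del i xs)" "\<rho> x = \<rho> y" by auto
      moreover have "y \<in> set xs" using y(1) del_sorted(4)[OF xs i] by blast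
      moreover have "inj_on \<rho> (set xs)"
        using xs by (intro inj_on_rank sorted_chain) (auto simp: Sx)
      ultimately show "x \<in> set (del i xs)"
        using \<open>x \<in> set xs\<close> by (auto dest: inj_onD)
    qed
    moreover have "card (set (del i ys)) = card (set (del i xs))"
      using del_sorted[OF xs i] del_sorted[OF ys i] by (simp add: distinct_card sorted_distinct)
    ultimately have "set (del i ys) = set (del i xs)" by (intro card_subset_eq) auto
    then show "del i xs = del i ys"
      using del_sorted[OF xs i] del_sorted[OF ys i] by (intro sorted_set_unique) auto
  next
    assume "del i xs = del i ys"
    then show "set (del i ys) \<subseteq> set xs" using del_sorted(4)[OF xs i] by simp
  qed
  define f where "f v = (\<Sum>xs\<in>Sx. frag_cmul (v (set xs)) (frag_of xs))" for v :: "'a set \<Rightarrow> int"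
  have f_lookup: "Poly_Mapping.lookup (f v) xs = (if xs \<in> Sx then v (set xs) else 0)" for v xs
  proof -
    have "Poly_Mapping.lookup (f v) xs = (\<Sum>ys\<in>Sx. if ys = xs then v (set ys) else 0)"
      unfolding f_def lookup_sum by (intro sum.cong) (auto simp: lookup_single when_def)
    then show ?thesis using finSx by simp
  qed
  have f_carrier: "f v \<in> carrier ?C" for v
    unfolding f_def by (rule sum_cmul_in_free_Abelian_group)
  have bd: "Poly_Mapping.lookup (order_boundary (f v)) ys =
      (\<Sum>xs\<in>Sx. v (set xs) * (\<Sum>i<k. (-1) ^ i * (if del i xs = ys then 1 else 0)))" for v ys
  proof -
    have eq: "order_boundary (f v) = (\<Sum>xs\<in>Sx. frag_cmul (v (set xs)) (\<Sum>i<length xs. frag_cmul ((-1) ^ i) (frag_of (del i xs))))"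
      unfolding order_boundary_def f_def frag_extend_sum_cmul[OF finSx] del_def ..
    show ?thesis
      unfolding eq lookup_sum by (intro sum.cong) (auto simp: lookup_sum lookup_single when_def Sx intro!: sum.cong)
  qed
  have star_sum: "(\<Sum>A\<in>star P lt k T. v A) = (\<Sum>xs\<in>Sx. if T \<subseteq> set xs then v (set xs) else 0)" for v :: "'a set \<Rightarrow> int" and T
  proof -
    have "(\<Sum>A\<in>star P lt k T. v A) = (\<Sum>A\<in>?Ch. if T \<subseteq> A then v A else 0)"
      using finite_star[OF finite_P, of lt k "{}"]
      by (subst sum.If_cases) (auto simp: star_def intro!: sum.cong)
    also have "\<dots> = (\<Sum>xs\<in>Sx. if T \<subseteq> set xs then v (set xs) else 0)"
      by (rule sum.reindex_bij_betw[OF bij, symmetric])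
    finally show ?thesis .
  qed
  have bd_del: "Poly_Mapping.lookup (order_boundary (f v)) (del j ys) =
      (-1) ^ j * (\<Sum>A\<in>star P lt k (set (del j ys)). v A)"
    if ys: "ys \<in> Sx" and j: "j < k" for v j ys
  proof -
    have "(\<Sum>i<k. (-1) ^ i * (if del i xs = del j ys then 1 else 0)) =
        ((-1) ^ j * (if set (del j ys) \<subseteq> set xs then 1 else 0) :: int)" if xs: "xs \<in> Sx" for xs
    proof -
      have "(\<Sum>i<k. (-1) ^ i * (if del i xs = del j ys then 1 else 0)) =
          (\<Sum>i<k. if i = j then (-1) ^ i * (if del i xs = del j ys then 1 else 0) else (0::int))"
        using del_inj[OF xs ys _ j] by (intro sum.cong) auto
      also have "\<dots> = (-1) ^ j * (if del j xs = del j ys then 1 else 0)"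
        using j by simp
      finally show ?thesis unfolding del_iff[OF xs ys j] .
    qed
    then have "Poly_Mapping.lookup (order_boundary (f v)) (del j ys) =
        (\<Sum>xs\<in>Sx. v (set xs) * ((-1) ^ j * (if set (del j ys) \<subseteq> set xs then 1 else 0)))"
      unfolding bd by (intro sum.cong) auto
    also have "\<dots> = (-1) ^ j * (\<Sum>xs\<in>Sx. if set (del j ys) \<subseteq> set xs then v (set xs) else 0)"
      unfolding sum_distrib_left by (intro sum.cong) auto
    finally show ?thesis unfolding star_sum .
  qed
  have cycle: "order_boundary (f v) = 0 \<longleftrightarrow> (\<forall>F\<in>star_rels P lt k {}. (\<Sum>A\<in>F. v A) = 0)" for v
  proof
    assume 0: "order_boundary (f v) = 0"
    show "\<forall>F\<in>star_rels P lt k {}. (\<Sum>A\<in>F. v A) = 0"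
    proof
      fix F assume "F \<in> star_rels P lt k {}"
      then obtain T where T: "F = star P lt k T" "finite T" "Suc (card T) = k" by (rule star_relsE)
      show "(\<Sum>A\<in>F. v A) = 0"
      proof (cases "F = {}")
        case False
        then obtain A where A: "A \<in> star P lt k T" using T by auto
        then have "A \<in> ?Ch" by (auto simp: star_def)
        then have "A \<in> set ` Sx" using bij by (simp add: bij_betw_def)
        then obtain ys where ys: "ys \<in> Sx" "set ys = A" by blast
        \<comment> \<open>A facet in the star has one element more than \<open>T\<close>; deleting
          it identifies \<open>T\<close> with a face \<open>del j ys\<close>, whose boundary
          coefficient is the star sum up to sign.\<close>
        have "T \<noteq> A" using starD(3)[OF A] T(3) by force
        then obtain x where x: "x \<in> A" "x \<notin> T" using starD(5)[OF A] by blast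
        then obtain j where j: "j < k" "ys ! j = x" using ys by (auto simp: in_set_conv_nth Sx)
        have ysj: "ys = take j ys @ ys ! j # drop (Suc j) ys"
          using j ys by (intro id_take_nth_drop) (simp add: Sx)
        have "T \<subseteq> set (take j ys @ ys ! j # drop (Suc j) ys)"
          using ysj ys(2) starD(5)[OF A] by simp
        then have "T \<subseteq> set (del j ys)"
          using x(2) j(2) by (auto simp: del_def)
        moreover have "card (set (del j ys)) = card T"
          using del_sorted[OF ys(1) j(1)] T(3) by (simp add: distinct_card sorted_distinct)
        ultimately have "T = set (del j ys)" by (intro card_subset_eq) auto
        then show ?thesis
          using bd_del[OF ys(1) j(1), of v] 0 T(1) by simp
      qed simp
    qed
  next
    assume v: "\<forall>F\<in>star_rels P lt k {}. (\<Sum>A\<in>F. v A) = 0"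
    have "Poly_Mapping.lookup (order_boundary (f v)) zs = 0" for zs
    proof (cases "\<exists>ys\<in>Sx. \<exists>j<k. zs = del j ys")
      case True
      then obtain ys j where ys: "ys \<in> Sx" "j < k" "zs = del j ys" by blast
      have "star P lt k (set zs) \<in> star_rels P lt k {}"
        using del_sorted[OF ys(1,2)] ys by (intro star_relsI) (auto simp: distinct_card sorted_distinct)
      then show ?thesis using bd_del[OF ys(1,2), of v] v ys(3) by simp
    next
      case False
      then have "del i xs \<noteq> zs" if "xs \<in> Sx" "i < k" for i xs using that by blast
      then show ?thesis unfolding bd by (intro sum.neutral ballI) simp
    qed
    then show "order_boundary (f v) = 0" by (intro poly_mapping_eqI) simp
  qed
  define Z where "Z = {c \<in> carrier ?C. order_boundary c = 0}"
  have Z: "subgroup Z ?C"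
  proof (rule C.subgroupI)
    show "Z \<subseteq> carrier ?C" by (auto simp: Z_def)
    have "0 \<in> Z" by (simp add: Z_def order_boundary_def)
    then show "Z \<noteq> {}" by blast
    show "inv\<^bsub>?C\<^esub> c \<in> Z" if "c \<in> Z" for c
      using that by (simp add: Z_def order_boundary_def frag_extend_minus)
    show "c \<otimes>\<^bsub>?C\<^esub> d \<in> Z" if "c \<in> Z" "d \<in> Z" for c d
      using that C.m_closed[of c d] by (simp add: Z_def order_boundary_def frag_extend_add)
  qed
  let ?G = "subgroup_generated ?C Z"
  have carG: "carrier ?G = Z"
    using Z by (rule subgroup.carrier_subgroup_generated_subgroup)
  have "fun_group ?K \<cong> ?G"
  proof (rule fun_group_isoI[where \<phi> = f and \<psi> = "\<lambda>c A. if A \<in> ?Ch then Poly_Mapping.lookup c (inv_into Sx set A) else 0"])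
    have fK: "f v \<in> Z" if "v \<in> ?K" for v
      using that f_carrier cycle[of v] by (simp add: Z_def relker_def)
    then show "f v \<in> carrier ?G" if "v \<in> ?K" for v
      using that carG by simp
    show "f (\<lambda>x. u x + v x) = f u \<otimes>\<^bsub>?G\<^esub> f v" for u v
      by (simp add: f_def frag_cmul_distrib sum.distrib)
    let ?g = "\<lambda>c A. if A \<in> ?Ch then Poly_Mapping.lookup c (inv_into Sx set A) else 0"
    have inv: "inv_into Sx set A \<in> Sx" "set (inv_into Sx set A) = A" if "A \<in> ?Ch" for A
      using that bij by (auto simp: bij_betw_def f_inv_into_f intro!: inv_into_into)
    show gf: "?g (f v) = v" if "v \<in> ?K" for v
    proof
      fix A show "?g (f v) A = v A"
        using that inv[of A] by (auto simp: f_lookup relker_def)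
    qed
    show fg: "f (?g c) = c" if "c \<in> carrier ?G" for c
    proof (rule poly_mapping_eqI)
      fix xs
      have c: "Poly_Mapping.keys c \<subseteq> Sx" using that carG by (auto simp: Z_def)
      show "Poly_Mapping.lookup (f (?g c)) xs = Poly_Mapping.lookup c xs"
      proof (cases "xs \<in> Sx")
        case True
        then have "inv_into Sx set (set xs) = xs"
          using bij by (intro inv_into_f_f) (auto simp: bij_betw_def)
        then show ?thesis using True set_star by (simp add: f_lookup)
      next
        case False
        then have "xs \<notin> Poly_Mapping.keys c" using c by blast
        then show ?thesis using False by (simp add: f_lookup in_keys_iff)
      qed
    qed
    show "?g c \<in> ?K" if c: "c \<in> carrier ?G" for c
    proof -
      have "order_boundary (f (?g c)) = 0" using fg[OF c] c carG by (simp add: Z_def)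
      then show ?thesis unfolding cycle by (simp add: relker_def)
    qed
  qed
  then have "?G \<cong> fun_group ?K"
    using group_relker by (rule group.iso_sym[rotated])
  moreover have G: "group ?G" by (rule C.group_subgroup_generated)
  ultimately have rG: "free_rank ?G (linkrank P lt k {})"
    unfolding linkrank_def by (rule free_rank_cong[OF free_rank_relker[OF finite_star[OF finite_P]], rotated])
  have empty: "order_simplices P lt (int k - 1 + 1) = {}"
  proof (rule equals0I)
    fix xs assume "xs \<in> order_simplices P lt (int k - 1 + 1)"
    then have xs: "set xs \<subseteq> P" "sorted_wrt lt xs" "length xs = Suc k"
      by (auto simp: order_simplices_def)
    have "card (\<rho> ` set xs) = Suc k"
      using card_image[OF inj_on_rank[OF xs(1) sorted_chain[OF xs(2)]]] distinct_card[OF sorted_distinct[OF xs(1,2)]] xs(3)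
      by simp
    moreover have "\<rho> ` set xs \<subseteq> {a<..n}" using rank_bounds xs(1) by blast
    then have "card (\<rho> ` set xs) \<le> card {a<..n}" by (intro card_mono) auto
    ultimately show False by simp
  qed
  have bdry: "order_boundary ` carrier (order_chain_group (int k - 1 + 1) P lt) = {\<one>\<^bsub>?G\<^esub>}"
    unfolding order_chain_group_def empty by (auto simp: order_boundary_def)
  have "reduced_order_homology (int k - 1) P lt = ?G Mod {\<one>\<^bsub>?G\<^esub>}"
    unfolding reduced_order_homology_def bdry unfolding order_chain_group_def Sx_def[symmetric] Z_def[symmetric] ..
  moreover interpret Gc: comm_group ?G by (rule free_rank_comm_group[OF rG])
  have "group (?G Mod {\<one>\<^bsub>?G\<^esub>})"
    by (intro normal.factorgroup_is_group Gc.one_is_normal)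
  ultimately show ?thesis
    using free_rank_cong[OF rG _ Gc.Mod_one_iso] by simp
qed

end

section \<open>Reduced homology of finite discrete spaces\<close>

text \<open>The coefficients of \<open>h\<close> embed \<open>G\<close> into integer-valued
  functions, where the kernel is free of some rank \<open>r\<close> by
  \<open>free_rank_fun_group\<close>. A preimage of a generator of \<open>H\<close> splits \<phi>,
  hence \<open>G\<close> has rank \<open>r + 1\<close>, and uniqueness of the rank gives
  \<open>r = m - 1\<close>.\<close>

lemma free_rank_kernel:
  assumes G: "free_rank G m" and \<phi>: "group_hom G H \<phi>" and surj: "\<phi> ` carrier G = carrier H"
    and H: "free_rank H 1"
  shows "free_rank (subgroup_generated G (kernel G H \<phi>)) (m - 1)"
proof -
  interpret \<phi>: group_hom G H \<phi> by (rule \<phi>)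
  let ?F = "free_Abelian_group {..<m}" and ?F1 = "free_Abelian_group {..<1::nat}"
  let ?K = "kernel G H \<phi>"
  have iso_ex: "\<exists>h. h \<in> hom G ?F \<and> inj_on h (carrier G)" "\<exists>h k. group_isomorphisms H ?F1 h k"
    using G \<phi>.G.iso_iff_group_isomorphisms[of _ ?F] H \<phi>.H.iso_iff_group_isomorphisms[of _ ?F1]
    unfolding free_rank_def is_iso_def iso_def bij_betw_def by blast+
  then obtain h where h: "h \<in> hom G ?F" and h_inj: "inj_on h (carrier G)" by blast
  obtain h1 k1 where hk1: "group_isomorphisms H ?F1 h1 k1" using iso_ex by blast
  then have h1: "h1 \<in> hom H ?F1" and k1: "\<And>c. c \<in> carrier ?F1 \<Longrightarrow> k1 c \<in> carrier H"
    and h1k1: "\<And>c. c \<in> carrier ?F1 \<Longrightarrow> h1 (k1 c) = c" and k1h1: "\<And>y. y \<in> carrier H \<Longrightarrow> k1 (h1 y) = y"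
    by (auto simp: group_isomorphisms_def hom_def simp del: carrier_free_Abelian_group_iff)
  define e where "e x = Poly_Mapping.lookup (h x)" for x
  define Z where "Z = e ` carrier G"
  define i where "i = inv_into (carrier G) e"
  define \<eta> where "\<eta> y = Poly_Mapping.lookup (h1 y) 0" for y
  have e_inj: "inj_on e (carrier G)"
    using h_inj unfolding e_def inj_on_def by (simp add: lookup_inject)
  have ie: "i (e x) = x" if "x \<in> carrier G" for x
    using that e_inj by (simp add: i_def)
  have e_mult: "e (x \<otimes>\<^bsub>G\<^esub> y) = (\<lambda>j. e x j + e y j)" if "x \<in> carrier G" "y \<in> carrier G" for x y
    using hom_mult[OF h that] by (simp add: e_def lookup_add fun_eq_iff)
  have e_one: "e \<one>\<^bsub>G\<^esub> = (\<lambda>j. 0)"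
  proof
    fix j show "e \<one>\<^bsub>G\<^esub> j = 0"
      using fun_cong[OF e_mult[of "\<one>\<^bsub>G\<^esub>" "\<one>\<^bsub>G\<^esub>"], of j] by simp
  qed
  have e_diff: "e (x \<otimes>\<^bsub>G\<^esub> inv\<^bsub>G\<^esub> y) = (\<lambda>j. e x j - e y j)" if "x \<in> carrier G" "y \<in> carrier G" for x y
  proof
    fix j
    have "e y j + e (inv\<^bsub>G\<^esub> y) j = 0"
      using fun_cong[OF e_mult[of y "inv\<^bsub>G\<^esub> y"], of j] that e_one by simp
    then show "e (x \<otimes>\<^bsub>G\<^esub> inv\<^bsub>G\<^esub> y) j = e x j - e y j"
      using fun_cong[OF e_mult[of x "inv\<^bsub>G\<^esub> y"], of j] that by simp
  qed
  have \<eta>_mult: "\<eta> (x \<otimes>\<^bsub>H\<^esub> y) = \<eta> x + \<eta> y" if "x \<in> carrier H" "y \<in> carrier H" for x y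
    using hom_mult[OF h1 that] by (simp add: \<eta>_def lookup_add)
  have \<eta>_one: "\<eta> \<one>\<^bsub>H\<^esub> = 0"
    using \<eta>_mult[of "\<one>\<^bsub>H\<^esub>" "\<one>\<^bsub>H\<^esub>"] by simp
  have \<eta>_zero: "y = \<one>\<^bsub>H\<^esub>" if y: "y \<in> carrier H" and "\<eta> y = 0" for y
  proof -
    have "Poly_Mapping.keys (h1 y) \<subseteq> {..<1}"
      using hom_in_carrier[OF h1 y] by simp
    then have "h1 y = 0"
      using that(2) by (intro poly_mapping_eqI) (metis \<eta>_def in_keys_iff lessThan_iff less_one lookup_zero subsetD)
    moreover have "Poly_Mapping.keys (h1 \<one>\<^bsub>H\<^esub>) \<subseteq> {..<1}"
      using hom_in_carrier[OF h1 \<phi>.H.one_closed] by simp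
    then have "h1 \<one>\<^bsub>H\<^esub> = 0"
      using \<eta>_one by (intro poly_mapping_eqI) (metis \<eta>_def in_keys_iff lessThan_iff less_one lookup_zero subsetD)
    ultimately show ?thesis
      using k1h1[OF y] k1h1[OF \<phi>.H.one_closed] by simp
  qed
  define q where "q v = \<eta> (\<phi> (i v))" for v
  have q_e: "q (e x) = \<eta> (\<phi> x)" if "x \<in> carrier G" for x
    using ie[OF that] by (simp add: q_def)
  have Z0: "(\<lambda>j. 0) \<in> Z"
    unfolding Z_def using e_one[symmetric] by blast
  have Zd: "(\<lambda>j. u j - v j) \<in> Z" if uv: "u \<in> Z" "v \<in> Z" for u v
  proof -
    obtain x y where "x \<in> carrier G" "u = e x" "y \<in> carrier G" "v = e y"
      using uv unfolding Z_def by blast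
    then show ?thesis
      using e_diff[of x y] unfolding Z_def by (metis \<phi>.G.inv_closed \<phi>.G.m_closed imageI)
  qed
  have q_add: "q (\<lambda>j. u j + v j) = q u + q v" if uv: "u \<in> Z" "v \<in> Z" for u v
  proof -
    obtain x y where xy: "x \<in> carrier G" "u = e x" "y \<in> carrier G" "v = e y"
      using uv unfolding Z_def by blast
    have "q (\<lambda>j. u j + v j) = q (e (x \<otimes>\<^bsub>G\<^esub> y))"
      using e_mult[OF xy(1,3)] xy by simp
    also have "\<dots> = q u + q v"
      using xy by (simp add: q_e \<eta>_mult)
    finally show ?thesis .
  qed
  have "frag_of 0 \<in> carrier ?F1" by simp
  then have "k1 (frag_of 0) \<in> \<phi> ` carrier G" using k1 surj by simp
  then obtain x0 where x0: "x0 \<in> carrier G" "\<phi> x0 = k1 (frag_of 0)" by fastforce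
  have v0: "e x0 \<in> Z" "q (e x0) = 1"
    using x0 h1k1[of "frag_of 0"] by (auto simp: Z_def q_e \<eta>_def lookup_single)
  have GZ: "fun_group Z \<cong> G"
  proof (rule fun_group_isoI[where \<phi> = i and \<psi> = e])
    show "i (\<lambda>x. u x + v x) = i u \<otimes>\<^bsub>G\<^esub> i v" if uv: "u \<in> Z" "v \<in> Z" for u v
    proof -
      obtain x y where xy: "x \<in> carrier G" "u = e x" "y \<in> carrier G" "v = e y"
        using uv unfolding Z_def by blast
      then show ?thesis using ie[of "x \<otimes>\<^bsub>G\<^esub> y"] by (simp add: e_mult ie)
    qed
  qed (auto simp: Z_def ie)
  let ?Z' = "{v \<in> Z. q v = 0}"
  have Z': "?Z' = e ` ?K"
  proof (intro equalityI subsetI)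
    fix v assume "v \<in> ?Z'"
    then obtain x where x: "x \<in> carrier G" "v = e x" "\<eta> (\<phi> x) = 0"
      unfolding Z_def by (auto simp: q_e)
    then have "x \<in> ?K" using \<eta>_zero[of "\<phi> x"] by (simp add: kernel_def)
    then show "v \<in> e ` ?K" using x(2) by blast
  qed (auto simp: kernel_def Z_def q_e \<eta>_one)
  have "\<exists>r. free_rank (fun_group ?Z') r"
  proof (rule free_rank_fun_group[of "{..<m}"])
    show "v j = 0" if "v \<in> ?Z'" "j \<notin> {..<m}" for v j
    proof -
      obtain x where x: "x \<in> carrier G" "v = e x" using \<open>v \<in> ?Z'\<close> unfolding Z_def by blast
      have "Poly_Mapping.keys (h x) \<subseteq> {..<m}" using hom_in_carrier[OF h x(1)] by simp
      then show ?thesis using \<open>j \<notin> {..<m}\<close> unfolding x(2) e_def by (metis in_keys_iff subsetD)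
    qed
    have q0: "q (\<lambda>j. 0) = 0" using q_e[of "\<one>\<^bsub>G\<^esub>"] e_one \<eta>_one by simp
    then show "(\<lambda>j. 0) \<in> ?Z'" using Z0 by simp
    show "(\<lambda>j. u j - v j) \<in> ?Z'" if uv: "u \<in> ?Z'" "v \<in> ?Z'" for u v
    proof -
      have "q (\<lambda>j. (u j - v j) + v j) = q (\<lambda>j. u j - v j) + q v"
        using uv by (intro q_add Zd) auto
      then show ?thesis using uv Zd[of u v] by simp
    qed
  qed simp
  then obtain r where r: "free_rank (fun_group ?Z') r" by blast
  have "free_rank (fun_group Z) (Suc r)"
    by (rule free_rank_fun_group_extend[of Z q "e x0", OF Z0 Zd q_add v0 r])
  moreover have "free_rank (fun_group Z) m"
    by (rule free_rank_cong[OF G group_fun_group[OF Z0 Zd] GZ])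
  ultimately have "m = Suc r" by (rule free_rank_unique[rotated])
  have "fun_group ?Z' \<cong> subgroup_generated G ?K"
  proof (rule fun_group_isoI[where \<phi> = i and \<psi> = e])
    have car: "carrier (subgroup_generated G ?K) = ?K"
      by (rule subgroup.carrier_subgroup_generated_subgroup[OF \<phi>.subgroup_kernel])
    show "i v \<in> carrier (subgroup_generated G ?K)" if "v \<in> ?Z'" for v
      using that unfolding car Z' by (auto simp: ie kernel_def)
    show "e x \<in> ?Z'" if "x \<in> carrier (subgroup_generated G ?K)" for x
      using that unfolding car Z' by blast
    show "e (i v) = v" if "v \<in> ?Z'" for v
      using that by (auto simp: Z_def ie)
    show "i (e x) = x" if "x \<in> carrier (subgroup_generated G ?K)" for x
      using that unfolding car by (simp add: ie kernel_def)
    show "i (\<lambda>x. u x + v x) = i u \<otimes>\<^bsub>subgroup_generated G ?K\<^esub> i v" if uv: "u \<in> ?Z'" "v \<in> ?Z'" for u v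
    proof -
      obtain x y where xy: "x \<in> carrier G" "u = e x" "y \<in> carrier G" "v = e y"
        using uv unfolding Z_def by blast
      then show ?thesis using ie[of "x \<otimes>\<^bsub>G\<^esub> y"] by (simp add: e_mult ie)
    qed
  qed
  then have "subgroup_generated G ?K \<cong> fun_group ?Z'"
    using free_rank_group[OF r] by (rule group.iso_sym[rotated])
  then have "free_rank (subgroup_generated G ?K) r"
    by (intro free_rank_cong[OF r] \<phi>.G.group_subgroup_generated)
  then show ?thesis using \<open>m = Suc r\<close> by simp
qed

lemma path_components_of_discrete_topology:
  "path_components_of (discrete_topology S) = (\<lambda>x. {x}) ` S"
proof -
  have *: "path_component_of_set (discrete_topology S) x = {x}" if x: "x \<in> S" for x
  proof
    have "connectedin (discrete_topology S) (path_component_of_set (discrete_topology S) x)"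
      by (intro path_connectedin_imp_connectedin path_connectedin_path_component_of)
    moreover have "x \<in> path_component_of_set (discrete_topology S) x"
      using x by (simp add: path_component_of_refl)
    ultimately show "path_component_of_set (discrete_topology S) x \<subseteq> {x}"
      unfolding connectedin_discrete_topology by blast
    show "{x} \<subseteq> path_component_of_set (discrete_topology S) x"
      using x by (simp add: path_component_of_refl)
  qed
  have "path_components_of (discrete_topology S) = path_component_of_set (discrete_topology S) ` S"
    by (simp add: path_components_of_def)
  also have "\<dots> = (\<lambda>x. {x}) ` S"
    by (intro image_cong refl *)
  finally show ?thesis .
qed

lemma free_rank_homology_discrete:
  assumes "finite S"
  shows "free_rank (homology_group 0 (discrete_topology S)) (card S)"
proof (rule free_rankI[OF _ zeroth_homology_group])
  show "card (path_components_of (discrete_topology S)) = card S"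
    unfolding path_components_of_discrete_topology by (intro card_image) (auto simp: inj_on_def)
qed (use assms in \<open>auto simp: path_components_of_discrete_topology\<close>)

text \<open>Reduced homology is by definition the kernel of the map to the homology of a point. The
  inclusion of a point \<open>a\<close> is a section of that map, which is therefore onto an
  infinite cyclic group.\<close>

lemma free_rank_reduced_homology_discrete:
  assumes "finite S" "S \<noteq> {}"
  shows "free_rank (reduced_homology_group 0 (discrete_topology S)) (card S - 1)"
proof -
  let ?X = "discrete_topology S" and ?U = "discrete_topology {()}"
  let ?h = "hom_induced 0 ?X {} ?U {} (\<lambda>x. ())"
  obtain a where a: "a \<in> S" using assms(2) by blast
  have c1: "continuous_map ?X ?U (\<lambda>x. ())" and c2: "continuous_map ?U ?X (\<lambda>x. a)"
    using a by auto
  have gh: "group_hom (homology_group 0 ?X) (homology_group 0 ?U) ?h"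
    by (simp add: hom_induced_empty_hom group_hom_axioms_def group_hom_def)
  have "?h ` carrier (homology_group 0 ?X) = carrier (homology_group 0 ?U)"
  proof (intro equalityI subsetI)
    fix y assume y: "y \<in> carrier (homology_group 0 ?U)"
    let ?k = "hom_induced 0 ?U {} ?X {} (\<lambda>x. a)"
    have "?h (?k y) = hom_induced 0 ?U {} ?U {} ((\<lambda>x. ()) \<circ> (\<lambda>x. a)) y"
      using hom_induced_compose_empty[OF c2 c1, of 0] by (metis comp_apply)
    also have "(\<lambda>x. ()) \<circ> (\<lambda>x. a) = id" by auto
    also have "hom_induced 0 ?U {} ?U {} id y = y" using y by (simp add: hom_induced_id)
    finally have "?h (?k y) = y" .
    moreover have "?k y \<in> carrier (homology_group 0 ?X)"
      using hom_in_carrier[OF hom_induced_empty_hom y] .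
    ultimately show "y \<in> ?h ` carrier (homology_group 0 ?X)" by (metis imageI)
  next
    fix y assume "y \<in> ?h ` carrier (homology_group 0 ?X)"
    then show "y \<in> carrier (homology_group 0 ?U)"
      using group_hom.hom_closed[OF gh] by blast
  qed
  moreover have "free_rank (homology_group 0 ?U) 1"
    using free_rank_homology_discrete[of "{()}"] by simp
  ultimately show ?thesis
    unfolding reduced_homology_group_def
    by (intro free_rank_kernel[OF free_rank_homology_discrete[OF assms(1)] gh])
qed

section \<open>Subspaces, quotients and symplectic forms over finite fields\<close>

lemma subspace_iff:
  assumes "vectorspace K V"
  shows "VectorSpace.subspace K U V \<longleftrightarrow> U \<subseteq> carrier V \<and> \<zero>\<^bsub>V\<^esub> \<in> U \<and>
    (\<forall>x\<in>U. \<forall>y\<in>U. x \<oplus>\<^bsub>V\<^esub> y \<in> U) \<and> (\<forall>c\<in>carrier K. \<forall>x\<in>U. c \<odot>\<^bsub>V\<^esub> x \<in> U)"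
proof -
  interpret vectorspace K V by fact
  have "module K V" by unfold_locales
  then show ?thesis
    using assms unfolding VectorSpace.subspace_def submodule_def by blast
qed

lemma subspaceD:
  assumes "VectorSpace.subspace K U V"
  shows "vectorspace K V" "U \<subseteq> carrier V" "\<zero>\<^bsub>V\<^esub> \<in> U"
    "\<And>x y. x \<in> U \<Longrightarrow> y \<in> U \<Longrightarrow> x \<oplus>\<^bsub>V\<^esub> y \<in> U"
    "\<And>c x. c \<in> carrier K \<Longrightarrow> x \<in> U \<Longrightarrow> c \<odot>\<^bsub>V\<^esub> x \<in> U"
proof -
  show "vectorspace K V" using assms by (rule subspace.vs)
  then show "U \<subseteq> carrier V" "\<zero>\<^bsub>V\<^esub> \<in> U"
    "\<And>x y. x \<in> U \<Longrightarrow> y \<in> U \<Longrightarrow> x \<oplus>\<^bsub>V\<^esub> y \<in> U"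
    "\<And>c x. c \<in> carrier K \<Longrightarrow> x \<in> U \<Longrightarrow> c \<odot>\<^bsub>V\<^esub> x \<in> U"
    using assms by (simp_all add: subspace_iff)
qed

lemma (in vectorspace) subspace_uminus:
  assumes "VectorSpace.subspace K U V" "x \<in> U"
  shows "\<ominus>\<^bsub>V\<^esub> x \<in> U"
proof -
  have "x \<in> carrier V" using assms subspaceD(2) by blast
  then have "\<ominus>\<^bsub>V\<^esub> x = (\<ominus>\<^bsub>K\<^esub> \<one>\<^bsub>K\<^esub>) \<odot>\<^bsub>V\<^esub> x" by (simp add: smult_minus_1)
  then show ?thesis using subspaceD(5)[OF assms(1) _ assms(2)] by simp
qed

lemma (in vectorspace) subspace_minus:
  assumes "VectorSpace.subspace K U V" "x \<in> U" "y \<in> U"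
  shows "x \<ominus>\<^bsub>V\<^esub> y \<in> U"
  unfolding a_minus_def using assms by (intro subspaceD(4) subspace_uminus)

lemma (in vectorspace) subspace_of_subspace:
  assumes U: "VectorSpace.subspace K U V"
  shows "VectorSpace.subspace K W (V\<lparr>carrier := U\<rparr>) \<longleftrightarrow> VectorSpace.subspace K W V \<and> W \<subseteq> U"
proof -
  have V: "vectorspace K V" by unfold_locales
  note VU = subspace_is_vs[OF U]
  show ?thesis
    unfolding subspace_iff[OF VU] subspace_iff[OF V] using subspaceD(2)[OF U] by auto
qed

lemma (in vectorspace) carrier_subspace: "VectorSpace.subspace K (carrier V) V"
proof -
  have V: "vectorspace K V" by unfold_locales
  show ?thesis unfolding subspace_iff[OF V] by simp
qed

lemma (in vectorspace) zero_subspace: "VectorSpace.subspace K {\<zero>\<^bsub>V\<^esub>} V"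
proof -
  have V: "vectorspace K V" by unfold_locales
  show ?thesis unfolding subspace_iff[OF V] by (simp add: smult_r_null)
qed

lemma (in vectorspace) basis_exists_finite:
  assumes "finite (carrier V)"
  shows "\<exists>B. finite B \<and> basis B \<and> card B = dim"
proof -
  have "gen_set (carrier V)"
    using in_own_span[OF order_refl] span_is_subset2[OF order_refl] by auto
  then have "fin_dim" unfolding fin_dim_def using assms by blast
  then obtain B where "finite B" "basis B" using finite_basis_exists by blast
  then show ?thesis using dim_basis by auto
qed

text \<open>Over a finite field cardinality determines dimension, so the dimension formulas below
  are obtained by counting elements and comparing exponents.\<close>

lemma (in vectorspace) card_eq_power_dim:
  assumes "finite (carrier V)"
  shows "card (carrier V) = card (carrier K) ^ dim"
proof -
  obtain B where B: "finite B" "basis B" "card B = dim"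
    using basis_exists_finite[OF assms] by blast
  then have BV: "B \<subseteq> carrier V" by (simp add: basis_def)
  have uniq: "\<exists>!a. a \<in> B \<rightarrow>\<^sub>E carrier K \<and> lincomb a B = v" if "v \<in> carrier V" for v
    using basis_criterion[OF B(1) BV] B(2) that by blast
  have "bij_betw (\<lambda>a. lincomb a B) (B \<rightarrow>\<^sub>E carrier K) (carrier V)"
    unfolding bij_betw_def
  proof
    have lc: "lincomb a B \<in> carrier V" if "a \<in> B \<rightarrow>\<^sub>E carrier K" for a
      using that BV by (intro lincomb_closed) auto
    show "inj_on (\<lambda>a. lincomb a B) (B \<rightarrow>\<^sub>E carrier K)"
      using uniq lc by (intro inj_onI) metis
    show "(\<lambda>a. lincomb a B) ` (B \<rightarrow>\<^sub>E carrier K) = carrier V"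
      using uniq lc by blast
  qed
  then have "card (B \<rightarrow>\<^sub>E carrier K) = card (carrier V)" by (rule bij_betw_same_card)
  then show ?thesis using B by (simp add: card_funcsetE)
qed

section \<open>Quotient spaces and the correspondence of subspaces\<close>

locale quotient_space = vectorspace K V for K V +
  fixes N
  assumes N: "VectorSpace.subspace K N V"
begin

abbreviation "Q \<equiv> quotient_module V N"
abbreviation proj where "proj x \<equiv> N +>\<^bsub>V\<^esub> x"

lemma abelian_subgroup_N: "abelian_subgroup N V"
proof (rule abelian_subgroupI3)
  show "abelian_group V" by unfold_locales
  show "additive_subgroup N V"
  proof (rule additive_subgroupI, rule M.add.subgroupI)
    show "N \<subseteq> carrier V" by (rule subspaceD(2)[OF N])
    show "N \<noteq> {}" using subspaceD(3)[OF N] by auto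
    show "\<ominus>\<^bsub>V\<^esub> a \<in> N" if "a \<in> N" for a
      using subspace_uminus[OF N that] .
    show "a \<oplus>\<^bsub>V\<^esub> b \<in> N" if "a \<in> N" "b \<in> N" for a b
      using subspaceD(4)[OF N that] .
  qed
qed

sublocale N: abelian_subgroup N V by (rule abelian_subgroup_N)

lemma mem_proj_iff: "x \<in> carrier V \<Longrightarrow> y \<in> carrier V \<Longrightarrow> y \<in> proj x \<longleftrightarrow> y \<ominus>\<^bsub>V\<^esub> x \<in> N"
  using N.a_rcos_module[of x y] by (simp add: a_minus_def)

lemma proj_subset: "x \<in> carrier V \<Longrightarrow> proj x \<subseteq> carrier V"
  by (intro M.a_r_coset_subset_G subspaceD(2)[OF N])

lemma proj_eq_iff: "x \<in> carrier V \<Longrightarrow> y \<in> carrier V \<Longrightarrow> proj x = proj y \<longleftrightarrow> x \<ominus>\<^bsub>V\<^esub> y \<in> N"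
  using mem_proj_iff[of y x] N.a_rcos_self[of x] M.a_repr_independence[OF _ _ N.a_subgroup, of x y] by auto

lemma proj_zero: "proj \<zero>\<^bsub>V\<^esub> = N"
  by (intro M.a_coset_add_zero subspaceD(2)[OF N])

lemma proj_eq_N: "x \<in> carrier V \<Longrightarrow> proj x = N \<longleftrightarrow> x \<in> N"
  using M.a_coset_join1[OF _ _ N.a_subgroup] M.a_coset_join2[OF _ N.a_subgroup] by blast

lemma carrier_Q: "carrier Q = proj ` carrier V"
  by (auto simp: quotient_module_def A_RCOSETS_def')

lemma zero_Q: "\<zero>\<^bsub>Q\<^esub> = N"
  by (simp add: quotient_module_def)

lemma zero_Q': "\<zero>\<^bsub>Q\<^esub> = proj \<zero>\<^bsub>V\<^esub>"
  by (simp only: zero_Q proj_zero)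

lemma add_Q: "x \<in> carrier V \<Longrightarrow> y \<in> carrier V \<Longrightarrow> proj x \<oplus>\<^bsub>Q\<^esub> proj y = proj (x \<oplus>\<^bsub>V\<^esub> y)"
  by (simp add: quotient_module_def N.a_rcos_sum)

text \<open>Scalar multiplication of a coset is defined as a union over its representatives; it
  collapses to one coset because two representatives differ by an element of \<open>N\<close>, and
  so do their multiples.\<close>

lemma smult_Q:
  assumes c: "c \<in> carrier K" and x: "x \<in> carrier V"
  shows "c \<odot>\<^bsub>Q\<^esub> proj x = proj (c \<odot>\<^bsub>V\<^esub> x)"
proof -
  have "proj (c \<odot>\<^bsub>V\<^esub> y) = proj (c \<odot>\<^bsub>V\<^esub> x)" if y: "y \<in> proj x" for y
  proof -
    have yV: "y \<in> carrier V" using y proj_subset[OF x] by blast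
    have "c \<odot>\<^bsub>V\<^esub> (y \<ominus>\<^bsub>V\<^esub> x) \<in> N"
      using y mem_proj_iff[OF x yV] subspaceD(5)[OF N c] by blast
    then show ?thesis
      using proj_eq_iff[of "c \<odot>\<^bsub>V\<^esub> y" "c \<odot>\<^bsub>V\<^esub> x"] c x yV
      by (simp add: a_minus_def smult_r_distr smult_r_minus)
  qed
  then have "(\<Union>y\<in>proj x. proj (c \<odot>\<^bsub>V\<^esub> y)) = (\<Union>y\<in>proj x. proj (c \<odot>\<^bsub>V\<^esub> x))"
    by (rule SUP_cong[OF refl])
  also have "\<dots> = proj (c \<odot>\<^bsub>V\<^esub> x)"
    using N.a_rcos_self[OF x] by blast
  finally show ?thesis by (simp add: quotient_module_def)
qed

lemma vectorspace_Q: "vectorspace K Q"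
proof (rule vs_criteria)
  show "field K" by unfold_locales
  have E: "\<exists>x. x \<in> carrier V \<and> v = proj x" if "v \<in> carrier Q" for v
    using that unfolding carrier_Q by blast
  have I: "proj x \<in> carrier Q" if "x \<in> carrier V" for x
    unfolding carrier_Q using that by (rule imageI)
  show "\<zero>\<^bsub>Q\<^esub> \<in> carrier Q"
    using I[OF M.zero_closed] unfolding zero_Q proj_zero .
  show "\<forall>v w. v \<in> carrier Q \<and> w \<in> carrier Q \<longrightarrow> v \<oplus>\<^bsub>Q\<^esub> w \<in> carrier Q"
  proof (intro allI impI, elim conjE)
    fix v w assume "v \<in> carrier Q" "w \<in> carrier Q"
    with E obtain x y where "x \<in> carrier V" "y \<in> carrier V" "v = proj x" "w = proj y" by metis
    then show "v \<oplus>\<^bsub>Q\<^esub> w \<in> carrier Q" using I[of "x \<oplus>\<^bsub>V\<^esub> y"] by (simp only: add_Q M.a_closed)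
  qed
  show "\<forall>v\<in>carrier Q. \<exists>w\<in>carrier Q. v \<oplus>\<^bsub>Q\<^esub> w = \<zero>\<^bsub>Q\<^esub>"
  proof
    fix v assume "v \<in> carrier Q"
    then obtain x where x: "x \<in> carrier V" "v = proj x" using E by blast
    have "v \<oplus>\<^bsub>Q\<^esub> proj (\<ominus>\<^bsub>V\<^esub> x) = \<zero>\<^bsub>Q\<^esub>"
      using x by (simp only: add_Q zero_Q M.r_neg proj_zero M.a_inv_closed)
    then show "\<exists>w\<in>carrier Q. v \<oplus>\<^bsub>Q\<^esub> w = \<zero>\<^bsub>Q\<^esub>"
      using I[OF M.a_inv_closed[OF x(1)]] by blast
  qed
  show "\<forall>c v. c \<in> carrier K \<and> v \<in> carrier Q \<longrightarrow> c \<odot>\<^bsub>Q\<^esub> v \<in> carrier Q"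
  proof (intro allI impI, elim conjE)
    fix c v assume c: "c \<in> carrier K" "v \<in> carrier Q"
    with E obtain x where "x \<in> carrier V" "v = proj x" by blast
    then show "c \<odot>\<^bsub>Q\<^esub> v \<in> carrier Q" using c(1) I[of "c \<odot>\<^bsub>V\<^esub> x"] by (simp only: smult_Q smult_closed)
  qed
  show "\<forall>v w. v \<in> carrier Q \<and> w \<in> carrier Q \<longrightarrow> v \<oplus>\<^bsub>Q\<^esub> w = w \<oplus>\<^bsub>Q\<^esub> v"
  proof (intro allI impI, elim conjE)
    fix v w assume "v \<in> carrier Q" "w \<in> carrier Q"
    with E obtain x y where "x \<in> carrier V" "y \<in> carrier V" "v = proj x" "w = proj y" by metis
    then show "v \<oplus>\<^bsub>Q\<^esub> w = w \<oplus>\<^bsub>Q\<^esub> v" using M.a_comm[of x y] by (simp only: add_Q)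
  qed
  show "\<forall>v w x. v \<in> carrier Q \<and> w \<in> carrier Q \<and> x \<in> carrier Q \<longrightarrow>
      (v \<oplus>\<^bsub>Q\<^esub> w) \<oplus>\<^bsub>Q\<^esub> x = v \<oplus>\<^bsub>Q\<^esub> (w \<oplus>\<^bsub>Q\<^esub> x)"
  proof (intro allI impI, elim conjE)
    fix u v w assume "u \<in> carrier Q" "v \<in> carrier Q" "w \<in> carrier Q"
    with E obtain x y z where "x \<in> carrier V" "y \<in> carrier V" "z \<in> carrier V"
      "u = proj x" "v = proj y" "w = proj z" by metis
    then show "(u \<oplus>\<^bsub>Q\<^esub> v) \<oplus>\<^bsub>Q\<^esub> w = u \<oplus>\<^bsub>Q\<^esub> (v \<oplus>\<^bsub>Q\<^esub> w)"
      by (simp only: add_Q M.a_closed M.a_assoc)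
  qed
  show "\<forall>v\<in>carrier Q. v \<oplus>\<^bsub>Q\<^esub> \<zero>\<^bsub>Q\<^esub> = v"
  proof
    fix v assume "v \<in> carrier Q"
    with E obtain x where "x \<in> carrier V" "v = proj x" by blast
    then show "v \<oplus>\<^bsub>Q\<^esub> \<zero>\<^bsub>Q\<^esub> = v"
      unfolding zero_Q' by (simp only: add_Q M.zero_closed M.r_zero)
  qed
  show "\<forall>a b v. a \<in> carrier K \<and> b \<in> carrier K \<and> v \<in> carrier Q \<longrightarrow>
      (a \<otimes>\<^bsub>K\<^esub> b) \<odot>\<^bsub>Q\<^esub> v = a \<odot>\<^bsub>Q\<^esub> (b \<odot>\<^bsub>Q\<^esub> v)"
  proof (intro allI impI, elim conjE)
    fix a b v assume ab: "a \<in> carrier K" "b \<in> carrier K" "v \<in> carrier Q"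
    with E obtain x where "x \<in> carrier V" "v = proj x" by blast
    then show "(a \<otimes>\<^bsub>K\<^esub> b) \<odot>\<^bsub>Q\<^esub> v = a \<odot>\<^bsub>Q\<^esub> (b \<odot>\<^bsub>Q\<^esub> v)"
      using ab(1,2) by (simp only: smult_Q smult_closed R.m_closed smult_assoc1)
  qed
  show "\<forall>v\<in>carrier Q. \<one>\<^bsub>K\<^esub> \<odot>\<^bsub>Q\<^esub> v = v"
  proof
    fix v assume "v \<in> carrier Q"
    with E obtain x where "x \<in> carrier V" "v = proj x" by blast
    then show "\<one>\<^bsub>K\<^esub> \<odot>\<^bsub>Q\<^esub> v = v" by (simp only: smult_Q R.one_closed smult_one)
  qed
  show "\<forall>a b v. a \<in> carrier K \<and> b \<in> carrier K \<and> v \<in> carrier Q \<longrightarrow>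
      (a \<oplus>\<^bsub>K\<^esub> b) \<odot>\<^bsub>Q\<^esub> v = a \<odot>\<^bsub>Q\<^esub> v \<oplus>\<^bsub>Q\<^esub> b \<odot>\<^bsub>Q\<^esub> v"
  proof (intro allI impI, elim conjE)
    fix a b v assume ab: "a \<in> carrier K" "b \<in> carrier K" "v \<in> carrier Q"
    with E obtain x where "x \<in> carrier V" "v = proj x" by blast
    then show "(a \<oplus>\<^bsub>K\<^esub> b) \<odot>\<^bsub>Q\<^esub> v = a \<odot>\<^bsub>Q\<^esub> v \<oplus>\<^bsub>Q\<^esub> b \<odot>\<^bsub>Q\<^esub> v"
      using ab(1,2) by (simp only: smult_Q smult_closed R.a_closed add_Q smult_l_distr)
  qed
  show "\<forall>a v w. a \<in> carrier K \<and> v \<in> carrier Q \<and> w \<in> carrier Q \<longrightarrow>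
      a \<odot>\<^bsub>Q\<^esub> (v \<oplus>\<^bsub>Q\<^esub> w) = a \<odot>\<^bsub>Q\<^esub> v \<oplus>\<^bsub>Q\<^esub> a \<odot>\<^bsub>Q\<^esub> w"
  proof (intro allI impI, elim conjE)
    fix a v w assume a: "a \<in> carrier K" "v \<in> carrier Q" "w \<in> carrier Q"
    with E obtain x y where "x \<in> carrier V" "y \<in> carrier V" "v = proj x" "w = proj y" by metis
    then show "a \<odot>\<^bsub>Q\<^esub> (v \<oplus>\<^bsub>Q\<^esub> w) = a \<odot>\<^bsub>Q\<^esub> v \<oplus>\<^bsub>Q\<^esub> a \<odot>\<^bsub>Q\<^esub> w"
      using a(1) by (simp only: smult_Q smult_closed M.a_closed add_Q smult_r_distr)
  qed
qed

text \<open>A subspace containing \<open>N\<close> is a union of cosets, which is what makes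
  inclusions between images equivalent to inclusions between such subspaces.\<close>

lemma proj_mem_image:
  assumes "VectorSpace.subspace K W V" "N \<subseteq> W" "x \<in> carrier V"
  shows "proj x \<in> proj ` W \<longleftrightarrow> x \<in> W"
proof
  assume "proj x \<in> proj ` W"
  then obtain y where y: "y \<in> W" "proj x = proj y" by blast
  have yV: "y \<in> carrier V" using y(1) subspaceD(2)[OF assms(1)] by blast
  have "x \<ominus>\<^bsub>V\<^esub> y \<in> W" using y(2) proj_eq_iff[OF assms(3) yV] assms(2) by blast
  then have "(x \<ominus>\<^bsub>V\<^esub> y) \<oplus>\<^bsub>V\<^esub> y \<in> W" using y(1) subspaceD(4)[OF assms(1)] by blast
  moreover have "(x \<ominus>\<^bsub>V\<^esub> y) \<oplus>\<^bsub>V\<^esub> y = x" using assms(3) yV by (simp add: a_minus_def M.a_assoc M.l_neg)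
  ultimately show "x \<in> W" by simp
qed simp

lemma subspace_proj:
  assumes W: "VectorSpace.subspace K W V"
  shows "VectorSpace.subspace K (proj ` W) Q"
proof -
  note s = subspaceD[OF W]
  have "proj \<zero>\<^bsub>V\<^esub> \<in> proj ` W" using s(3) by (rule imageI)
  then have "\<zero>\<^bsub>Q\<^esub> \<in> proj ` W" unfolding zero_Q proj_zero .
  moreover have "v \<oplus>\<^bsub>Q\<^esub> w \<in> proj ` W" if "v \<in> proj ` W" "w \<in> proj ` W" for v w
  proof -
    from that obtain x y where xy: "x \<in> W" "y \<in> W" "v = proj x" "w = proj y" by blast
    have "v \<oplus>\<^bsub>Q\<^esub> w = proj (x \<oplus>\<^bsub>V\<^esub> y)" using xy add_Q[of x y] s(2) by blast
    then show ?thesis using s(4)[OF xy(1,2)] by blast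
  qed
  moreover have "c \<odot>\<^bsub>Q\<^esub> v \<in> proj ` W" if "c \<in> carrier K" "v \<in> proj ` W" for c v
  proof -
    from that obtain x where x: "x \<in> W" "v = proj x" by blast
    have "c \<odot>\<^bsub>Q\<^esub> v = proj (c \<odot>\<^bsub>V\<^esub> x)" using x smult_Q[OF that(1), of x] s(2) by blast
    then show ?thesis using s(5)[OF that(1) x(1)] by blast
  qed
  moreover have "proj ` W \<subseteq> carrier Q"
    unfolding carrier_Q by (rule image_mono[OF s(2)])
  ultimately show ?thesis
    by (subst subspace_iff[OF vectorspace_Q]) (intro conjI ballI; assumption)
qed

lemma subspace_lift:
  assumes W': "VectorSpace.subspace K W' Q"
  obtains W where "VectorSpace.subspace K W V" "N \<subseteq> W" "W' = proj ` W"
proof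
  note s = subspaceD[OF W']
  let ?W = "{x \<in> carrier V. proj x \<in> W'}"
  have V: "vectorspace K V" by unfold_locales
  show "VectorSpace.subspace K ?W V"
    unfolding subspace_iff[OF V]
  proof (intro conjI ballI)
    show "\<zero>\<^bsub>V\<^esub> \<in> ?W" using s(3) unfolding zero_Q by (simp add: proj_zero del: M.a_coset_add_zero)
    show "x \<oplus>\<^bsub>V\<^esub> y \<in> ?W" if "x \<in> ?W" "y \<in> ?W" for x y
      using that s(4)[of "proj x" "proj y"] by (simp add: add_Q)
    show "c \<odot>\<^bsub>V\<^esub> x \<in> ?W" if "c \<in> carrier K" "x \<in> ?W" for c x
      using that s(5)[of c "proj x"] by (simp add: smult_Q)
  qed blast
  show "N \<subseteq> ?W"
  proof
    fix x assume x: "x \<in> N"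
    then have xV: "x \<in> carrier V" using subspaceD(2)[OF N] by blast
    moreover have "proj x \<in> W'"
      using s(3) proj_eq_N[OF xV] x unfolding zero_Q by simp
    ultimately show "x \<in> ?W" by blast
  qed
  show "W' = proj ` ?W"
    using s(2) unfolding carrier_Q by blast
qed

lemma proj_image_subset_iff:
  assumes "VectorSpace.subspace K W V" "VectorSpace.subspace K W' V" "N \<subseteq> W'"
  shows "proj ` W \<subseteq> proj ` W' \<longleftrightarrow> W \<subseteq> W'"
proof
  assume sub: "proj ` W \<subseteq> proj ` W'"
  show "W \<subseteq> W'"
  proof
    fix x assume "x \<in> W"
    then have "x \<in> carrier V" "proj x \<in> proj ` W'" using sub subspaceD(2)[OF assms(1)] by blast+
    then show "x \<in> W'" using proj_mem_image[OF assms(2,3)] by blast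
  qed
qed blast

lemma proj_image_psubset_iff:
  assumes "VectorSpace.subspace K W V" "N \<subseteq> W" "VectorSpace.subspace K W' V" "N \<subseteq> W'"
  shows "proj ` W \<subset> proj ` W' \<longleftrightarrow> W \<subset> W'"
  using proj_image_subset_iff[OF assms(1,3,4)] proj_image_subset_iff[OF assms(3,1,2)] by blast

lemma proj_image_eq_iff:
  assumes "VectorSpace.subspace K W V" "N \<subseteq> W" "VectorSpace.subspace K W' V" "N \<subseteq> W'"
  shows "proj ` W = proj ` W' \<longleftrightarrow> W = W'"
  using proj_image_subset_iff[OF assms(1,3,4)] proj_image_subset_iff[OF assms(3,1,2)] by blast

lemma proj_N: "proj ` N = {\<zero>\<^bsub>Q\<^esub>}"
proof -
  have "proj x = N" if "x \<in> N" for x using that subspaceD(2)[OF N] proj_eq_N by blast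
  then have "proj ` N = (\<lambda>x. N) ` N" by (rule image_cong[OF refl])
  also have "\<dots> = {\<zero>\<^bsub>Q\<^esub>}" using subspaceD(3)[OF N] unfolding zero_Q by blast
  finally show ?thesis .
qed

text \<open>Every fibre of the projection on \<open>W\<close> is a translate of \<open>N\<close>,
  because \<open>N \<subseteq> W\<close>.\<close>

lemma card_proj:
  assumes W: "VectorSpace.subspace K W V" "N \<subseteq> W" and fin: "finite W"
  shows "card (proj ` W) * card N = card W"
proof -
  note s = subspaceD[OF W(1)]
  have fib: "card {x \<in> W. proj x = A} = card N" if A: "A \<in> proj ` W" for A
  proof -
    obtain y where y: "y \<in> W" "A = proj y" using A by blast
    have yV: "y \<in> carrier V" using y s by blast
    have "{x \<in> W. proj x = A} = (\<lambda>h. h \<oplus>\<^bsub>V\<^esub> y) ` N"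
    proof (intro equalityI subsetI)
      fix x assume "x \<in> {x \<in> W. proj x = A}"
      then have x: "x \<in> carrier V" "x \<ominus>\<^bsub>V\<^esub> y \<in> N" using y(2) yV proj_eq_iff[of x y] s(2) by auto
      moreover have "x = (x \<ominus>\<^bsub>V\<^esub> y) \<oplus>\<^bsub>V\<^esub> y" using x(1) yV by (simp add: a_minus_def M.a_assoc M.l_neg)
      ultimately show "x \<in> (\<lambda>h. h \<oplus>\<^bsub>V\<^esub> y) ` N" by blast
    next
      fix x assume "x \<in> (\<lambda>h. h \<oplus>\<^bsub>V\<^esub> y) ` N"
      then obtain h where h: "h \<in> N" "x = h \<oplus>\<^bsub>V\<^esub> y" by blast
      have hV: "h \<in> carrier V" using h(1) subspaceD(2)[OF N] by blast
      have "x \<in> W" using h y W(2) s(4) by blast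
      moreover have "x \<ominus>\<^bsub>V\<^esub> y = h" using h(2) hV yV by (simp add: a_minus_def M.a_assoc M.r_neg)
      ultimately show "x \<in> {x \<in> W. proj x = A}"
        using h(1) y(2) yV proj_eq_iff[of x y] s(2) by auto
    qed
    moreover have "inj_on (\<lambda>h. h \<oplus>\<^bsub>V\<^esub> y) N"
      using yV subspaceD(2)[OF N] by (intro inj_onI) (auto simp: subset_iff)
    ultimately show ?thesis by (simp add: card_image)
  qed
  have "card W = (\<Sum>A\<in>proj ` W. card {x \<in> W. proj x = A})"
    using sum.group[OF fin finite_imageI[OF fin, of proj] order_refl, of "\<lambda>_. 1::nat"] by simp
  also have "\<dots> = card (proj ` W) * card N"
    using fib by simp
  finally show ?thesis by simp
qed

end

text \<open>After scaling \<open>x0\<close> to a vector \<open>w\<close> with value 1, the space is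
  the product of the kernel and the line of multiples of \<open>w\<close>.\<close>

lemma (in vectorspace) card_functional_kernel:
  assumes fin: "finite (carrier V)" and f: "f \<in> carrier V \<rightarrow> carrier K"
    and add: "\<And>x y. x \<in> carrier V \<Longrightarrow> y \<in> carrier V \<Longrightarrow> f (x \<oplus>\<^bsub>V\<^esub> y) = f x \<oplus>\<^bsub>K\<^esub> f y"
    and smult: "\<And>c x. c \<in> carrier K \<Longrightarrow> x \<in> carrier V \<Longrightarrow> f (c \<odot>\<^bsub>V\<^esub> x) = c \<otimes>\<^bsub>K\<^esub> f x"
    and nz: "x0 \<in> carrier V" "f x0 \<noteq> \<zero>\<^bsub>K\<^esub>"
  shows "card {x \<in> carrier V. f x = \<zero>\<^bsub>K\<^esub>} * card (carrier K) = card (carrier V)"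
proof -
  let ?Z = "{x \<in> carrier V. f x = \<zero>\<^bsub>K\<^esub>}"
  have fx0: "f x0 \<in> carrier K" using f nz by blast
  then have inv: "inv\<^bsub>K\<^esub> f x0 \<in> carrier K" "inv\<^bsub>K\<^esub> f x0 \<otimes>\<^bsub>K\<^esub> f x0 = \<one>\<^bsub>K\<^esub>"
    using nz(2) field_Units by auto
  define w where "w = inv\<^bsub>K\<^esub> f x0 \<odot>\<^bsub>V\<^esub> x0"
  have w: "w \<in> carrier V" "f w = \<one>\<^bsub>K\<^esub>" using inv nz by (auto simp: w_def smult)
  have fcw: "f (c \<odot>\<^bsub>V\<^esub> w) = c" if "c \<in> carrier K" for c using that w by (simp add: smult)
  have fc: "f x \<in> carrier K" if "x \<in> carrier V" for x using f that by blast
  have neg: "f (\<ominus>\<^bsub>V\<^esub> x) = \<ominus>\<^bsub>K\<^esub> f x" if "x \<in> carrier V" for x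
    using smult[of "\<ominus>\<^bsub>K\<^esub> \<one>\<^bsub>K\<^esub>" x] fc[OF that] that by (simp add: smult_minus_1 R.l_minus)
  have "bij_betw (\<lambda>(x, c). x \<oplus>\<^bsub>V\<^esub> c \<odot>\<^bsub>V\<^esub> w) (?Z \<times> carrier K) (carrier V)"
  proof (rule bij_betw_byWitness[where f' = "\<lambda>x. (x \<ominus>\<^bsub>V\<^esub> f x \<odot>\<^bsub>V\<^esub> w, f x)"])
    show "\<forall>a\<in>?Z \<times> carrier K. (\<lambda>x. (x \<ominus>\<^bsub>V\<^esub> f x \<odot>\<^bsub>V\<^esub> w, f x)) ((\<lambda>(x, c). x \<oplus>\<^bsub>V\<^esub> c \<odot>\<^bsub>V\<^esub> w) a) = a"
      using w by (auto simp: add fcw a_minus_def M.a_assoc M.r_neg)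
    show "\<forall>x\<in>carrier V. (\<lambda>(x, c). x \<oplus>\<^bsub>V\<^esub> c \<odot>\<^bsub>V\<^esub> w) (x \<ominus>\<^bsub>V\<^esub> f x \<odot>\<^bsub>V\<^esub> w, f x) = x"
      using w fc by (auto simp: a_minus_def M.a_assoc M.l_neg)
    show "(\<lambda>(x, c). x \<oplus>\<^bsub>V\<^esub> c \<odot>\<^bsub>V\<^esub> w) ` (?Z \<times> carrier K) \<subseteq> carrier V"
      using w by auto
    show "(\<lambda>x. (x \<ominus>\<^bsub>V\<^esub> f x \<odot>\<^bsub>V\<^esub> w, f x)) ` carrier V \<subseteq> ?Z \<times> carrier K"
      using w fc by (auto simp: add neg fcw a_minus_def R.r_neg)
  qed
  then have "card (?Z \<times> carrier K) = card (carrier V)" by (rule bij_betw_same_card)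
  then show ?thesis by (simp add: card_cartesian_product)
qed

section \<open>Nondegenerate forms and orthogonal complements\<close>

locale finite_vectorspace = vectorspace K V for K V +
  assumes finite_K: "finite (carrier K)" and finite_V: "finite (carrier V)"
begin

lemma card_field: "card (carrier K) \<ge> 2"
proof -
  have "card {\<zero>\<^bsub>K\<^esub>, \<one>\<^bsub>K\<^esub>} \<le> card (carrier K)"
    using finite_K by (intro card_mono) auto
  then show ?thesis by simp
qed

end

text \<open>Antisymmetry makes left and right orthogonality agree, so that the one-sided
  \<open>perp\<close> is the orthogonal complement and additivity in the second argument follows
  from the first.\<close>

locale form_space = finite_vectorspace K V for K V +
  fixes \<omega>
  assumes form_closed: "x \<in> carrier V \<Longrightarrow> y \<in> carrier V \<Longrightarrow> \<omega> x y \<in> carrier K"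
    and form_add: "x \<in> carrier V \<Longrightarrow> y \<in> carrier V \<Longrightarrow> z \<in> carrier V \<Longrightarrow>
      \<omega> (x \<oplus>\<^bsub>V\<^esub> y) z = \<omega> x z \<oplus>\<^bsub>K\<^esub> \<omega> y z"
    and form_smult: "c \<in> carrier K \<Longrightarrow> x \<in> carrier V \<Longrightarrow> y \<in> carrier V \<Longrightarrow>
      \<omega> (c \<odot>\<^bsub>V\<^esub> x) y = c \<otimes>\<^bsub>K\<^esub> \<omega> x y"
    and form_swap: "x \<in> carrier V \<Longrightarrow> y \<in> carrier V \<Longrightarrow> \<omega> y x = \<ominus>\<^bsub>K\<^esub> \<omega> x y"
    and form_nondegenerate: "x \<in> carrier V \<Longrightarrow> (\<And>y. y \<in> carrier V \<Longrightarrow> \<omega> x y = \<zero>\<^bsub>K\<^esub>) \<Longrightarrow> x = \<zero>\<^bsub>V\<^esub>"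
begin

abbreviation perp where "perp U \<equiv> symp_complement K V \<omega> U"

lemma perp_iff: "x \<in> perp U \<longleftrightarrow> x \<in> carrier V \<and> (\<forall>y\<in>U. \<omega> x y = \<zero>\<^bsub>K\<^esub>)"
  by (simp add: symp_complement_def)

lemma form_swap_zero: "x \<in> carrier V \<Longrightarrow> y \<in> carrier V \<Longrightarrow> \<omega> x y = \<zero>\<^bsub>K\<^esub> \<Longrightarrow> \<omega> y x = \<zero>\<^bsub>K\<^esub>"
  using form_swap[of x y] by simp

lemma form_add_right:
  assumes "x \<in> carrier V" "y \<in> carrier V" "z \<in> carrier V"
  shows "\<omega> x (y \<oplus>\<^bsub>V\<^esub> z) = \<omega> x y \<oplus>\<^bsub>K\<^esub> \<omega> x z"
proof -
  have "\<omega> x (y \<oplus>\<^bsub>V\<^esub> z) = \<ominus>\<^bsub>K\<^esub> (\<omega> y x \<oplus>\<^bsub>K\<^esub> \<omega> z x)"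
    using form_swap[of "y \<oplus>\<^bsub>V\<^esub> z" x] form_add[of y z x] assms by simp
  also have "\<dots> = (\<ominus>\<^bsub>K\<^esub> \<omega> y x) \<oplus>\<^bsub>K\<^esub> (\<ominus>\<^bsub>K\<^esub> \<omega> z x)"
    using form_closed assms by (simp add: R.minus_add)
  also have "\<dots> = \<omega> x y \<oplus>\<^bsub>K\<^esub> \<omega> x z"
    using form_swap[of y x] form_swap[of z x] assms by simp
  finally show ?thesis .
qed

lemma form_zero: "y \<in> carrier V \<Longrightarrow> \<omega> \<zero>\<^bsub>V\<^esub> y = \<zero>\<^bsub>K\<^esub>"
  using form_smult[of "\<zero>\<^bsub>K\<^esub>" "\<zero>\<^bsub>V\<^esub>" y] form_closed[of "\<zero>\<^bsub>V\<^esub>" y] by simp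

lemma perp_subspace:
  assumes "U \<subseteq> carrier V"
  shows "VectorSpace.subspace K (perp U) V"
proof -
  have V: "vectorspace K V" by unfold_locales
  have U: "y \<in> carrier V" if "y \<in> U" for y using that assms by blast
  show ?thesis
    unfolding subspace_iff[OF V]
  proof (intro conjI ballI)
    show "perp U \<subseteq> carrier V" by (auto simp: perp_iff)
    show "\<zero>\<^bsub>V\<^esub> \<in> perp U" using U form_zero by (simp add: perp_iff)
    show "x \<oplus>\<^bsub>V\<^esub> y \<in> perp U" if "x \<in> perp U" "y \<in> perp U" for x y
      using that U by (simp add: perp_iff form_add)
    show "c \<odot>\<^bsub>V\<^esub> x \<in> perp U" if "c \<in> carrier K" "x \<in> perp U" for c x
      using that U by (simp add: perp_iff form_smult)
  qed
qed

text \<open>Double counting of the pairs \<open>(x, u) \<in> V \<times> U\<close> with \<open>\<omega> x u = 0\<close>.\<close>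

lemma card_perp:
  assumes U: "VectorSpace.subspace K U V"
  shows "card U * card (perp U) = card (carrier V)"
proof -
  note s = subspaceD[OF U]
  let ?q = "card (carrier K)" and ?V = "carrier V"
  have finU: "finite U" using s(2) finite_V by (rule finite_subset)
  have perpV: "perp U \<subseteq> ?V" by (auto simp: perp_iff)
  \<comment> \<open>For nonzero \<open>u\<close>, nondegeneracy makes
    \<open>\<lambda>x. \<omega> x u\<close> a nonzero functional, whose kernel has index
    \<open>?q\<close>. The counts are multiplied by \<open>?q\<close> so that no division
    occurs.\<close>
  have row: "?q * card {x \<in> ?V. \<omega> x u = \<zero>\<^bsub>K\<^esub>} = (if u = \<zero>\<^bsub>V\<^esub> then ?q * card ?V else card ?V)"
    if u: "u \<in> ?V" for u
  proof (cases "u = \<zero>\<^bsub>V\<^esub>")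
    case True
    then have "{x \<in> ?V. \<omega> x u = \<zero>\<^bsub>K\<^esub>} = ?V"
      using form_zero form_swap_zero by auto
    then show ?thesis using True by simp
  next
    case False
    then obtain x0 where x0: "x0 \<in> ?V" "\<omega> u x0 \<noteq> \<zero>\<^bsub>K\<^esub>"
      using form_nondegenerate[OF u] by blast
    have "card {x \<in> ?V. \<omega> x u = \<zero>\<^bsub>K\<^esub>} * ?q = card ?V"
    proof (rule card_functional_kernel[OF finite_V])
      show "(\<lambda>x. \<omega> x u) \<in> ?V \<rightarrow> carrier K" using form_closed u by auto
      show "\<omega> x0 u \<noteq> \<zero>\<^bsub>K\<^esub>" using x0 form_swap_zero u by blast
    qed (use u x0 form_add form_smult in auto)
    then show ?thesis using False by (simp add: mult.commute)
  qed
  have col: "?q * card {u \<in> U. \<omega> x u = \<zero>\<^bsub>K\<^esub>} = (if x \<in> perp U then ?q * card U else card U)"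
    if x: "x \<in> ?V" for x
  proof (cases "x \<in> perp U")
    case True
    then have "{u \<in> U. \<omega> x u = \<zero>\<^bsub>K\<^esub>} = U" by (auto simp: perp_iff)
    then show ?thesis using True by simp
  next
    case False
    then obtain u0 where u0: "u0 \<in> U" "\<omega> x u0 \<noteq> \<zero>\<^bsub>K\<^esub>" using x by (auto simp: perp_iff)
    interpret U: vectorspace K "V\<lparr>carrier := U\<rparr>" by (rule subspace_is_vs[OF U])
    have UV: "u \<in> ?V" if "u \<in> U" for u using that s(2) by blast
    have "{u \<in> U. \<omega> x u = \<zero>\<^bsub>K\<^esub>} = {u \<in> U. \<omega> u x = \<zero>\<^bsub>K\<^esub>}"
      using form_swap_zero x UV by blast
    moreover have "card {u \<in> carrier (V\<lparr>carrier := U\<rparr>). \<omega> u x = \<zero>\<^bsub>K\<^esub>} * ?q = card (carrier (V\<lparr>carrier := U\<rparr>))"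
    proof (rule U.card_functional_kernel)
      show "\<omega> u0 x \<noteq> \<zero>\<^bsub>K\<^esub>" using u0 form_swap_zero x UV by blast
      show "(\<lambda>u. \<omega> u x) \<in> carrier (V\<lparr>carrier := U\<rparr>) \<rightarrow> carrier K" using form_closed x UV by auto
    qed (use x u0 finU UV form_add form_smult in auto)
    ultimately show ?thesis using False by (simp add: mult.commute)
  qed
  have "(\<Sum>u\<in>U. card {x \<in> ?V. \<omega> x u = \<zero>\<^bsub>K\<^esub>}) = (\<Sum>x\<in>?V. card {u \<in> U. \<omega> x u = \<zero>\<^bsub>K\<^esub>})"
    using sum_multicount_gen[OF finU finite_V, of "\<lambda>u x. \<omega> x u = \<zero>\<^bsub>K\<^esub>" "\<lambda>x. card {u \<in> U. \<omega> x u = \<zero>\<^bsub>K\<^esub>}"]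
    by simp
  then have "(\<Sum>u\<in>U. ?q * card {x \<in> ?V. \<omega> x u = \<zero>\<^bsub>K\<^esub>}) = (\<Sum>x\<in>?V. ?q * card {u \<in> U. \<omega> x u = \<zero>\<^bsub>K\<^esub>})"
    by (simp flip: sum_distrib_left)
  moreover have "(\<Sum>u\<in>U. ?q * card {x \<in> ?V. \<omega> x u = \<zero>\<^bsub>K\<^esub>}) = ?q * card ?V + (card U - 1) * card ?V"
  proof -
    have "(\<Sum>u\<in>U. ?q * card {x \<in> ?V. \<omega> x u = \<zero>\<^bsub>K\<^esub>}) = (\<Sum>u\<in>U. if u = \<zero>\<^bsub>V\<^esub> then ?q * card ?V else card ?V)"
      using s(2) by (intro sum.cong refl row) blast
    also have "\<dots> = ?q * card ?V + (\<Sum>u\<in>U - {\<zero>\<^bsub>V\<^esub>}. card ?V)"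
      using finU s(3) by (subst sum.remove[of U "\<zero>\<^bsub>V\<^esub>"]) (auto intro!: sum.cong)
    finally show ?thesis using finU s(3) by simp
  qed
  moreover have "(\<Sum>x\<in>?V. ?q * card {u \<in> U. \<omega> x u = \<zero>\<^bsub>K\<^esub>}) =
      card (perp U) * (?q * card U) + (card ?V - card (perp U)) * card U"
  proof -
    have "(\<Sum>x\<in>?V. ?q * card {u \<in> U. \<omega> x u = \<zero>\<^bsub>K\<^esub>}) = (\<Sum>x\<in>?V. if x \<in> perp U then ?q * card U else card U)"
      by (intro sum.cong refl col)
    also have "\<dots> = (\<Sum>x\<in>perp U. ?q * card U) + (\<Sum>x\<in>?V - perp U. card U)"
      using finite_V perpV by (subst sum.If_cases) (auto simp: Int_absorb1 Diff_eq intro!: arg_cong2[where f = "(+)"] sum.cong)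
    finally show ?thesis
      using finite_V perpV by (simp add: card_Diff_subset finite_subset)
  qed
  ultimately have eq: "?q * card ?V + (card U - 1) * card ?V =
      card (perp U) * (?q * card U) + (card ?V - card (perp U)) * card U" by simp
  have "card U \<noteq> 0" using finU s(3) by auto
  moreover have "card (perp U) \<le> card ?V" using finite_V perpV by (rule card_mono)
  \<comment> \<open>Substituting \<open>m\<close>, \<open>l\<close> and \<open>r\<close> removes the
    truncated subtractions. After cancelling common terms the double count reads
    \<open>(q - 1) |V| = (q - 1) |U| |perp U|\<close>, and \<open>q - 1\<close>, which is
    \<open>Suc r\<close>, is positive.\<close>
  ultimately obtain m l where ml: "card U = Suc m" "card ?V = card (perp U) + l"
    using not0_implies_Suc le_Suc_ex by metis
  obtain r where "?q = 2 + r" using card_field le_Suc_ex by blast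
  then have r: "?q = Suc (Suc r)" by simp
  have "Suc r * card ?V = Suc r * (card U * card (perp U))"
    using eq unfolding r ml(1) by (simp add: ml(2) algebra_simps)
  then show ?thesis by (metis mult_cancel1 nat.distinct(1))
qed

lemma isotropic_subset_perp:
  assumes "U \<subseteq> W" "isotropic K \<omega> W" "W \<subseteq> carrier V"
  shows "W \<subseteq> perp U"
proof
  fix x assume "x \<in> W"
  with assms show "x \<in> perp U" unfolding perp_iff isotropic_def by blast
qed

text \<open>An isotropic subspace lies in its own complement, so \<open>card_perp\<close> bounds the
  square of its size; in terms of dimensions this is the bound by half of the total.\<close>

lemma isotropic_card:
  assumes U: "VectorSpace.subspace K U V" "isotropic K \<omega> U"
  shows "card U * card U \<le> card (carrier V)"
proof -
  have "U \<subseteq> perp U" using isotropic_subset_perp[OF order_refl U(2) subspaceD(2)[OF U(1)]] .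
  moreover have "finite (perp U)"
    by (rule finite_subset[OF _ finite_V]) (auto simp: perp_iff)
  ultimately have "card U \<le> card (perp U)" by (intro card_mono)
  then have "card U * card U \<le> card U * card (perp U)" by (rule mult_le_mono2)
  then show ?thesis unfolding card_perp[OF U(1)] .
qed

text \<open>An isotropic \<open>perp U\<close> has size squared at most the size of the space, which
  is the product of the sizes of \<open>U\<close> and \<open>perp U\<close>; so it is no larger than
  \<open>U\<close>. This serves to see that an isotropic subspace strictly above \<open>U\<close> is
  proper in \<open>perp U\<close>.\<close>

lemma perp_isotropic_eq:
  assumes U: "VectorSpace.subspace K U V" "isotropic K \<omega> U" and iso: "isotropic K \<omega> (perp U)"
  shows "perp U = U"
proof -
  note s = subspaceD[OF U(1)]
  have W: "VectorSpace.subspace K (perp U) V" by (rule perp_subspace[OF s(2)])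
  have fin: "finite (perp U)" using subspaceD(2)[OF W] finite_V by (rule finite_subset)
  have sub: "U \<subseteq> perp U" using isotropic_subset_perp[OF order_refl U(2) s(2)] .
  have pos: "card (perp U) > 0"
    using fin subspaceD(3)[OF W] by (auto simp: card_gt_0_iff)
  have "card (perp U) * card (perp U) \<le> card U * card (perp U)"
    using isotropic_card[OF W iso] card_perp[OF U(1)] by simp
  then have "card (perp U) \<le> card U" using pos by simp
  then show ?thesis using card_seteq[OF fin sub] by simp
qed

text \<open>Changing representatives by elements of \<open>U\<close> adds only terms that vanish by
  isotropy and orthogonality, so the image in \<open>induced_form\<close> is a singleton and
  \<open>the_elem\<close> returns its value.\<close>

lemma induced_form_proj:
  assumes U: "VectorSpace.subspace K U V" and x: "x \<in> perp U" and y: "y \<in> perp U" and iso: "isotropic K \<omega> U"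
  shows "induced_form \<omega> (U +>\<^bsub>V\<^esub> x) (U +>\<^bsub>V\<^esub> y) = \<omega> x y"
proof -
  note s = subspaceD[OF U]
  have xy: "x \<in> carrier V" "y \<in> carrier V" using x y by (auto simp: perp_iff)
  have "\<omega> (u \<oplus>\<^bsub>V\<^esub> x) (v \<oplus>\<^bsub>V\<^esub> y) = \<omega> x y" if uv: "u \<in> U" "v \<in> U" for u v
  proof -
    have uvV: "u \<in> carrier V" "v \<in> carrier V" using uv s(2) by auto
    have z: "\<omega> u v = \<zero>\<^bsub>K\<^esub>" "\<omega> x v = \<zero>\<^bsub>K\<^esub>" "\<omega> u y = \<zero>\<^bsub>K\<^esub>"
      using iso uv x y form_swap_zero[of y u] uvV by (auto simp: isotropic_def perp_iff)
    show ?thesis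
      using uvV xy z form_closed[OF xy] by (simp add: form_add form_add_right)
  qed
  then have "(\<lambda>(x, y). \<omega> x y) ` ((U +>\<^bsub>V\<^esub> x) \<times> (U +>\<^bsub>V\<^esub> y)) = {\<omega> x y}"
    using s(3) unfolding a_r_coset_def' by (auto simp: image_iff)
  then show ?thesis by (simp add: induced_form_def)
qed

end

lemma (in field) std_symplectic_form_space:
  assumes fin: "finite (carrier R)"
  shows "form_space R (func_space {..<2 * n}) (std_symplectic R n)"
proof -
  let ?V = "func_space {..<2 * n}"
  have mod: "module R ?V" by (rule func_space_is_module)
  have V: "vectorspace R ?V" unfolding vectorspace_def using mod field_axioms by blast
  have carV: "carrier ?V = {..<2 * n} \<rightarrow>\<^sub>E carrier R" by (simp add: func_space_def)
  have cl: "x i \<in> carrier R" "x (n + i) \<in> carrier R" if "x \<in> carrier ?V" "i < n" for x i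
    using that PiE_mem[of x "{..<2 * n}" "\<lambda>_. carrier R" i] PiE_mem[of x "{..<2 * n}" "\<lambda>_. carrier R" "n + i"]
    unfolding carV by simp_all
  have addV: "(x \<oplus>\<^bsub>?V\<^esub> y) i = x i \<oplus> y i" if "i < 2 * n" for x y i
    using that by (simp add: func_space_def)
  have smV: "(c \<odot>\<^bsub>?V\<^esub> x) i = c \<otimes> x i" if "i < 2 * n" for c x i
    using that by (simp add: func_space_def)
  define t where "t x y i = x i \<otimes> y (n + i) \<ominus> x (n + i) \<otimes> y i" for x y :: "nat \<Rightarrow> 'a" and i
  have form: "std_symplectic R n x y = (\<Oplus>i\<in>{..<n}. t x y i)" for x y
    by (simp add: std_symplectic_def t_def)
  have tc: "t x y i \<in> carrier R" if "x \<in> carrier ?V" "y \<in> carrier ?V" "i < n" for x y i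
    using cl that by (simp add: t_def)
  have tcf: "t x y \<in> {..<n} \<rightarrow> carrier R" if "x \<in> carrier ?V" "y \<in> carrier ?V" for x y
    using tc that by auto
  have single: "(\<Oplus>i\<in>{..<n}. if j = i then c else \<zero>) = c" if "j < n" "c \<in> carrier R" for j c
    using add.finprod_singleton[of j "{..<n}" "\<lambda>_. c"] that by simp
  interpret V: vectorspace R ?V by (rule V)
  show ?thesis
  proof unfold_locales
    show "finite (carrier R)" by (rule fin)
    show "finite (carrier ?V)" unfolding carV using fin by (intro finite_PiE) auto
    show "std_symplectic R n x y \<in> carrier R" if "x \<in> carrier ?V" "y \<in> carrier ?V" for x y
      unfolding form by (rule finsum_closed[OF tcf[OF that]])
    show "std_symplectic R n (x \<oplus>\<^bsub>?V\<^esub> y) z = std_symplectic R n x z \<oplus> std_symplectic R n y z"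
      if xyz: "x \<in> carrier ?V" "y \<in> carrier ?V" "z \<in> carrier ?V" for x y z
    proof -
      have "t (x \<oplus>\<^bsub>?V\<^esub> y) z i = t x z i \<oplus> t y z i" if i: "i < n" for i
      proof -
        note c = cl[OF xyz(1) i] cl[OF xyz(2) i] cl[OF xyz(3) i]
        have "(x \<oplus>\<^bsub>?V\<^esub> y) i = x i \<oplus> y i" "(x \<oplus>\<^bsub>?V\<^esub> y) (n + i) = x (n + i) \<oplus> y (n + i)"
          using addV i by auto
        then show ?thesis
          using c by (simp add: t_def a_minus_def l_distr minus_add a_ac)
      qed
      then have "std_symplectic R n (x \<oplus>\<^bsub>?V\<^esub> y) z = (\<Oplus>i\<in>{..<n}. t x z i \<oplus> t y z i)"
        unfolding form using tc xyz by (intro finsum_cong') auto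
      also have "\<dots> = std_symplectic R n x z \<oplus> std_symplectic R n y z"
        unfolding form by (rule finsum_addf[OF tcf tcf]) (use xyz in auto)
      finally show ?thesis .
    qed
    have sm: "std_symplectic R n (c \<odot>\<^bsub>?V\<^esub> x) y = c \<otimes> std_symplectic R n x y"
      if xy: "c \<in> carrier R" "x \<in> carrier ?V" "y \<in> carrier ?V" for c x y
    proof -
      have "t (c \<odot>\<^bsub>?V\<^esub> x) y i = c \<otimes> t x y i" if i: "i < n" for i
      proof -
        note c = cl[OF xy(2) i] cl[OF xy(3) i]
        have "(c \<odot>\<^bsub>?V\<^esub> x) i = c \<otimes> x i" "(c \<odot>\<^bsub>?V\<^esub> x) (n + i) = c \<otimes> x (n + i)"
          using smV i by auto
        then show ?thesis
          using c xy(1) by (simp add: t_def a_minus_def r_distr r_minus m_assoc)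
      qed
      then have "std_symplectic R n (c \<odot>\<^bsub>?V\<^esub> x) y = (\<Oplus>i\<in>{..<n}. c \<otimes> t x y i)"
        unfolding form using tc xy by (intro finsum_cong') auto
      also have "\<dots> = c \<otimes> std_symplectic R n x y"
        unfolding form by (rule finsum_rdistr[symmetric]) (use tcf xy in auto)
      finally show ?thesis .
    qed
    then show "std_symplectic R n (c \<odot>\<^bsub>?V\<^esub> x) y = c \<otimes> std_symplectic R n x y"
      if "c \<in> carrier R" "x \<in> carrier ?V" "y \<in> carrier ?V" for c x y using that .
    show "std_symplectic R n y x = \<ominus> std_symplectic R n x y"
      if xy: "x \<in> carrier ?V" "y \<in> carrier ?V" for x y
    proof -
      have "t y x i = (\<ominus> \<one>) \<otimes> t x y i" if i: "i < n" for i
        using cl[OF xy(1) i] cl[OF xy(2) i]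
        by (simp add: t_def a_minus_def l_minus minus_add m_ac a_ac)
      then have "std_symplectic R n y x = (\<Oplus>i\<in>{..<n}. (\<ominus> \<one>) \<otimes> t x y i)"
        unfolding form using tc xy by (intro finsum_cong') auto
      also have "\<dots> = (\<ominus> \<one>) \<otimes> (\<Oplus>i\<in>{..<n}. t x y i)"
        by (rule finsum_rdistr[symmetric]) (use tcf xy in auto)
      also have "\<dots> = \<ominus> std_symplectic R n x y"
        unfolding form using finsum_closed[OF tcf[OF xy]] by (simp add: l_minus)
      finally show ?thesis .
    qed
    show "x = \<zero>\<^bsub>?V\<^esub>"
      if x: "x \<in> carrier ?V" and z: "\<And>y. y \<in> carrier ?V \<Longrightarrow> std_symplectic R n x y = \<zero>" for x
    proof -
      \<comment> \<open>Nondegeneracy is tested on unit vectors: pairing with the one at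
        \<open>n + i\<close> returns \<open>x i\<close>, pairing with the one at \<open>i\<close>
        returns minus \<open>x (n + i)\<close>.\<close>
      let ?e = "\<lambda>k. \<lambda>j\<in>{..<2 * n}. if j = k then \<one> else \<zero>"
      have e: "?e k \<in> carrier ?V" for k unfolding carV by auto
      have "x i = \<zero> \<and> x (n + i) = \<zero>" if i: "i < n" for i
      proof
        have "t x (?e (n + i)) j = (if i = j then x i else \<zero>)" if "j < n" for j
          using i that cl[OF x that] by (auto simp: t_def a_minus_def)
        then have "std_symplectic R n x (?e (n + i)) = (\<Oplus>j\<in>{..<n}. if i = j then x i else \<zero>)"
          unfolding form using cl[OF x i] by (intro finsum_cong') auto
        then show "x i = \<zero>" using z[OF e] single[OF i cl(1)[OF x i]] by simp
        have "t x (?e i) j = (if i = j then \<ominus> x (n + i) else \<zero>)" if "j < n" for j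
          using i that cl[OF x that] by (auto simp: t_def a_minus_def)
        then have "std_symplectic R n x (?e i) = (\<Oplus>j\<in>{..<n}. if i = j then \<ominus> x (n + i) else \<zero>)"
          unfolding form using cl[OF x i] by (intro finsum_cong') auto
        then have "\<ominus> x (n + i) = \<zero>" using z[OF e] single[of i "\<ominus> x (n + i)"] i cl(2)[OF x i] by simp
        then show "x (n + i) = \<zero>" using cl(2)[OF x i] add.inv_eq_1_iff by simp
      qed
      then have low: "x j = \<zero>" "x (n + j) = \<zero>" if "j < n" for j
        using that by simp_all
      have "x j = \<zero>" if j: "j < 2 * n" for j
      proof (cases "j < n")
        case False
        then obtain i where "j = n + i" using le_Suc_ex not_less by blast
        then show ?thesis using low(2)[of i] j by simp
      qed (rule low)
      then show ?thesis
        using x unfolding carV by (auto simp: func_space_def fun_eq_iff PiE_iff extensional_def)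
    qed
  qed
qed

lemma (in vectorspace)
  assumes M: "VectorSpace.subspace K M V" and a: "a \<in> carrier V" and b: "b \<in> carrier V"
  shows subspace_cancel_diff1: "a \<ominus>\<^bsub>V\<^esub> b \<in> M \<Longrightarrow> b \<in> M \<Longrightarrow> a \<in> M"
    and subspace_cancel_diff2: "a \<ominus>\<^bsub>V\<^esub> b \<in> M \<Longrightarrow> a \<in> M \<Longrightarrow> b \<in> M"
    and subspace_cancel_add: "a \<oplus>\<^bsub>V\<^esub> b \<in> M \<Longrightarrow> b \<in> M \<Longrightarrow> a \<in> M"
proof -
  have 1: "(a \<ominus>\<^bsub>V\<^esub> b) \<oplus>\<^bsub>V\<^esub> b = a" using a b by (simp add: a_minus_def M.a_assoc M.l_neg)
  show "a \<in> M" if "a \<ominus>\<^bsub>V\<^esub> b \<in> M" "b \<in> M" using subspaceD(4)[OF M that] unfolding 1 .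
  have "a \<ominus>\<^bsub>V\<^esub> (a \<ominus>\<^bsub>V\<^esub> b) = b"
    using a b by (simp add: a_minus_def M.minus_add M.r_neg1 M.r_neg2 M.minus_minus)
  then show "b \<in> M" if "a \<ominus>\<^bsub>V\<^esub> b \<in> M" "a \<in> M" using subspace_minus[OF M that(2,1)] by simp
  have "(a \<oplus>\<^bsub>V\<^esub> b) \<ominus>\<^bsub>V\<^esub> b = a" using a b by (simp add: a_minus_def M.a_assoc M.r_neg)
  then show "a \<in> M" if "a \<oplus>\<^bsub>V\<^esub> b \<in> M" "b \<in> M" using subspace_minus[OF M that] by simp
qed

section \<open>Orientations\<close>

locale tuple_space = finite_vectorspace K V for K V +
  fixes r :: nat
begin

definition "tuples = {..<r} \<rightarrow>\<^sub>E carrier V"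
definition "tgen = free_gen K tuples"
definition "tspace = free_module K tuples"
definition "ext_rels =
  {tgen (v(i := x \<oplus>\<^bsub>V\<^esub> y)) \<ominus>\<^bsub>tspace\<^esub> (tgen (v(i := x)) \<oplus>\<^bsub>tspace\<^esub> tgen (v(i := y))) | v i x y.
            v \<in> tuples \<and> i < r \<and> x \<in> carrier V \<and> y \<in> carrier V} \<union>
  {tgen (v(i := c \<odot>\<^bsub>V\<^esub> x)) \<ominus>\<^bsub>tspace\<^esub> c \<odot>\<^bsub>tspace\<^esub> tgen (v(i := x)) | v i c x.
            v \<in> tuples \<and> i < r \<and> c \<in> carrier K \<and> x \<in> carrier V} \<union>
  {tgen v | v. v \<in> tuples \<and> (\<exists>i j. i < r \<and> j < r \<and> i \<noteq> j \<and> v i = v j)}"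

lemma exterior_power_eq:
  "exterior_power K V r = quotient_module tspace (LinearCombinations.module.span K tspace ext_rels)"
  unfolding exterior_power_def Let_def ext_rels_def tspace_def tgen_def tuples_def ..

lemma finite_tuples: "finite tuples"
  unfolding tuples_def using finite_V by (intro finite_PiE) auto

lemma tuple_upd: "v \<in> tuples \<Longrightarrow> i < r \<Longrightarrow> x \<in> carrier V \<Longrightarrow> v(i := x) \<in> tuples"
  unfolding tuples_def by (auto simp: PiE_iff extensional_def)

lemma tuple_mem: "v \<in> tuples \<Longrightarrow> i < r \<Longrightarrow> v i \<in> carrier V"
  unfolding tuples_def PiE_iff by simp

text \<open>A finite space has finitely many tuples of length \<open>r\<close>, so finite support is
  automatic and the free module is a function space whose elements can be counted.\<close>

lemma tspace_eq: "tspace = ring.func_space K tuples"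
proof -
  have "{f \<in> tuples \<rightarrow>\<^sub>E carrier K. finite {s \<in> tuples. f s \<noteq> \<zero>\<^bsub>K\<^esub>}} = tuples \<rightarrow>\<^sub>E carrier K"
    using finite_tuples by auto
  then show ?thesis unfolding tspace_def free_module_def func_space_def by simp
qed

lemma vectorspace_tspace: "vectorspace K tspace"
  unfolding tspace_eq by (rule func_space_is_vs)

interpretation F: vectorspace K tspace by (rule vectorspace_tspace)

lemma carrier_tspace: "carrier tspace = tuples \<rightarrow>\<^sub>E carrier K"
  by (simp add: tspace_eq func_space_def)

lemma finite_tspace: "finite (carrier tspace)"
  unfolding carrier_tspace using finite_tuples finite_K by (intro finite_PiE) auto

lemma add_tspace: "t \<in> tuples \<Longrightarrow> (g \<oplus>\<^bsub>tspace\<^esub> h) t = g t \<oplus>\<^bsub>K\<^esub> h t"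
  by (simp add: tspace_eq func_space_def)

lemma smult_tspace: "t \<in> tuples \<Longrightarrow> (c \<odot>\<^bsub>tspace\<^esub> h) t = c \<otimes>\<^bsub>K\<^esub> h t"
  by (simp add: tspace_eq func_space_def)

lemma zero_tspace: "\<zero>\<^bsub>tspace\<^esub> = (\<lambda>t\<in>tuples. \<zero>\<^bsub>K\<^esub>)"
  by (auto simp: tspace_eq func_space_def)

lemma tgen_closed: "tgen t \<in> carrier tspace"
  unfolding tgen_def free_gen_def carrier_tspace by auto

lemma tgen_app: "s \<in> tuples \<Longrightarrow> tgen t s = (if s = t then \<one>\<^bsub>K\<^esub> else \<zero>\<^bsub>K\<^esub>)"
  unfolding tgen_def free_gen_def by simp

lemma tspace_eqI:
  assumes "g \<in> carrier tspace" "h \<in> carrier tspace" "\<And>t. t \<in> tuples \<Longrightarrow> g t = h t"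
  shows "g = h"
  using assms unfolding carrier_tspace by (rule PiE_ext)

lemma ext_rels_subset: "ext_rels \<subseteq> carrier tspace"
  unfolding ext_rels_def by (auto intro!: F.M.minus_closed F.M.a_closed F.smult_closed tgen_closed)

lemma
  assumes "v \<in> tuples" "i < r"
  shows ext_rels_add: "x \<in> carrier V \<Longrightarrow> y \<in> carrier V \<Longrightarrow>
      tgen (v(i := x \<oplus>\<^bsub>V\<^esub> y)) \<ominus>\<^bsub>tspace\<^esub> (tgen (v(i := x)) \<oplus>\<^bsub>tspace\<^esub> tgen (v(i := y))) \<in> ext_rels"
    and ext_rels_smult: "c \<in> carrier K \<Longrightarrow> x \<in> carrier V \<Longrightarrow>
      tgen (v(i := c \<odot>\<^bsub>V\<^esub> x)) \<ominus>\<^bsub>tspace\<^esub> c \<odot>\<^bsub>tspace\<^esub> tgen (v(i := x)) \<in> ext_rels"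
    and ext_rels_alt: "j < r \<Longrightarrow> i \<noteq> j \<Longrightarrow> v i = v j \<Longrightarrow> tgen v \<in> ext_rels"
proof -
  show "tgen (v(i := x \<oplus>\<^bsub>V\<^esub> y)) \<ominus>\<^bsub>tspace\<^esub> (tgen (v(i := x)) \<oplus>\<^bsub>tspace\<^esub> tgen (v(i := y))) \<in> ext_rels"
    if "x \<in> carrier V" "y \<in> carrier V" for x y
    unfolding ext_rels_def
    by (rule UnI1, rule UnI1, rule CollectI, intro exI conjI, rule refl) (fact assms that)+
  show "tgen (v(i := c \<odot>\<^bsub>V\<^esub> x)) \<ominus>\<^bsub>tspace\<^esub> c \<odot>\<^bsub>tspace\<^esub> tgen (v(i := x)) \<in> ext_rels"
    if "c \<in> carrier K" "x \<in> carrier V" for c x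
    unfolding ext_rels_def
    by (rule UnI1, rule UnI2, rule CollectI, intro exI conjI, rule refl) (fact assms that)+
  show "tgen v \<in> ext_rels" if "j < r" "i \<noteq> j" "v i = v j" for j
    unfolding ext_rels_def
    by (rule UnI2, rule CollectI, intro exI conjI, rule refl) (fact assms that)+
qed

lemma span_subspace: "VectorSpace.subspace K (F.span ext_rels) tspace"
  by (rule F.span_is_subspace[OF ext_rels_subset])

lemma tgen_spanning:
  assumes M: "VectorSpace.subspace K M tspace" and gen: "\<And>t. t \<in> tuples \<Longrightarrow> tgen t \<in> M"
  shows "M = carrier tspace"
proof
  note s = subspaceD[OF M]
  show "M \<subseteq> carrier tspace" by (rule s(2))
  have "h \<in> M" if "finite A" "A \<subseteq> tuples" "h \<in> carrier tspace" "\<And>t. t \<in> tuples \<Longrightarrow> t \<notin> A \<Longrightarrow> h t = \<zero>\<^bsub>K\<^esub>" for A h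
    using that
  proof (induction A arbitrary: h rule: finite_induct)
    case empty
    then have "h = \<zero>\<^bsub>tspace\<^esub>"
      by (intro tspace_eqI F.M.zero_closed) (auto simp: zero_tspace)
    then show ?case using s(3) by simp
  next
    case (insert a A)
    have a: "a \<in> tuples" using insert.prems(1) by auto
    let ?g = "h(a := \<zero>\<^bsub>K\<^esub>)"
    have ha: "h t \<in> carrier K" if "t \<in> tuples" for t
      using insert.prems(2) that unfolding carrier_tspace PiE_iff by simp
    have g: "?g \<in> carrier tspace"
      using insert.prems(2) a unfolding carrier_tspace by (auto simp: PiE_iff extensional_def)
    have "?g \<in> M"
    proof (rule insert.IH[OF _ g])
      show "A \<subseteq> tuples" using insert.prems(1) by blast
      show "?g t = \<zero>\<^bsub>K\<^esub>" if "t \<in> tuples" "t \<notin> A" for t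
        using insert.prems(3)[OF that(1)] that(2) by (cases "t = a") simp_all
    qed
    moreover have "h a \<odot>\<^bsub>tspace\<^esub> tgen a \<in> M"
      by (rule s(5)[OF ha[OF a] gen[OF a]])
    ultimately have "?g \<oplus>\<^bsub>tspace\<^esub> (h a \<odot>\<^bsub>tspace\<^esub> tgen a) \<in> M" by (rule s(4))
    moreover have "?g \<oplus>\<^bsub>tspace\<^esub> (h a \<odot>\<^bsub>tspace\<^esub> tgen a) = h"
    proof (rule tspace_eqI)
      show "?g \<oplus>\<^bsub>tspace\<^esub> (h a \<odot>\<^bsub>tspace\<^esub> tgen a) \<in> carrier tspace"
        by (intro F.M.a_closed F.smult_closed g ha a tgen_closed)
      show "(?g \<oplus>\<^bsub>tspace\<^esub> (h a \<odot>\<^bsub>tspace\<^esub> tgen a)) t = h t" if "t \<in> tuples" for t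
        using that ha a by (simp add: add_tspace smult_tspace tgen_app)
    qed (rule insert.prems(2))
    ultimately show ?case by simp
  qed
  from this[OF finite_tuples order_refl] show "carrier tspace \<subseteq> M" by blast
qed

text \<open>
  Modulo a subspace containing the relations, the generators behave like an alternating multilinear
  function of the tuple.
\<close>

lemma
  assumes M: "VectorSpace.subspace K M tspace" and N: "ext_rels \<subseteq> M" and v: "v \<in> tuples" and i: "i < r"
  shows rel_add1: "x \<in> carrier V \<Longrightarrow> y \<in> carrier V \<Longrightarrow>
      tgen (v(i := x)) \<in> M \<Longrightarrow> tgen (v(i := y)) \<in> M \<Longrightarrow> tgen (v(i := x \<oplus>\<^bsub>V\<^esub> y)) \<in> M"
    and rel_add2: "x \<in> carrier V \<Longrightarrow> y \<in> carrier V \<Longrightarrow>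
      tgen (v(i := x \<oplus>\<^bsub>V\<^esub> y)) \<in> M \<Longrightarrow> tgen (v(i := y)) \<in> M \<Longrightarrow> tgen (v(i := x)) \<in> M"
    and rel_smult: "c \<in> carrier K \<Longrightarrow> x \<in> carrier V \<Longrightarrow>
      tgen (v(i := x)) \<in> M \<Longrightarrow> tgen (v(i := c \<odot>\<^bsub>V\<^esub> x)) \<in> M"
    and rel_alt: "j < r \<Longrightarrow> i \<noteq> j \<Longrightarrow> v i = v j \<Longrightarrow> tgen v \<in> M"
proof -
  note s = subspaceD[OF M]
  have add: "tgen (v(i := x \<oplus>\<^bsub>V\<^esub> y)) \<ominus>\<^bsub>tspace\<^esub> (tgen (v(i := x)) \<oplus>\<^bsub>tspace\<^esub> tgen (v(i := y))) \<in> M"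
    if "x \<in> carrier V" "y \<in> carrier V" for x y
    using subsetD[OF N ext_rels_add[OF v i that]] .
  show "tgen (v(i := x \<oplus>\<^bsub>V\<^esub> y)) \<in> M"
    if "x \<in> carrier V" "y \<in> carrier V" "tgen (v(i := x)) \<in> M" "tgen (v(i := y)) \<in> M" for x y
    by (rule F.subspace_cancel_diff1[OF M _ _ add[OF that(1,2)] s(4)[OF that(3,4)]])
      (intro tgen_closed F.M.a_closed)+
  show "tgen (v(i := x)) \<in> M"
    if "x \<in> carrier V" "y \<in> carrier V" "tgen (v(i := x \<oplus>\<^bsub>V\<^esub> y)) \<in> M" "tgen (v(i := y)) \<in> M" for x y
  proof -
    have "tgen (v(i := x)) \<oplus>\<^bsub>tspace\<^esub> tgen (v(i := y)) \<in> M"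
      by (rule F.subspace_cancel_diff2[OF M _ _ add[OF that(1,2)] that(3)]) (intro tgen_closed F.M.a_closed)+
    then show ?thesis using that(4) by (rule F.subspace_cancel_add[OF M tgen_closed tgen_closed])
  qed
  show "tgen (v(i := c \<odot>\<^bsub>V\<^esub> x)) \<in> M" if c: "c \<in> carrier K" "x \<in> carrier V" "tgen (v(i := x)) \<in> M" for c x
  proof -
    have rel: "tgen (v(i := c \<odot>\<^bsub>V\<^esub> x)) \<ominus>\<^bsub>tspace\<^esub> c \<odot>\<^bsub>tspace\<^esub> tgen (v(i := x)) \<in> M"
      using subsetD[OF N ext_rels_smult[OF v i c(1,2)]] .
    show ?thesis
      by (rule F.subspace_cancel_diff1[OF M _ _ rel s(5)[OF c(1,3)]]) (intro tgen_closed F.smult_closed c(1))+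
  qed
  show "tgen v \<in> M" if "j < r" "i \<noteq> j" "v i = v j" for j
    using subsetD[OF N ext_rels_alt[OF v i that]] .
qed

text \<open>Polarisation: generators with equal entries at \<open>i\<close> and \<open>j\<close> lie
  in \<open>M\<close>, so the passage of these two entries from (x, y) to (x, x + y), then to (y, x
  + y), then to (y, x) stays inside \<open>M\<close>.\<close>

lemma rel_swap:
  assumes M: "VectorSpace.subspace K M tspace" and N: "ext_rels \<subseteq> M" and v: "v \<in> tuples"
    and ij: "i < r" "j < r" "i \<noteq> j" and z: "tgen v \<in> M"
  shows "tgen (v(i := v j, j := v i)) \<in> M"
proof -
  let ?x = "v i" and ?y = "v j"
  have xy: "?x \<in> carrier V" "?y \<in> carrier V" using tuple_mem[OF v] ij by auto
  define w where "w a b = v(i := a, j := b)" for a b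
  have w: "w a b \<in> tuples" if "a \<in> carrier V" "b \<in> carrier V" for a b
    unfolding w_def using v ij that by (intro tuple_upd)
  have wi: "(w a b)(i := c) = w c b" for a b c unfolding w_def using ij(3) by (auto simp: fun_eq_iff)
  have wj: "(w a b)(j := c) = w a c" for a b c unfolding w_def by simp
  have diag: "tgen (w a a) \<in> M" if "a \<in> carrier V" for a
    by (rule rel_alt[OF M N w[OF that that] ij(1,2,3)]) (use ij(3) in \<open>simp add: w_def\<close>)
  have "w ?x ?y = v" unfolding w_def using ij(3) by (auto simp: fun_eq_iff)
  then have wxy: "tgen (w ?x ?y) \<in> M" using z by simp
  let ?s = "?x \<oplus>\<^bsub>V\<^esub> ?y"
  have s: "?s \<in> carrier V" using xy by simp
  have 1: "tgen (w ?x ?s) \<in> M"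
    by (rule rel_add1[OF M N w[OF xy(1,1)] ij(2) xy, unfolded wj, OF diag[OF xy(1)] wxy])
  have "tgen (w ?s ?s) \<in> M" by (rule diag[OF s])
  then have "tgen (w (?y \<oplus>\<^bsub>V\<^esub> ?x) ?s) \<in> M" using M.a_comm[OF xy] by simp
  then have 2: "tgen (w ?y ?s) \<in> M"
    by (rule rel_add2[OF M N w[OF xy(1) s] ij(1) xy(2,1), unfolded wi, OF _ 1])
  have "tgen (w ?y ?x) \<in> M"
    by (rule rel_add2[OF M N w[OF xy(2,1)] ij(2) xy, unfolded wj, OF 2 diag[OF xy(2)]])
  then show ?thesis unfolding w_def .
qed

lemma basis_generator_suffices:
  assumes M: "VectorSpace.subspace K M tspace" and N: "ext_rels \<subseteq> M"
    and \<beta>: "\<beta> \<in> tuples" and span: "span (\<beta> ` {..<r}) = carrier V" and z: "tgen \<beta> \<in> M"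
  shows "M = carrier tspace"
proof (rule tgen_spanning[OF M])
  have \<beta>V: "\<beta> i \<in> carrier V" if "i < r" for i using tuple_mem[OF \<beta> that] .
  define sel where "sel p = (\<lambda>i\<in>{..<r}. \<beta> (p i))" for p
  have sel: "sel p \<in> tuples" if "\<And>i. i < r \<Longrightarrow> p i < r" for p
    unfolding sel_def tuples_def restrict_PiE_iff using \<beta>V[OF that] by (intro ballI) (simp only: lessThan_iff)
  have perm: "tgen (sel p) \<in> M" if "p permutes {..<r}" for p
    using finite_lessThan that
  proof (induction p rule: permutes_rev_induct)
    case id
    have "sel id = \<beta>"
      unfolding sel_def id_apply by (rule PiE_restrict[OF \<beta>[unfolded tuples_def]])
    then show ?case using z by (simp only:)
  next
    case (swap a b p)
    have pr: "p i < r" if "i < r" for i using permutes_in_image[OF swap.hyps(4), of i] that by simp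
    have "sel (p \<circ> Transposition.transpose a b) = (sel p)(a := sel p b, b := sel p a)"
      using swap.hyps(1-3) by (auto simp: sel_def fun_eq_iff Transposition.transpose_def)
    moreover have "tgen ((sel p)(a := sel p b, b := sel p a)) \<in> M"
      using swap.hyps(1-3) swap.IH pr by (intro rel_swap[OF M N sel]) simp_all
    ultimately show ?case by (simp only:)
  qed
  have base: "tgen v \<in> M" if v: "v \<in> tuples" and B: "\<And>i. i < r \<Longrightarrow> v i \<in> \<beta> ` {..<r}" for v
  proof -
    have "\<exists>j. j < r \<and> v i = \<beta> j" if "i < r" for i using B[OF that] by auto
    then obtain p where p: "\<And>i. i < r \<Longrightarrow> p i < r \<and> v i = \<beta> (p i)" by metis
    show ?thesis
    proof (cases "inj_on p {..<r}")
      case True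
      define p' where "p' i = (if i < r then p i else i)" for i
      have "inj_on p' {..<r}" "p' ` {..<r} \<subseteq> {..<r}"
        using True p by (auto simp: p'_def inj_on_def)
      then have "bij_betw p' {..<r} {..<r}"
        by (simp add: bij_betw_def endo_inj_surj)
      then have "p' permutes {..<r}" by (rule bij_imp_permutes) (simp add: p'_def)
      then have "tgen (sel p') \<in> M" by (rule perm)
      moreover have "sel p' = v"
      proof (rule PiE_ext[OF _ v[unfolded tuples_def]])
        show "sel p' \<in> {..<r} \<rightarrow>\<^sub>E carrier V"
          using sel[of p'] p unfolding tuples_def by (simp add: p'_def)
        show "sel p' i = v i" if "i \<in> {..<r}" for i
          using p[of i] that by (simp add: sel_def p'_def)
      qed
      ultimately show ?thesis by (simp only:)
    next
      case False
      then obtain i j where ij: "i < r" "j < r" "i \<noteq> j" "p i = p j" by (auto simp: inj_on_def)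
      then have "v i = v j" using p[OF ij(1)] p[OF ij(2)] by simp
      then show ?thesis by (rule rel_alt[OF M N v ij(1-3)])
    qed
  qed
  \<comment> \<open>Induction on the number \<open>l\<close> of leading entries that may be
    arbitrary; \<open>l = 0\<close> is \<open>base\<close>, and \<open>l = r\<close> covers all
    tuples.\<close>
  have "tgen v \<in> M" if "l \<le> r" "v \<in> tuples" "\<And>i. i < r \<Longrightarrow> l \<le> i \<Longrightarrow> v i \<in> \<beta> ` {..<r}" for l v
    using that
  proof (induction l arbitrary: v)
    case 0
    then show ?case by (intro base) auto
  next
    case (Suc l)
    have l: "l < r" using Suc.prems(1) by simp
    let ?S = "{x \<in> carrier V. tgen (v(l := x)) \<in> M}"
    have "\<beta> ` {..<r} \<subseteq> ?S"
    proof
      fix x assume x: "x \<in> \<beta> ` {..<r}"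
      then have xV: "x \<in> carrier V" using \<beta>V by auto
      have "tgen (v(l := x)) \<in> M"
        using Suc.prems x xV l by (intro Suc.IH tuple_upd) auto
      then show "x \<in> ?S" using xV by simp
    qed
    moreover have "VectorSpace.subspace K ?S V"
    proof -
      have V: "vectorspace K V" by unfold_locales
      \<comment> \<open>The zero vector is reached as the multiple by 0 of a vector of \<beta>,
        which is already known to lie in \<open>?S\<close>.\<close>
      have v0: "tgen (v(l := \<zero>\<^bsub>V\<^esub>)) \<in> M"
      proof -
        have "\<beta> l \<in> ?S" using calculation l by auto
        then have "tgen (v(l := \<zero>\<^bsub>K\<^esub> \<odot>\<^bsub>V\<^esub> \<beta> l)) \<in> M"
          by (intro rel_smult[OF M N Suc.prems(2) l]) auto
        then show ?thesis using \<beta>V[OF l] by simp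
      qed
      show ?thesis
        unfolding subspace_iff[OF V]
        using rel_add1[OF M N Suc.prems(2) l] rel_smult[OF M N Suc.prems(2) l] v0 by auto
    qed
    ultimately have "span (\<beta> ` {..<r}) \<subseteq> ?S"
      by (intro span_is_subset) (auto simp: VectorSpace.subspace_def)
    then have "v l \<in> ?S" using span tuple_mem[OF Suc.prems(2) l] by blast
    then show ?case by simp
  qed
  from this[OF order_refl] show "tgen v \<in> M" if "v \<in> tuples" for v using that by auto
qed

text \<open>The form \<open>f\<close> gives the lower bound: extended linearly to \<open>g\<close>,
  it kills the relations and takes the value 1 on \<beta>, so the quotient does not collapse.
  Together with spanning by \<beta>, the span of the relations is exactly the kernel of
  \<open>g\<close>, and the quotient has the size of the field.\<close>

lemma card_exterior_power:
  assumes f_closed: "\<And>v. v \<in> tuples \<Longrightarrow> f v \<in> carrier K"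
    and f_add: "\<And>v i x y. v \<in> tuples \<Longrightarrow> i < r \<Longrightarrow> x \<in> carrier V \<Longrightarrow> y \<in> carrier V \<Longrightarrow>
      f (v(i := x \<oplus>\<^bsub>V\<^esub> y)) = f (v(i := x)) \<oplus>\<^bsub>K\<^esub> f (v(i := y))"
    and f_smult: "\<And>v i c x. v \<in> tuples \<Longrightarrow> i < r \<Longrightarrow> c \<in> carrier K \<Longrightarrow> x \<in> carrier V \<Longrightarrow>
      f (v(i := c \<odot>\<^bsub>V\<^esub> x)) = c \<otimes>\<^bsub>K\<^esub> f (v(i := x))"
    and f_alt: "\<And>v i j. v \<in> tuples \<Longrightarrow> i < r \<Longrightarrow> j < r \<Longrightarrow> i \<noteq> j \<Longrightarrow> v i = v j \<Longrightarrow> f v = \<zero>\<^bsub>K\<^esub>"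
    and \<beta>: "\<beta> \<in> tuples" "span (\<beta> ` {..<r}) = carrier V" "f \<beta> = \<one>\<^bsub>K\<^esub>"
  shows "vectorspace K (exterior_power K V r) \<and>
    card (carrier (exterior_power K V r)) = card (carrier K)"
proof -
  define g where "g h = (\<Oplus>\<^bsub>K\<^esub>t\<in>tuples. h t \<otimes>\<^bsub>K\<^esub> f t)" for h
  let ?F = "carrier tspace"
  have hK: "h t \<in> carrier K" if "h \<in> ?F" "t \<in> tuples" for h t
    using that unfolding carrier_tspace PiE_iff by simp
  have hf: "(\<lambda>t. h t \<otimes>\<^bsub>K\<^esub> f t) \<in> tuples \<rightarrow> carrier K" if "h \<in> ?F" for h
    using hK[OF that] f_closed by auto
  have g_closed: "g h \<in> carrier K" if "h \<in> ?F" for h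
    unfolding g_def by (rule R.finsum_closed[OF hf[OF that]])
  have g_add: "g (h \<oplus>\<^bsub>tspace\<^esub> h') = g h \<oplus>\<^bsub>K\<^esub> g h'" if hh: "h \<in> ?F" "h' \<in> ?F" for h h'
  proof -
    have "g (h \<oplus>\<^bsub>tspace\<^esub> h') = (\<Oplus>\<^bsub>K\<^esub>t\<in>tuples. h t \<otimes>\<^bsub>K\<^esub> f t \<oplus>\<^bsub>K\<^esub> h' t \<otimes>\<^bsub>K\<^esub> f t)"
      unfolding g_def using hK[OF hh(1)] hK[OF hh(2)] f_closed
      by (intro R.finsum_cong') (auto simp: add_tspace R.l_distr)
    also have "\<dots> = g h \<oplus>\<^bsub>K\<^esub> g h'"
      unfolding g_def by (rule R.finsum_addf[OF hf[OF hh(1)] hf[OF hh(2)]])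
    finally show ?thesis .
  qed
  have g_smult: "g (c \<odot>\<^bsub>tspace\<^esub> h) = c \<otimes>\<^bsub>K\<^esub> g h" if ch: "c \<in> carrier K" "h \<in> ?F" for c h
  proof -
    have "g (c \<odot>\<^bsub>tspace\<^esub> h) = (\<Oplus>\<^bsub>K\<^esub>t\<in>tuples. c \<otimes>\<^bsub>K\<^esub> (h t \<otimes>\<^bsub>K\<^esub> f t))"
      unfolding g_def using hK[OF ch(2)] f_closed ch(1)
      by (intro R.finsum_cong') (auto simp: smult_tspace R.m_assoc)
    also have "\<dots> = c \<otimes>\<^bsub>K\<^esub> g h"
      unfolding g_def by (rule R.finsum_rdistr[OF finite_tuples ch(1) hf[OF ch(2)], symmetric])
    finally show ?thesis .
  qed
  have g_gen: "g (tgen t) = f t" if t: "t \<in> tuples" for t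
  proof -
    have "g (tgen t) = (\<Oplus>\<^bsub>K\<^esub>s\<in>tuples. if t = s then f s else \<zero>\<^bsub>K\<^esub>)"
      unfolding g_def using f_closed by (intro R.finsum_cong') (auto simp: tgen_app)
    also have "\<dots> = f t"
      using t finite_tuples f_closed by (intro R.finsum_singleton) auto
    finally show ?thesis .
  qed
  have g_uminus: "g (\<ominus>\<^bsub>tspace\<^esub> h) = \<ominus>\<^bsub>K\<^esub> g h" if "h \<in> ?F" for h
    using g_smult[of "\<ominus>\<^bsub>K\<^esub> \<one>\<^bsub>K\<^esub>" h] g_closed[OF that] that by (simp add: F.smult_minus_1 R.l_minus)
  have g_diff: "g (h \<ominus>\<^bsub>tspace\<^esub> h') = g h \<ominus>\<^bsub>K\<^esub> g h'" if "h \<in> ?F" "h' \<in> ?F" for h h'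
    using that by (simp add: a_minus_def g_add g_uminus)
  have diff_zero: "h \<ominus>\<^bsub>tspace\<^esub> \<zero>\<^bsub>tspace\<^esub> = h" if "h \<in> ?F" for h
    using that F.M.minus_equality[of "\<zero>\<^bsub>tspace\<^esub>" "\<zero>\<^bsub>tspace\<^esub>"] by (simp add: a_minus_def)
  let ?L = "{h \<in> ?F. g h = \<zero>\<^bsub>K\<^esub>}" and ?N = "F.span ext_rels"
  have L: "VectorSpace.subspace K ?L tspace"
    unfolding subspace_iff[OF vectorspace_tspace]
  proof (intro conjI ballI)
    have "g (\<zero>\<^bsub>K\<^esub> \<odot>\<^bsub>tspace\<^esub> \<zero>\<^bsub>tspace\<^esub>) = \<zero>\<^bsub>K\<^esub>"
      using g_smult[of "\<zero>\<^bsub>K\<^esub>" "\<zero>\<^bsub>tspace\<^esub>"] g_closed[OF F.M.zero_closed] by simp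
    then show "\<zero>\<^bsub>tspace\<^esub> \<in> ?L" by simp
  qed (auto simp: g_add g_smult)
  have "ext_rels \<subseteq> ?L"
  proof
    fix h assume h: "h \<in> ext_rels"
    then have hF: "h \<in> ?F" using ext_rels_subset by blast
    note c = f_closed[OF tuple_upd]
    have "g h = \<zero>\<^bsub>K\<^esub>"
      using h unfolding ext_rels_def
    proof (elim UnE CollectE exE conjE)
      fix v i x y assume *: "h = tgen (v(i := x \<oplus>\<^bsub>V\<^esub> y)) \<ominus>\<^bsub>tspace\<^esub> (tgen (v(i := x)) \<oplus>\<^bsub>tspace\<^esub> tgen (v(i := y)))"
        "v \<in> tuples" "i < r" "x \<in> carrier V" "y \<in> carrier V"
      have "g h = f (v(i := x \<oplus>\<^bsub>V\<^esub> y)) \<ominus>\<^bsub>K\<^esub> (f (v(i := x)) \<oplus>\<^bsub>K\<^esub> f (v(i := y)))"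
        unfolding *(1) using *(2-5) by (simp add: g_diff g_add g_gen tgen_closed tuple_upd)
      then show ?thesis
        using f_add[OF *(2-5)] c[OF *(2,3,4)] c[OF *(2,3,5)] by (simp add: a_minus_def R.r_neg)
    next
      fix v i b x assume *: "h = tgen (v(i := b \<odot>\<^bsub>V\<^esub> x)) \<ominus>\<^bsub>tspace\<^esub> b \<odot>\<^bsub>tspace\<^esub> tgen (v(i := x))"
        "v \<in> tuples" "i < r" "b \<in> carrier K" "x \<in> carrier V"
      have "g h = f (v(i := b \<odot>\<^bsub>V\<^esub> x)) \<ominus>\<^bsub>K\<^esub> (b \<otimes>\<^bsub>K\<^esub> f (v(i := x)))"
        unfolding *(1) using *(2-5) by (simp add: g_diff g_smult g_gen tgen_closed tuple_upd)
      then show ?thesis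
        using f_smult[OF *(2-5)] c[OF *(2,3,5)] *(4) by (simp add: a_minus_def R.r_neg)
    next
      fix v i j assume *: "h = tgen v" "v \<in> tuples" "i < r" "j < r" "i \<noteq> j" "v i = v j"
      show ?thesis unfolding *(1) g_gen[OF *(2)] by (rule f_alt[OF *(2-6)])
    qed
    then show "h \<in> ?L" using hF by simp
  qed
  then have NL: "?N \<subseteq> ?L"
    using L by (intro F.span_is_subset) (auto simp: VectorSpace.subspace_def)
  interpret Q: quotient_space K tspace ?N
    by (intro quotient_space.intro quotient_space_axioms.intro vectorspace_tspace span_subspace)
  have sp: "ext_rels \<subseteq> ?N" by (rule F.in_own_span[OF ext_rels_subset])
  have LN: "?L \<subseteq> ?N"
  proof -
    \<comment> \<open>The sum of \<open>?N\<close> and the line of \<open>tgen \<beta>\<close>; it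
      is everything by \<open>basis_generator_suffices\<close>. An element of \<open>?L\<close> is
      thus an element of \<open>?N\<close> plus a multiple of \<open>tgen \<beta>\<close>, and
      applying \<open>g\<close> shows that the multiple is 0.\<close>
    let ?M = "{h \<in> ?F. \<exists>c\<in>carrier K. h \<ominus>\<^bsub>tspace\<^esub> c \<odot>\<^bsub>tspace\<^esub> tgen \<beta> \<in> ?N}"
    have cb: "c \<odot>\<^bsub>tspace\<^esub> tgen \<beta> \<in> ?F" if "c \<in> carrier K" for c
      using that tgen_closed by simp
    have M_iff: "h \<in> ?M \<longleftrightarrow> h \<in> ?F \<and> Q.proj h \<in> (\<lambda>c. Q.proj (c \<odot>\<^bsub>tspace\<^esub> tgen \<beta>)) ` carrier K" for h
      using Q.proj_eq_iff[of h] cb by auto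
    have M_E: thesis
      if h: "h \<in> ?M"
        and "\<And>c. h \<in> ?F \<Longrightarrow> c \<in> carrier K \<Longrightarrow> Q.proj h = Q.proj (c \<odot>\<^bsub>tspace\<^esub> tgen \<beta>) \<Longrightarrow> thesis"
      for h thesis
      using that(1) unfolding M_iff by (elim conjE imageE) (rule that(2))
    have "?M = ?F"
    proof (rule basis_generator_suffices[OF _ _ \<beta>(1,2)])
      show "VectorSpace.subspace K ?M tspace"
        unfolding subspace_iff[OF vectorspace_tspace]
      proof (intro conjI ballI)
        show "\<zero>\<^bsub>tspace\<^esub> \<in> ?M"
          unfolding M_iff using tgen_closed[of \<beta>]
          by (intro conjI F.M.zero_closed image_eqI[of _ _ "\<zero>\<^bsub>K\<^esub>"]) auto
        show "h \<oplus>\<^bsub>tspace\<^esub> h' \<in> ?M" if hM: "h \<in> ?M" "h' \<in> ?M" for h h'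
        proof -
          obtain c where c1: "h \<in> ?F" "c \<in> carrier K" "Q.proj h = Q.proj (c \<odot>\<^bsub>tspace\<^esub> tgen \<beta>)"
            by (rule M_E[OF hM(1)])
          obtain c' where c2: "h' \<in> ?F" "c' \<in> carrier K" "Q.proj h' = Q.proj (c' \<odot>\<^bsub>tspace\<^esub> tgen \<beta>)"
            by (rule M_E[OF hM(2)])
          note c = c1(1) c2(1) c1(2) c2(2) c1(3) c2(3)
          have "Q.proj (h \<oplus>\<^bsub>tspace\<^esub> h') = Q.proj (c \<odot>\<^bsub>tspace\<^esub> tgen \<beta> \<oplus>\<^bsub>tspace\<^esub> c' \<odot>\<^bsub>tspace\<^esub> tgen \<beta>)"
            using Q.add_Q[OF c(1,2)] Q.add_Q[OF cb[OF c(3)] cb[OF c(4)]] c(5,6) by simp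
          also have "\<dots> = Q.proj ((c \<oplus>\<^bsub>K\<^esub> c') \<odot>\<^bsub>tspace\<^esub> tgen \<beta>)"
            using c(3,4) tgen_closed[of \<beta>] by (simp add: F.smult_l_distr)
          finally show ?thesis
            unfolding M_iff
            using F.M.a_closed[OF c(1,2)] by (intro conjI image_eqI[OF _ R.a_closed[OF c(3,4)]])
        qed
        show "b \<odot>\<^bsub>tspace\<^esub> h \<in> ?M" if b: "b \<in> carrier K" and hM: "h \<in> ?M" for b h
        proof -
          obtain c where c: "h \<in> ?F" "c \<in> carrier K" "Q.proj h = Q.proj (c \<odot>\<^bsub>tspace\<^esub> tgen \<beta>)"
            by (rule M_E[OF hM])
          have "Q.proj (b \<odot>\<^bsub>tspace\<^esub> h) = Q.proj (b \<odot>\<^bsub>tspace\<^esub> (c \<odot>\<^bsub>tspace\<^esub> tgen \<beta>))"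
            using Q.smult_Q[OF b c(1)] Q.smult_Q[OF b cb[OF c(2)]] c(3) by simp
          also have "\<dots> = Q.proj ((b \<otimes>\<^bsub>K\<^esub> c) \<odot>\<^bsub>tspace\<^esub> tgen \<beta>)"
            using b c(2) tgen_closed[of \<beta>] by (simp add: F.smult_assoc1)
          finally show ?thesis
            unfolding M_iff
            using F.smult_closed[OF b c(1)] by (intro conjI image_eqI[OF _ R.m_closed[OF b c(2)]])
        qed
      qed blast
      show "ext_rels \<subseteq> ?M"
      proof
        fix h assume h: "h \<in> ext_rels"
        then have hF: "h \<in> ?F" using ext_rels_subset by blast
        have "h \<ominus>\<^bsub>tspace\<^esub> \<zero>\<^bsub>K\<^esub> \<odot>\<^bsub>tspace\<^esub> tgen \<beta> = h"
          using hF tgen_closed[of \<beta>] by (simp add: diff_zero)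
        then show "h \<in> ?M" using subsetD[OF sp h] hF by (intro CollectI conjI bexI[OF _ R.zero_closed]) simp_all
      qed
      have "tgen \<beta> \<ominus>\<^bsub>tspace\<^esub> tgen \<beta> = \<zero>\<^bsub>tspace\<^esub>"
        using tgen_closed[of \<beta>] by (simp add: a_minus_def F.M.r_neg)
      then have "tgen \<beta> \<ominus>\<^bsub>tspace\<^esub> \<one>\<^bsub>K\<^esub> \<odot>\<^bsub>tspace\<^esub> tgen \<beta> \<in> ?N"
        unfolding F.smult_one[OF tgen_closed] using subspaceD(3)[OF span_subspace] by (simp only:)
      then show "tgen \<beta> \<in> ?M"
        using tgen_closed[of \<beta>] by (intro CollectI conjI bexI[OF _ R.one_closed])
    qed
    show ?thesis
    proof
      fix h assume h: "h \<in> ?L"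
      then obtain c where c: "c \<in> carrier K" "h \<ominus>\<^bsub>tspace\<^esub> c \<odot>\<^bsub>tspace\<^esub> tgen \<beta> \<in> ?N"
        using \<open>?M = ?F\<close> by blast
      then have "g (h \<ominus>\<^bsub>tspace\<^esub> c \<odot>\<^bsub>tspace\<^esub> tgen \<beta>) = \<zero>\<^bsub>K\<^esub>" using NL by blast
      moreover have "g (h \<ominus>\<^bsub>tspace\<^esub> c \<odot>\<^bsub>tspace\<^esub> tgen \<beta>) = \<ominus>\<^bsub>K\<^esub> c"
        using h c(1) cb[OF c(1)] tgen_closed[of \<beta>] \<beta>(1,3)
        by (simp add: g_diff g_smult g_gen) (simp add: a_minus_def)
      ultimately have "\<ominus>\<^bsub>K\<^esub> c = \<zero>\<^bsub>K\<^esub>" by simp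
      then have "c = \<zero>\<^bsub>K\<^esub>" using c(1) R.add.inv_eq_1_iff by simp
      moreover have "h \<ominus>\<^bsub>tspace\<^esub> \<zero>\<^bsub>tspace\<^esub> = h" using h by (simp add: diff_zero)
      ultimately show "h \<in> ?N" using c(2) F.lmult_0[OF tgen_closed[of \<beta>]] by simp
    qed
  qed
  have eq: "?N = ?L" using NL LN by blast
  have 1: "card ?L * card (carrier K) = card ?F"
    using \<beta>(1,3) g_gen[of \<beta>] g_closed
    by (intro F.card_functional_kernel[OF finite_tspace _ g_add g_smult tgen_closed[of \<beta>]]) auto
  have 2: "card (Q.proj ` ?F) * card ?N = card ?F"
    using subspaceD(2)[OF span_subspace] by (intro Q.card_proj F.carrier_subspace finite_tspace)
  have "?N \<noteq> {}" using subspaceD(3)[OF span_subspace] by (intro notI) simp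
  with finite_subset[OF subspaceD(2)[OF span_subspace] finite_tspace] have 3: "card ?N > 0"
    by (simp add: card_gt_0_iff)
  have cancel: "x = z" if "y * z = w" "x * y = w" "y > 0" for x y z w :: nat
    using that by (metis mult.commute mult_left_cancel nat_neq_iff)
  have "card (Q.proj ` ?F) = card (carrier K)"
    by (rule cancel[OF 1[folded eq] 2 3])
  then show ?thesis
    unfolding exterior_power_eq Q.carrier_Q using Q.vectorspace_Q by (rule conjI[rotated])
qed

end

section \<open>Determinants and the number of orientations\<close>

lemma (in vectorspace) basis_coordinates:
  assumes fin: "finite B" and B: "basis B"
  shows "\<exists>co. (\<forall>x\<in>carrier V. \<forall>b\<in>B. co x b \<in> carrier K) \<and>
    (\<forall>x\<in>carrier V. \<forall>y\<in>carrier V. \<forall>b\<in>B. co (x \<oplus>\<^bsub>V\<^esub> y) b = co x b \<oplus>\<^bsub>K\<^esub> co y b) \<and>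
    (\<forall>c\<in>carrier K. \<forall>x\<in>carrier V. \<forall>b\<in>B. co (c \<odot>\<^bsub>V\<^esub> x) b = c \<otimes>\<^bsub>K\<^esub> co x b) \<and>
    (\<forall>b\<in>B. \<forall>b'\<in>B. co b b' = (if b' = b then \<one>\<^bsub>K\<^esub> else \<zero>\<^bsub>K\<^esub>))"
proof -
  have BV: "B \<subseteq> carrier V" using B unfolding basis_def by simp
  have ex1: "\<exists>!a. a \<in> B \<rightarrow>\<^sub>E carrier K \<and> lincomb a B = x" if "x \<in> carrier V" for x
    using basis_criterion[OF fin BV] B that by simp
  define co where "co x = (THE a. a \<in> B \<rightarrow>\<^sub>E carrier K \<and> lincomb a B = x)" for x
  have co: "co x \<in> B \<rightarrow>\<^sub>E carrier K \<and> lincomb (co x) B = x" if "x \<in> carrier V" for x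
    unfolding co_def by (rule theI'[OF ex1[OF that]])
  have coB: "co x b \<in> carrier K" if "x \<in> carrier V" "b \<in> B" for x b
    using co[OF that(1)] that(2) unfolding PiE_iff by simp
  have coP: "co x \<in> B \<rightarrow> carrier K" if "x \<in> carrier V" for x
    using coB[OF that] by (rule Pi_I)
  have uniq: "co x b = a b" if "x \<in> carrier V" "a \<in> B \<rightarrow> carrier K" "lincomb a B = x" "b \<in> B" for x a b
  proof -
    have "lincomb (restrict a B) B = lincomb a B"
      by (rule lincomb_restrict[OF BV]) (use that(2) in auto)
    moreover have "restrict a B \<in> B \<rightarrow>\<^sub>E carrier K"
      using that(2) unfolding restrict_PiE_iff by (auto simp: Pi_iff)
    ultimately have "restrict a B \<in> B \<rightarrow>\<^sub>E carrier K \<and> lincomb (restrict a B) B = x"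
      using that(3) by simp
    then have "co x = restrict a B" unfolding co_def by (rule the1_equality[OF ex1[OF that(1)]])
    then show ?thesis using that(4) by simp
  qed
  show ?thesis
  proof (intro exI[of _ co] conjI ballI)
    show "co (x \<oplus>\<^bsub>V\<^esub> y) b = co x b \<oplus>\<^bsub>K\<^esub> co y b"
      if xy: "x \<in> carrier V" "y \<in> carrier V" and b: "b \<in> B" for x y b
    proof (rule uniq[OF M.a_closed[OF xy] _ _ b])
      show "(\<lambda>b. co x b \<oplus>\<^bsub>K\<^esub> co y b) \<in> B \<rightarrow> carrier K"
        by (intro Pi_I R.a_closed coB xy)
      show "lincomb (\<lambda>b. co x b \<oplus>\<^bsub>K\<^esub> co y b) B = x \<oplus>\<^bsub>V\<^esub> y"
        using lincomb_sum[OF fin BV coP[OF xy(1)] coP[OF xy(2)]] co[OF xy(1)] co[OF xy(2)] by simp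
    qed
    show "co (c \<odot>\<^bsub>V\<^esub> x) b = c \<otimes>\<^bsub>K\<^esub> co x b"
      if c: "c \<in> carrier K" and x: "x \<in> carrier V" and b: "b \<in> B" for c x b
    proof (rule uniq[OF smult_closed[OF c x] _ _ b])
      show "(\<lambda>b. c \<otimes>\<^bsub>K\<^esub> co x b) \<in> B \<rightarrow> carrier K"
        by (intro Pi_I R.m_closed c coB x)
      show "lincomb (\<lambda>b. c \<otimes>\<^bsub>K\<^esub> co x b) B = c \<odot>\<^bsub>V\<^esub> x"
        using lincomb_smult[OF BV coP[OF x] c] co[OF x] by simp
    qed
    show "co b b' = (if b' = b then \<one>\<^bsub>K\<^esub> else \<zero>\<^bsub>K\<^esub>)" if b: "b \<in> B" and b': "b' \<in> B" for b b'
    proof (rule uniq[OF subsetD[OF BV b] _ _ b'])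
      show "(\<lambda>b'. if b' = b then \<one>\<^bsub>K\<^esub> else \<zero>\<^bsub>K\<^esub>) \<in> B \<rightarrow> carrier K" by simp
      have "lincomb (\<lambda>b'. if b' = b then \<one>\<^bsub>K\<^esub> else \<zero>\<^bsub>K\<^esub>) B
        = (\<Oplus>\<^bsub>V\<^esub>v\<in>B. if b = v then v else \<zero>\<^bsub>V\<^esub>)"
        unfolding lincomb_def
        by (rule M.finsum_cong') (use BV subsetD[OF BV] in auto)
      also have "\<dots> = b" by (rule M.finsum_singleton[OF b fin]) (use BV in auto)
      finally show "lincomb (\<lambda>b'. if b' = b then \<one>\<^bsub>K\<^esub> else \<zero>\<^bsub>K\<^esub>) B = b" .
    qed
  qed (rule coB)
qed

lemma (in vectorspace) span_singleton:
  assumes x: "x \<in> carrier V"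
  shows "span {x} = (\<lambda>c. c \<odot>\<^bsub>V\<^esub> x) ` carrier K"
proof -
  have lc: "lincomb a {x} = a x \<odot>\<^bsub>V\<^esub> x" if "a x \<in> carrier K" for a
    using x that by (simp add: lincomb_def)
  have *: "span {x} = {lincomb a {x} |a. a \<in> {x} \<rightarrow> carrier K}"
    by (rule finite_span) (use x in auto)
  show ?thesis
  proof
    show "span {x} \<subseteq> (\<lambda>c. c \<odot>\<^bsub>V\<^esub> x) ` carrier K"
      unfolding * using lc by auto
    show "(\<lambda>c. c \<odot>\<^bsub>V\<^esub> x) ` carrier K \<subseteq> span {x}"
    proof (rule image_subsetI)
      fix c assume "c \<in> carrier K"
      then have "c \<odot>\<^bsub>V\<^esub> x = lincomb (\<lambda>_. c) {x} \<and> (\<lambda>_. c) \<in> {x} \<rightarrow> carrier K"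
        using lc[of "\<lambda>_. c"] by simp
      then show "c \<odot>\<^bsub>V\<^esub> x \<in> span {x}" unfolding * by blast
    qed
  qed
qed

lemma (in vectorspace) smult_eq_zeroD:
  assumes c: "c \<in> carrier K" "c \<noteq> \<zero>\<^bsub>K\<^esub>" and x: "x \<in> carrier V" and z: "c \<odot>\<^bsub>V\<^esub> x = \<zero>\<^bsub>V\<^esub>"
  shows "x = \<zero>\<^bsub>V\<^esub>"
proof -
  have u: "c \<in> Units K" using c by (simp add: field_Units)
  then have i: "inv\<^bsub>K\<^esub> c \<in> carrier K" "inv\<^bsub>K\<^esub> c \<otimes>\<^bsub>K\<^esub> c = \<one>\<^bsub>K\<^esub>" by auto
  have "x = (inv\<^bsub>K\<^esub> c \<otimes>\<^bsub>K\<^esub> c) \<odot>\<^bsub>V\<^esub> x" unfolding i(2) using x by simp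
  also have "\<dots> = inv\<^bsub>K\<^esub> c \<odot>\<^bsub>V\<^esub> (c \<odot>\<^bsub>V\<^esub> x)" using i(1) c(1) x by (rule smult_assoc1)
  also have "\<dots> = \<zero>\<^bsub>V\<^esub>" unfolding z using i(1) by simp
  finally show ?thesis .
qed

lemma card_involution_pairs:
  assumes "finite S" and i: "\<And>x. x \<in> S \<Longrightarrow> i x \<in> S" "\<And>x. x \<in> S \<Longrightarrow> i x \<noteq> x" "\<And>x. x \<in> S \<Longrightarrow> i (i x) = x"
  shows "card ((\<lambda>x. {x, i x}) ` S) = card S div 2"
proof -
  let ?C = "(\<lambda>x. {x, i x}) ` S"
  have U: "\<Union> ?C = S" using i(1) by auto
  have "2 * card ?C = card (\<Union> ?C)"
  proof (rule card_partition)
    show "finite ?C" "finite (\<Union> ?C)" unfolding U using assms(1) by auto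
    show "card c = 2" if c: "c \<in> ?C" for c
    proof -
      obtain x where x: "x \<in> S" "c = {x, i x}" using c by (rule imageE)
      show ?thesis unfolding x(2) using i(2)[OF x(1)] by simp
    qed
    show "c \<inter> d = {}" if cd: "c \<in> ?C" "d \<in> ?C" "c \<noteq> d" for c d
    proof -
      obtain x where x: "x \<in> S" "c = {x, i x}" using cd(1) by (rule imageE)
      obtain y where y: "y \<in> S" "d = {y, i y}" using cd(2) by (rule imageE)
      have "x \<noteq> y" using cd(3) x y by auto
      moreover have "x \<noteq> i y" using cd(3) x y i(3)[OF y(1)] by auto
      moreover have "i x \<noteq> y" using cd(3) x y i(3)[OF x(1)] by auto
      moreover have "i x \<noteq> i y"
      proof
        assume "i x = i y"
        then have "i (i x) = i (i y)" by simp
        then show False using i(3)[OF x(1)] i(3)[OF y(1)] \<open>x \<noteq> y\<close> by simp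
      qed
      ultimately show ?thesis unfolding x(2) y(2) by simp
    qed
  qed
  then show ?thesis unfolding U by simp
qed

text \<open>In a space with as many elements as the field every nonzero vector generates, since its
  multiples are distinct. Negation has no fixed point among them because 2 is invertible, so it
  pairs them off.\<close>

lemma (in vectorspace) card_sign_pairs_of_generators:
  assumes fin: "finite (carrier K)" and cV: "card (carrier V) = card (carrier K)"
    and two: "\<one>\<^bsub>K\<^esub> \<oplus>\<^bsub>K\<^esub> \<one>\<^bsub>K\<^esub> \<noteq> \<zero>\<^bsub>K\<^esub>"
  shows "card {{x, \<ominus>\<^bsub>V\<^esub> x} | x. x \<in> carrier V \<and> span {x} = carrier V} = (card (carrier K) - 1) div 2"
proof -
  have K0: "card (carrier K) > 1"
  proof -
    have "card {\<zero>\<^bsub>K\<^esub>, \<one>\<^bsub>K\<^esub>} \<le> card (carrier K)" by (rule card_mono[OF fin]) simp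
    then show ?thesis by simp
  qed
  then have finV: "finite (carrier V)" using cV by (intro card_ge_0_finite) simp
  have gen: "span {x} = carrier V \<longleftrightarrow> x \<noteq> \<zero>\<^bsub>V\<^esub>" if x: "x \<in> carrier V" for x
  proof
    assume *: "span {x} = carrier V"
    show "x \<noteq> \<zero>\<^bsub>V\<^esub>"
    proof
      assume "x = \<zero>\<^bsub>V\<^esub>"
      then have "carrier V \<subseteq> {\<zero>\<^bsub>V\<^esub>}" using * span_singleton[OF x] by auto
      then have "card (carrier V) \<le> card {\<zero>\<^bsub>V\<^esub>}" by (rule card_mono[rotated]) simp
      then show False using K0 cV by simp
    qed
  next
    assume x0: "x \<noteq> \<zero>\<^bsub>V\<^esub>"
    have inj: "inj_on (\<lambda>c. c \<odot>\<^bsub>V\<^esub> x) (carrier K)"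
    proof (rule inj_onI)
      fix c d assume cd: "c \<in> carrier K" "d \<in> carrier K" "c \<odot>\<^bsub>V\<^esub> x = d \<odot>\<^bsub>V\<^esub> x"
      have "(c \<ominus>\<^bsub>K\<^esub> d) \<odot>\<^bsub>V\<^esub> x = c \<odot>\<^bsub>V\<^esub> x \<ominus>\<^bsub>V\<^esub> d \<odot>\<^bsub>V\<^esub> x"
        using cd(1,2) x by (simp add: a_minus_def smult_l_distr smult_l_minus)
      also have "\<dots> = \<zero>\<^bsub>V\<^esub>" unfolding cd(3) using cd(2) x by (simp add: a_minus_def M.r_neg)
      finally have "c \<ominus>\<^bsub>K\<^esub> d = \<zero>\<^bsub>K\<^esub>" using smult_eq_zeroD[of "c \<ominus>\<^bsub>K\<^esub> d" x] cd(1,2) x x0 by auto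
      then show "c = d" using cd(1,2) R.r_right_minus_eq by simp
    qed
    have "(\<lambda>c. c \<odot>\<^bsub>V\<^esub> x) ` carrier K = carrier V"
      by (rule card_subset_eq[OF finV]) (use x card_image[OF inj] cV in auto)
    then show "span {x} = carrier V" unfolding span_singleton[OF x] .
  qed
  have "{{x, \<ominus>\<^bsub>V\<^esub> x} | x. x \<in> carrier V \<and> span {x} = carrier V} = (\<lambda>x. {x, \<ominus>\<^bsub>V\<^esub> x}) ` (carrier V - {\<zero>\<^bsub>V\<^esub>})"
    using gen by blast
  moreover have "card ((\<lambda>x. {x, \<ominus>\<^bsub>V\<^esub> x}) ` (carrier V - {\<zero>\<^bsub>V\<^esub>})) = card (carrier V - {\<zero>\<^bsub>V\<^esub>}) div 2"
  proof (rule card_involution_pairs)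
    fix x assume x: "x \<in> carrier V - {\<zero>\<^bsub>V\<^esub>}"
    then have xV: "x \<in> carrier V" by simp
    show "\<ominus>\<^bsub>V\<^esub> x \<in> carrier V - {\<zero>\<^bsub>V\<^esub>}"
      using x M.minus_minus[OF xV] M.r_neg[OF xV] by auto
    show "\<ominus>\<^bsub>V\<^esub> x \<noteq> x"
    proof
      assume "\<ominus>\<^bsub>V\<^esub> x = x"
      then have "x \<oplus>\<^bsub>V\<^esub> x = \<zero>\<^bsub>V\<^esub>" using M.r_neg[OF xV] by simp
      then have "(\<one>\<^bsub>K\<^esub> \<oplus>\<^bsub>K\<^esub> \<one>\<^bsub>K\<^esub>) \<odot>\<^bsub>V\<^esub> x = \<zero>\<^bsub>V\<^esub>" using xV by (simp add: smult_l_distr)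
      then show False using smult_eq_zeroD[OF _ two xV] x by simp
    qed
    show "\<ominus>\<^bsub>V\<^esub> (\<ominus>\<^bsub>V\<^esub> x) = x" using xV by (rule M.minus_minus)
  qed (simp add: finV)
  moreover have "card (carrier V - {\<zero>\<^bsub>V\<^esub>}) = card (carrier K) - 1"
    unfolding cV[symmetric] by (rule card_Diff_singleton) simp
  ultimately show ?thesis by simp
qed

text \<open>The witnesses are the cofactors along row \<open>i\<close>; deleting that row makes them
  independent of \<open>b\<close>, which exhibits the determinant as linear in the row.\<close>

lemma det_row_expansion:
  fixes a :: "nat \<Rightarrow> nat \<Rightarrow> 'a :: comm_ring_1"
  assumes i: "i < r"
  shows "\<exists>C. \<forall>b. det (mat r r (\<lambda>(k, j). (a(i := b)) k j)) = (\<Sum>j<r. b j * C j)"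
proof (intro exI allI)
  let ?A = "\<lambda>b. mat r r (\<lambda>(k, j). (a(i := b)) k j)"
  fix b
  have "mat_delete (?A b) i j = mat_delete (?A (a i)) i j" if "j < r" for j
    using i that by (intro eq_matI) (auto simp: mat_delete_def)
  then have "cofactor (?A b) i j = cofactor (?A (a i)) i j" if "j < r" for j
    unfolding cofactor_def using that by (simp only:)
  moreover have "det (?A b) = (\<Sum>j<r. ?A b $$ (i, j) * cofactor (?A b) i j)"
    by (rule laplace_expansion_row[OF _ i]) simp
  ultimately show "det (?A b) = (\<Sum>j<r. b j * cofactor (?A (a i)) i j)"
    using i by simp
qed

text \<open>The alternating form required by \<open>card_exterior_power\<close> is a determinant of
  coordinates. Elements of \<open>Fp p\<close> are integers, so it is taken as the determinant of an
  integer matrix and reduced modulo \<open>p\<close> at the end; linearity in a row is proved as a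
  congruence, because the coordinates themselves add only modulo \<open>p\<close>.\<close>

lemma card_pm_orientations:
  assumes p: "prime p" "3 \<le> p" and V: "vectorspace (Fp p) V" and fin: "finite (carrier V)"
  shows "card (pm_orientations (Fp p) V) = (p - 1) div 2"
proof -
  interpret Fp: residues_prime p "Fp p"
    by unfold_locales (use p in auto)
  have carrier: "carrier (Fp p) = {0..int p - 1}" by (rule Fp.res_carrier_eq)
  have fK: "finite (carrier (Fp p))" unfolding carrier by simp
  interpret V: vectorspace "Fp p" V by (rule V)
  obtain B where B: "finite B" "V.basis B" "card B = V.dim"
    using V.basis_exists_finite[OF fin] by blast
  define r where "r = V.dim"
  interpret T: tuple_space "Fp p" V r
    by (intro tuple_space.intro finite_vectorspace.intro finite_vectorspace_axioms.intro V fK fin)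
  obtain b where b: "bij_betw b {..<r} B"
    using ex_bij_betw_nat_finite[OF B(1)] B(3) unfolding r_def lessThan_atLeast0 by auto
  have bB: "b i \<in> B" if "i < r" for i using bij_betwE[OF b] that by simp
  have BV: "B \<subseteq> carrier V" and gB: "V.span B = carrier V" using B(2) unfolding V.basis_def by auto
  obtain co where
    "(\<forall>x\<in>carrier V. \<forall>b\<in>B. co x b \<in> carrier (Fp p)) \<and>
    (\<forall>x\<in>carrier V. \<forall>y\<in>carrier V. \<forall>b\<in>B. co (x \<oplus>\<^bsub>V\<^esub> y) b = co x b \<oplus>\<^bsub>Fp p\<^esub> co y b) \<and>
    (\<forall>c\<in>carrier (Fp p). \<forall>x\<in>carrier V. \<forall>b\<in>B. co (c \<odot>\<^bsub>V\<^esub> x) b = c \<otimes>\<^bsub>Fp p\<^esub> co x b) \<and>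
    (\<forall>b\<in>B. \<forall>b'\<in>B. co b b' = (if b' = b then \<one>\<^bsub>Fp p\<^esub> else \<zero>\<^bsub>Fp p\<^esub>))"
    using V.basis_coordinates[OF B(1,2)] by (elim exE) (rule that)
  then have co: "co (x \<oplus>\<^bsub>V\<^esub> y) e = co x e \<oplus>\<^bsub>Fp p\<^esub> co y e"
    "c \<in> carrier (Fp p) \<Longrightarrow> co (c \<odot>\<^bsub>V\<^esub> x) e = c \<otimes>\<^bsub>Fp p\<^esub> co x e"
    "e' \<in> B \<Longrightarrow> co e e' = (if e' = e then \<one>\<^bsub>Fp p\<^esub> else \<zero>\<^bsub>Fp p\<^esub>)"
    if "x \<in> carrier V" "y \<in> carrier V" "e \<in> B" for c x y e e' using that by simp_all
  define A where "A v = mat r r (\<lambda>(k, j). co (v k) (b j))" for v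
  define f where "f v = det (A v) mod int p" for v
  have A_upd: "A (v(i := x)) = mat r r (\<lambda>(k, j). ((\<lambda>k j. co (v k) (b j))(i := (\<lambda>j. co x (b j)))) k j)" for v i x
    unfolding A_def by (rule cong_mat) auto
  have p0: "int p > 0" using p(2) by simp
  define \<beta> where "\<beta> = restrict b {..<r}"
  have "vectorspace (Fp p) (exterior_power (Fp p) V r) \<and>
    card (carrier (exterior_power (Fp p) V r)) = card (carrier (Fp p))"
  proof (rule T.card_exterior_power[of f \<beta>])
    show "f v \<in> carrier (Fp p)" for v
      unfolding f_def carrier using pos_mod_bound[OF p0, of "det (A v)"] pos_mod_sign[OF p0, of "det (A v)"] by simp
    show "f (v(i := x \<oplus>\<^bsub>V\<^esub> y)) = f (v(i := x)) \<oplus>\<^bsub>Fp p\<^esub> f (v(i := y))"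
      if i: "i < r" and xy: "x \<in> carrier V" "y \<in> carrier V" for v i x y
    proof -
      obtain C where "\<forall>d. det (mat r r (\<lambda>(k, j). ((\<lambda>k j. co (v k) (b j))(i := d)) k j)) = (\<Sum>j<r. d j * C j)"
        using det_row_expansion[OF i] by (rule exE)
      note C = this[rule_format]
      have "[(\<Sum>j<r. co (x \<oplus>\<^bsub>V\<^esub> y) (b j) * C j) = (\<Sum>j<r. (co x (b j) + co y (b j)) * C j)] (mod int p)"
        using co(1)[OF xy bB] by (intro cong_sum cong_mult cong_refl) (simp add: Fp.res_add_eq)
      then have "[det (A (v(i := x \<oplus>\<^bsub>V\<^esub> y))) = det (A (v(i := x))) + det (A (v(i := y)))] (mod int p)"
        unfolding A_upd C by (simp add: distrib_right sum.distrib)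
      then show ?thesis unfolding f_def Fp.res_add_eq cong_def by (simp add: mod_add_eq)
    qed
    show "f (v(i := c \<odot>\<^bsub>V\<^esub> x)) = c \<otimes>\<^bsub>Fp p\<^esub> f (v(i := x))"
      if i: "i < r" and cx: "c \<in> carrier (Fp p)" "x \<in> carrier V" for v i c x
    proof -
      obtain C where "\<forall>d. det (mat r r (\<lambda>(k, j). ((\<lambda>k j. co (v k) (b j))(i := d)) k j)) = (\<Sum>j<r. d j * C j)"
        using det_row_expansion[OF i] by (rule exE)
      note C = this[rule_format]
      have "[(\<Sum>j<r. co (c \<odot>\<^bsub>V\<^esub> x) (b j) * C j) = (\<Sum>j<r. (c * co x (b j)) * C j)] (mod int p)"
        using co(2)[OF cx(2,2) bB cx(1)] by (intro cong_sum cong_mult cong_refl) (simp add: Fp.res_mult_eq)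
      then have "[det (A (v(i := c \<odot>\<^bsub>V\<^esub> x))) = c * det (A (v(i := x)))] (mod int p)"
        unfolding A_upd C by (simp add: sum_distrib_left mult.assoc)
      then show ?thesis unfolding f_def Fp.res_mult_eq cong_def by (simp add: mod_mult_right_eq)
    qed
    show "f v = \<zero>\<^bsub>Fp p\<^esub>" if ij: "i < r" "j < r" "i \<noteq> j" "v i = v j" for v i j
    proof -
      have "det (A v) = 0"
        by (rule det_identical_rows[OF _ ij(3,1,2)]) (use ij in \<open>auto simp: A_def\<close>)
      then show ?thesis unfolding f_def Fp.res_zero_eq by simp
    qed
    show "\<beta> \<in> T.tuples"
      unfolding T.tuples_def \<beta>_def restrict_PiE_iff using bB BV by auto
    have "\<beta> ` {..<r} = B" unfolding \<beta>_def using b by (simp add: bij_betw_def)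
    then show "V.span (\<beta> ` {..<r}) = carrier V" using gB by simp
    have "A \<beta> = 1\<^sub>m r"
    proof (rule eq_matI)
      fix i j assume "i < dim_row (1\<^sub>m r :: int mat)" "j < dim_col (1\<^sub>m r :: int mat)"
      then have ij: "i < r" "j < r" by auto
      have "b j = b i \<longleftrightarrow> j = i" using bij_betw_imp_inj_on[OF b] ij by (auto simp: inj_on_def)
      then show "A \<beta> $$ (i, j) = 1\<^sub>m r $$ (i, j)"
        using ij co(3)[OF V.M.zero_closed V.M.zero_closed bB[OF ij(1)] bB[OF ij(2)]]
        by (simp add: A_def \<beta>_def Fp.res_zero_eq Fp.res_one_eq)
    qed (auto simp: A_def)
    then show "f \<beta> = \<one>\<^bsub>Fp p\<^esub>"
      unfolding f_def Fp.res_one_eq using p(2) by simp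
  qed
  then have E: "card (carrier (exterior_power (Fp p) V r)) = card (carrier (Fp p))"
    "vectorspace (Fp p) (exterior_power (Fp p) V r)" by simp_all
  have "\<one>\<^bsub>Fp p\<^esub> \<oplus>\<^bsub>Fp p\<^esub> \<one>\<^bsub>Fp p\<^esub> \<noteq> \<zero>\<^bsub>Fp p\<^esub>"
    unfolding Fp.res_add_eq Fp.res_one_eq Fp.res_zero_eq using p(2) by simp
  from vectorspace.card_sign_pairs_of_generators[OF E(2) fK E(1) this]
  show ?thesis unfolding pm_orientations_def Let_def r_def[symmetric] carrier by simp
qed

section \<open>Steinberg modules of isotropic flags\<close>

text \<open>The rank function of \<open>P\<close> is carried to \<open>Q\<close> by the inverse of
  \<open>f\<close>. This lets the homology attached to a quotient space be computed on subspaces of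
  the original space.\<close>

lemma (in graded_poset) free_rank_isomorphic_poset:
  assumes f: "bij_betw f P Q" and lt: "\<And>x y. x \<in> P \<Longrightarrow> y \<in> P \<Longrightarrow> lt' (f x) (f y) \<longleftrightarrow> lt x y"
  shows "free_rank (reduced_order_homology (int k - 1) Q lt') (linkrank P lt k {})"
proof -
  let ?g = "inv_into P f"
  have g: "?g y \<in> P" "f (?g y) = y" if "y \<in> Q" for y
    using f that by (auto simp: bij_betw_def inv_into_into f_inv_into_f)
  have lt2: "lt (?g x) (?g y)" if "x \<in> Q" "y \<in> Q" "lt' x y" for x y
    using lt[OF g(1)[OF that(1)] g(1)[OF that(2)]] g(2)[OF that(1)] g(2)[OF that(2)] that(3) by simp
  interpret Q: graded_poset Q lt' "\<lambda>y. \<rho> (?g y)" a n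
  proof
    show "finite Q" using bij_betw_finite[OF f] finite_P by simp
    show "\<rho> (?g y) \<in> {a<..n}" if "y \<in> Q" for y by (rule rank_bounds[OF g(1)[OF that]])
    show "\<rho> (?g x) < \<rho> (?g y)" if "x \<in> Q" "y \<in> Q" "lt' x y" for x y
      by (rule rank_mono[OF g(1)[OF that(1)] g(1)[OF that(2)] lt2[OF that]])
  qed
  have "linkrank Q lt' k {} = linkrank P lt k {}" by (rule linkrank_iso[OF finite_P f]) (rule lt)
  then show ?thesis using Q.free_rank_reduced_order_homology by simp
qed

section \<open>Dimensions and intervals of isotropic subspaces\<close>

definition (in vectorspace) sdim where
  "sdim U = vectorspace.dim K (V\<lparr>carrier := U\<rparr>)"

context finite_vectorspace
begin

lemma card_subspace:
  assumes U: "VectorSpace.subspace K U V"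
  shows "card U = card (carrier K) ^ sdim U"
proof -
  interpret U: vectorspace K "V\<lparr>carrier := U\<rparr>" by (rule subspace_is_vs[OF U])
  show ?thesis
    using U.card_eq_power_dim finite_subset[OF subspaceD(2)[OF U] finite_V] by (simp add: sdim_def)
qed

lemma sdim_less:
  assumes "VectorSpace.subspace K U V" "VectorSpace.subspace K W V" "U \<subset> W"
  shows "sdim U < sdim W"
proof -
  have "card U < card W"
    using finite_subset[OF subspaceD(2)[OF assms(2)] finite_V] assms(3) by (rule psubset_card_mono)
  then show ?thesis
    unfolding card_subspace[OF assms(1)] card_subspace[OF assms(2)]
    using card_field by (simp add: power_strict_increasing_iff)
qed

lemma sdim_zero: "sdim {\<zero>\<^bsub>V\<^esub>} = 0"
  using card_subspace[OF zero_subspace] card_field by (cases "sdim {\<zero>\<^bsub>V\<^esub>}") simp_all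

lemma finite_subspaces: "finite {U. VectorSpace.subspace K U V}"
  by (rule finite_subset[of _ "Pow (carrier V)"]) (auto dest: subspaceD(2) simp: finite_V)

end

context quotient_space
begin

text \<open>The correspondence theorem; the strict bounds at \<open>N\<close> and at the whole space
  translate into nonzero and proper in the quotient.\<close>

lemma proper_subspaces_bij:
  "bij_betw (image proj) {W. VectorSpace.subspace K W V \<and> N \<subset> W \<and> W \<subset> carrier V} (proper_subspaces K Q)"
proof (rule bij_betw_imageI)
  show "inj_on (image proj) {W. VectorSpace.subspace K W V \<and> N \<subset> W \<and> W \<subset> carrier V}"
    by (rule inj_onI) (simp add: proj_image_eq_iff psubset_imp_subset)
  show "image proj ` {W. VectorSpace.subspace K W V \<and> N \<subset> W \<and> W \<subset> carrier V} = proper_subspaces K Q"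
  proof (intro equalityI subsetI)
    fix A assume "A \<in> image proj ` {W. VectorSpace.subspace K W V \<and> N \<subset> W \<and> W \<subset> carrier V}"
    then obtain W where W: "A = proj ` W" "VectorSpace.subspace K W V" "N \<subset> W" "W \<subset> carrier V" by blast
    note eq = proj_image_eq_iff[OF W(2) psubset_imp_subset[OF W(3)]]
    have "proj ` W \<noteq> proj ` N" using eq[OF N order_refl] W(3) by blast
    moreover have "proj ` W \<noteq> proj ` carrier V" using eq[OF carrier_subspace subspaceD(2)[OF N]] W(4) by blast
    ultimately show "A \<in> proper_subspaces K Q"
      unfolding W(1) proper_subspaces_def proj_N carrier_Q using subspace_proj[OF W(2)] by simp
  next
    fix A assume A: "A \<in> proper_subspaces K Q"
    then have "VectorSpace.subspace K A Q" by (simp add: proper_subspaces_def)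
    then obtain W where W: "VectorSpace.subspace K W V" "N \<subseteq> W" "A = proj ` W" by (rule subspace_lift)
    have "N \<noteq> W" "W \<noteq> carrier V"
      using A unfolding W(3) proper_subspaces_def proj_N[symmetric] carrier_Q by auto
    then show "A \<in> image proj ` {W. VectorSpace.subspace K W V \<and> N \<subset> W \<and> W \<subset> carrier V}"
      unfolding W(3) using W(1,2) subspaceD(2)[OF W(1)] by blast
  qed
qed

lemma dim_Q:
  assumes "finite (carrier K)" "finite (carrier V)"
  shows "vectorspace.dim K Q + sdim N = dim"
proof -
  interpret finite_vectorspace K V
    by (intro finite_vectorspace.intro finite_vectorspace_axioms.intro assms) unfold_locales
  interpret Q: vectorspace K Q by (rule vectorspace_Q)
  have "finite (carrier Q)" unfolding carrier_Q using assms(2) by simp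
  then have "card (carrier K) ^ Q.dim * card (carrier K) ^ sdim N = card (carrier K) ^ dim"
    using card_proj[OF carrier_subspace subspaceD(2)[OF N] assms(2)]
    by (simp add: carrier_Q[symmetric] Q.card_eq_power_dim card_subspace[OF N] card_eq_power_dim[OF assms(2)])
  then have "card (carrier K) ^ (Q.dim + sdim N) = card (carrier K) ^ dim" by (simp add: power_add)
  then show ?thesis using card_field by (simp add: power_inject_exp)
qed

end

context form_space
begin

lemma coset_restrict: "U +>\<^bsub>V\<lparr>carrier := W\<rparr>\<^esub> x = U +>\<^bsub>V\<^esub> x"
  by (simp add: a_r_coset_def')

lemma quotient_space_subspace:
  assumes U: "VectorSpace.subspace K U V" and N: "VectorSpace.subspace K N V" "N \<subseteq> U"
  shows "quotient_space K (V\<lparr>carrier := U\<rparr>) N"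
  using subspace_is_vs[OF U] subspace_of_subspace[OF U] N
  by (intro quotient_space.intro quotient_space_axioms.intro) simp_all

abbreviation "isotropics \<equiv> proper_isotropics K V \<omega>"

lemma isotropicsD:
  assumes "U \<in> isotropics"
  shows "VectorSpace.subspace K U V" "isotropic K \<omega> U" "U \<noteq> {\<zero>\<^bsub>V\<^esub>}" "U \<noteq> carrier V"
  using assms by (simp_all add: proper_isotropics_def proper_subspaces_def)

lemma isotropic_subset: "isotropic K \<omega> U \<Longrightarrow> W \<subseteq> U \<Longrightarrow> isotropic K \<omega> W"
  by (auto simp: isotropic_def)

lemma zero_psubset:
  assumes "VectorSpace.subspace K U V"
  shows "{\<zero>\<^bsub>V\<^esub>} \<subset> U \<longleftrightarrow> U \<noteq> {\<zero>\<^bsub>V\<^esub>}"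
  using subspaceD(3)[OF assms] by auto

lemma finite_isotropics: "finite isotropics"
  by (rule finite_subset[OF _ finite_subspaces]) (auto dest: isotropicsD)

lemma sdim_isotropic_le:
  assumes "dim = 2 * n" and U: "VectorSpace.subspace K U V" "isotropic K \<omega> U"
  shows "sdim U \<le> n"
proof -
  have "card (carrier K) ^ (sdim U + sdim U) \<le> card (carrier K) ^ (2 * n)"
    using isotropic_card[OF U] unfolding card_subspace[OF U(1)] card_eq_power_dim[OF finite_V] assms(1)
    by (simp add: power_add)
  then show ?thesis using card_field by (simp add: power_increasing_iff)
qed

lemma graded_isotropics:
  assumes "dim = 2 * n"
  shows "graded_poset isotropics (\<subset>) sdim 0 n"
proof
  show "finite isotropics" by (rule finite_isotropics)
  show "sdim U \<in> {0<..n}" if "U \<in> isotropics" for U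
    using sdim_less[OF zero_subspace isotropicsD(1)[OF that]] zero_psubset[OF isotropicsD(1)[OF that]]
      isotropicsD(3)[OF that] sdim_isotropic_le[OF assms isotropicsD(1,2)[OF that]] by simp
  show "sdim U < sdim W" if "U \<in> isotropics" "W \<in> isotropics" "U \<subset> W" for U W
    by (rule sdim_less[OF isotropicsD(1)[OF that(1)] isotropicsD(1)[OF that(2)] that(3)])
qed

text \<open>Every subspace of an isotropic space is isotropic, so the proper nonzero subspaces of
  the quotient of \<open>U\<close> by \<open>N\<close> are the isotropic subspaces strictly between
  \<open>N\<close> and \<open>U\<close>.\<close>

lemma free_rank_steinberg:
  assumes U: "U \<in> isotropics" and N: "VectorSpace.subspace K N V" "N \<subset> U"
  shows "free_rank (steinberg K (quotient_module (V\<lparr>carrier := U\<rparr>) N))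
    (linkrank {W \<in> isotropics. N \<subset> W \<and> W \<subset> U} (\<subset>) (sdim U - sdim N - 1) {})"
proof -
  note U' = isotropicsD[OF U]
  let ?V = "V\<lparr>carrier := U\<rparr>" and ?P = "{W \<in> isotropics. N \<subset> W \<and> W \<subset> U}"
  interpret Q: quotient_space K ?V N
    by (rule quotient_space_subspace[OF U'(1) N(1) psubset_imp_subset[OF N(2)]])
  have finU: "finite U" using subspaceD(2)[OF U'(1)] finite_V by (rule finite_subset)
  have less: "sdim N < sdim U" by (rule sdim_less[OF N(1) U'(1) N(2)])
  have P: "?P = {W. VectorSpace.subspace K W ?V \<and> N \<subset> W \<and> W \<subset> carrier ?V}"
  proof (intro equalityI subsetI)
    fix W assume "W \<in> ?P"
    then show "W \<in> {W. VectorSpace.subspace K W ?V \<and> N \<subset> W \<and> W \<subset> carrier ?V}"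
      using subspace_of_subspace[OF U'(1)] isotropicsD(1) by auto
  next
    fix W assume W: "W \<in> {W. VectorSpace.subspace K W ?V \<and> N \<subset> W \<and> W \<subset> carrier ?V}"
    then have *: "VectorSpace.subspace K W V" "N \<subset> W" "W \<subset> U"
      using subspace_of_subspace[OF U'(1)] by auto
    have "W \<noteq> {\<zero>\<^bsub>V\<^esub>}" using *(2) subspaceD(3)[OF N(1)] by auto
    moreover have "W \<noteq> carrier V" using *(3) subspaceD(2)[OF U'(1)] by auto
    ultimately show "W \<in> ?P"
      using * isotropic_subset[OF U'(2)] by (simp add: proper_isotropics_def proper_subspaces_def)
  qed
  \<comment> \<open>Strictness on both sides leaves the ranks from \<open>sdim N + 1\<close> to
    \<open>sdim U - 1\<close>, so the top degree is the dimension of the quotient minus 2; that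
    dimension is positive, which disposes of the maximum in \<open>steinberg\<close>.\<close>
  interpret P: graded_poset ?P "(\<subset>)" sdim "sdim N" "sdim U - 1"
  proof
    show "finite ?P" using finite_isotropics by simp
    show "sdim W \<in> {sdim N<..sdim U - 1}" if "W \<in> ?P" for W
      using sdim_less[OF N(1), of W] sdim_less[OF _ U'(1), of W] that isotropicsD(1)[of W] by auto
    show "sdim W < sdim W'" if "W \<in> ?P" "W' \<in> ?P" "W \<subset> W'" for W W'
      using sdim_less[OF isotropicsD(1) isotropicsD(1) that(3)] that by simp
  qed
  have "free_rank (reduced_order_homology (int P.k - 1) (proper_subspaces K Q.Q) (\<subset>)) (linkrank ?P (\<subset>) P.k {})"
  proof (rule P.free_rank_isomorphic_poset)
    show "bij_betw (image Q.proj) ?P (proper_subspaces K Q.Q)"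
      unfolding P by (rule Q.proper_subspaces_bij)
    show "Q.proj ` W \<subset> Q.proj ` W' \<longleftrightarrow> W \<subset> W'" if "W \<in> ?P" "W' \<in> ?P" for W W'
      using that unfolding P by (intro Q.proj_image_psubset_iff) auto
  qed
  moreover have "vectorspace.dim K Q.Q + sdim N = sdim U"
    using Q.dim_Q[OF finite_K] finU by (simp add: Q.sdim_def sdim_def)
  then have "max (-1) (int (vectorspace.dim K Q.Q) - 2) = int P.k - 1" using less by simp
  moreover have "P.k = sdim U - sdim N - 1" by simp
  ultimately show ?thesis unfolding steinberg_def by simp
qed

text \<open>Isotropic subspaces containing \<open>U\<close> lie in \<open>perp U\<close>, so the
  proper nonzero isotropic subspaces of the quotient are those strictly above \<open>U\<close>. By
  \<open>card_perp\<close> the quotient has dimension \<open>2 * n - 2 * sdim U\<close>, and half of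
  it is the number of ranks above \<open>U\<close>.\<close>

lemma free_rank_symp_steinberg:
  assumes dim: "dim = 2 * n" and U: "VectorSpace.subspace K U V" "isotropic K \<omega> U"
  shows "free_rank (symp_steinberg K (quotient_module (V\<lparr>carrier := perp U\<rparr>) U) (induced_form \<omega>))
    (linkrank {W \<in> isotropics. U \<subset> W} (\<subset>) (n - sdim U) {})"
proof -
  let ?V = "V\<lparr>carrier := perp U\<rparr>" and ?P = "{W \<in> isotropics. U \<subset> W}"
  have W: "VectorSpace.subspace K (perp U) V" by (rule perp_subspace[OF subspaceD(2)[OF U(1)]])
  have sub: "U \<subseteq> perp U" by (rule isotropic_subset_perp[OF order_refl U(2) subspaceD(2)[OF U(1)]])
  interpret Q: quotient_space K ?V U
    by (rule quotient_space_subspace[OF W U(1) sub])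
  have finW: "finite (perp U)" using subspaceD(2)[OF W] finite_V by (rule finite_subset)
  have proj: "Q.proj = (\<lambda>x. U +>\<^bsub>V\<^esub> x)" by (rule ext) (rule coset_restrict)
  have iso: "isotropic K (induced_form \<omega>) (Q.proj ` X) \<longleftrightarrow> isotropic K \<omega> X" if "X \<subseteq> perp U" for X
    unfolding isotropic_def proj using induced_form_proj[OF U(1) _ _ U(2)] subsetD[OF that] by simp
  have P: "?P = {X \<in> {X. VectorSpace.subspace K X ?V \<and> U \<subset> X \<and> X \<subset> carrier ?V}. isotropic K \<omega> X}"
  proof (intro equalityI subsetI)
    fix X assume X: "X \<in> ?P"
    then have X': "VectorSpace.subspace K X V" "isotropic K \<omega> X" "U \<subset> X" using isotropicsD by auto
    have "X \<subseteq> perp U"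
      by (rule isotropic_subset_perp[OF psubset_imp_subset[OF X'(3)] X'(2) subspaceD(2)[OF X'(1)]])
    \<comment> \<open>Properness in the quotient is not immediate from properness in the whole
      space: it holds because an isotropic \<open>perp U\<close> would equal \<open>U\<close>,
      against \<open>U \<subset> X\<close>.\<close>
    moreover have "X \<noteq> perp U" using perp_isotropic_eq[OF U] X'(2,3) by auto
    ultimately show "X \<in> {X \<in> {X. VectorSpace.subspace K X ?V \<and> U \<subset> X \<and> X \<subset> carrier ?V}. isotropic K \<omega> X}"
      using subspace_of_subspace[OF W] X' by auto
  next
    fix X assume X: "X \<in> {X \<in> {X. VectorSpace.subspace K X ?V \<and> U \<subset> X \<and> X \<subset> carrier ?V}. isotropic K \<omega> X}"
    then have *: "VectorSpace.subspace K X V" "U \<subset> X" "X \<subset> perp U" "isotropic K \<omega> X"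
      using subspace_of_subspace[OF W] by auto
    have "X \<noteq> {\<zero>\<^bsub>V\<^esub>}" using *(2) subspaceD(3)[OF U(1)] by auto
    moreover have "X \<noteq> carrier V" using *(3) subspaceD(2)[OF W] by auto
    ultimately show "X \<in> ?P"
      using * by (simp add: proper_isotropics_def proper_subspaces_def)
  qed
  interpret P: graded_poset ?P "(\<subset>)" sdim "sdim U" n
  proof
    show "finite ?P" using finite_isotropics by simp
    show "sdim X \<in> {sdim U<..n}" if "X \<in> ?P" for X
      using sdim_less[OF U(1), of X] sdim_isotropic_le[OF dim, of X] that isotropicsD(1,2)[of X] by auto
    show "sdim X < sdim X'" if "X \<in> ?P" "X' \<in> ?P" "X \<subset> X'" for X X'
      using sdim_less[OF isotropicsD(1) isotropicsD(1) that(3)] that by simp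
  qed
  have "free_rank (reduced_order_homology (int P.k - 1) (proper_isotropics K Q.Q (induced_form \<omega>)) (\<subset>))
    (linkrank ?P (\<subset>) P.k {})"
  proof (rule P.free_rank_isomorphic_poset)
    note b = Q.proper_subspaces_bij
    show "bij_betw (image Q.proj) ?P (proper_isotropics K Q.Q (induced_form \<omega>))"
    proof (rule bij_betw_subset[OF b])
      show "image Q.proj ` ?P = proper_isotropics K Q.Q (induced_form \<omega>)"
      proof (intro equalityI subsetI)
        fix A assume "A \<in> image Q.proj ` ?P"
        then obtain X where X: "X \<in> ?P" "A = Q.proj ` X" by (rule imageE)
        have "Q.proj ` X \<in> proper_subspaces K Q.Q"
          by (rule bij_betw_apply[OF b]) (use X(1)[unfolded P] in simp)
        moreover have "X \<subseteq> perp U" "isotropic K \<omega> X" using X(1)[unfolded P] by auto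
        ultimately show "A \<in> proper_isotropics K Q.Q (induced_form \<omega>)"
          unfolding X(2) proper_isotropics_def using iso[of X] by simp
      next
        fix A assume A: "A \<in> proper_isotropics K Q.Q (induced_form \<omega>)"
        then have "A \<in> image Q.proj ` {W. VectorSpace.subspace K W ?V \<and> U \<subset> W \<and> W \<subset> carrier ?V}"
          unfolding bij_betw_imp_surj_on[OF b] proper_isotropics_def by simp
        then obtain X where X: "A = Q.proj ` X" "X \<in> {W. VectorSpace.subspace K W ?V \<and> U \<subset> W \<and> W \<subset> carrier ?V}"
          by (rule imageE)
        moreover have "X \<subseteq> perp U" using X(2) by auto
        then have "isotropic K \<omega> X"
          using A iso[of X] unfolding X(1) proper_isotropics_def by simp
        ultimately show "A \<in> image Q.proj ` ?P" unfolding P by simp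
      qed
    qed (auto simp: P)
    show "Q.proj ` X \<subset> Q.proj ` X' \<longleftrightarrow> X \<subset> X'" if "X \<in> ?P" "X' \<in> ?P" for X X'
      using that unfolding P by (intro Q.proj_image_psubset_iff) auto
  qed
  moreover have "vectorspace.dim K Q.Q + sdim U = sdim (perp U)"
    using Q.dim_Q[OF finite_K] finW by (simp add: Q.sdim_def sdim_def)
  moreover have "sdim U + sdim (perp U) = 2 * n"
  proof -
    have "card (carrier K) ^ (sdim U + sdim (perp U)) = card (carrier K) ^ (2 * n)"
      using card_perp[OF U(1)] unfolding card_subspace[OF U(1)] card_subspace[OF W] card_eq_power_dim[OF finite_V] dim
      by (simp add: power_add)
    then show ?thesis using card_field by (simp add: power_inject_exp)
  qed
  ultimately have "vectorspace.dim K Q.Q div 2 = P.k" by simp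
  with \<open>free_rank _ _\<close> show ?thesis unfolding symp_steinberg_def by simp
qed

text \<open>The labelled poset is graded by the dimension of the underlying subspace, and two labels
  on one subspace are incomparable because the order only looks at subspaces; so its top homology
  has the rank given by \<open>linkrank_labelled\<close>.\<close>

lemma free_rank_labelled_isotropics:
  assumes dim: "dim = 2 * n" and m: "m \<ge> 1" and L: "\<And>U. U \<in> isotropics \<Longrightarrow> card (L U) = m"
  shows "free_rank (reduced_order_homology (int n - 1) (Sigma isotropics L) (\<lambda>x y. fst x \<subset> fst y))
    (\<Sum>\<sigma> | \<sigma> \<subseteq> isotropics \<and> lt_chain (\<subset>) \<sigma>. (m - 1) ^ card \<sigma> * linkrank isotropics (\<subset>) n \<sigma>)"
proof -
  interpret P: graded_poset isotropics "(\<subset>)" sdim 0 n by (rule graded_isotropics[OF dim])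
  interpret S: graded_poset "Sigma isotropics L" "\<lambda>x y. fst x \<subset> fst y" "\<lambda>x. sdim (fst x)" 0 n
  proof
    show "finite (Sigma isotropics L)"
    proof (rule finite_SigmaI[OF finite_isotropics])
      show "finite (L U)" if "U \<in> isotropics" for U
        using L[OF that] m by (intro card_ge_0_finite) simp
    qed
    show "sdim (fst x) \<in> {0<..n}" if "x \<in> Sigma isotropics L" for x
      by (rule P.rank_bounds) (use that in auto)
    show "sdim (fst x) < sdim (fst y)"
      if "x \<in> Sigma isotropics L" "y \<in> Sigma isotropics L" "fst x \<subset> fst y" for x y
      by (rule P.rank_mono[OF _ _ that(3)]) (use that(1,2) in auto)
  qed
  show ?thesis
    using S.free_rank_reduced_order_homology P.linkrank_labelled[of m L, OF m L] by simp
qed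

lemma flag_members:
  assumes Vs: "set Vs \<subseteq> isotropics" "sorted_wrt (\<subset>) Vs"
  shows "sorted_wrt (\<subset>) ({\<zero>\<^bsub>V\<^esub>} # Vs)"
    and "W \<in> set ({\<zero>\<^bsub>V\<^esub>} # Vs) \<Longrightarrow> VectorSpace.subspace K W V \<and> isotropic K \<omega> W"
proof -
  have "{\<zero>\<^bsub>V\<^esub>} \<subset> U" if "U \<in> set Vs" for U
    using isotropicsD[OF subsetD[OF Vs(1) that]] zero_psubset by simp
  then show "sorted_wrt (\<subset>) ({\<zero>\<^bsub>V\<^esub>} # Vs)" using Vs(2) by simp
  have "isotropic K \<omega> {\<zero>\<^bsub>V\<^esub>}" by (simp add: isotropic_def form_zero)
  then show "VectorSpace.subspace K W V \<and> isotropic K \<omega> W" if "W \<in> set ({\<zero>\<^bsub>V\<^esub>} # Vs)"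
    using that zero_subspace isotropicsD(1,2)[of W] Vs(1) by auto
qed

end

text \<open>The bottom \<open>N\<close> is carried along as the head of the list, so that entry
  \<open>i\<close> of \<open>N # Vs\<close> precedes entry \<open>i\<close> of \<open>Vs\<close>.
  The recursion then unrolls into the open intervals between neighbours and the part above the last
  member.\<close>

lemma flagrank_eq_prod:
  fixes P :: "'a set set"
  assumes "sorted_wrt (\<subset>) (N # Vs)"
  shows "flagrank (\<subset>) \<rho> n {W \<in> P. N \<subset> W} (\<rho> N) Vs =
    (\<Prod>i<length Vs. linkrank {W \<in> P. (N # Vs) ! i \<subset> W \<and> W \<subset> Vs ! i} (\<subset>) (\<rho> (Vs ! i) - \<rho> ((N # Vs) ! i) - 1) {}) *
    linkrank {W \<in> P. last (N # Vs) \<subset> W} (\<subset>) (n - \<rho> (last (N # Vs))) {}"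
  using assms
proof (induction Vs arbitrary: N)
  case Nil
  then show ?case by simp
next
  case (Cons v Vs)
  have "N \<subset> v" using Cons.prems by simp
  then have 1: "{W \<in> {W \<in> P. N \<subset> W}. v \<subset> W} = {W \<in> P. v \<subset> W}" by auto
  have 2: "{W \<in> {W \<in> P. N \<subset> W}. W \<subset> v} = {W \<in> P. N \<subset> W \<and> W \<subset> v}" by auto
  have "sorted_wrt (\<subset>) (v # Vs)" using Cons.prems by simp
  from Cons.IH[OF this] show ?case
    unfolding flagrank.simps 1 2
    by (simp del: prod.lessThan_Suc add: prod.lessThan_Suc_shift mult.assoc)
qed

text \<open>The signs form a subgroup of order 2 because \<open>p \<ge> 3\<close>, and Lagrange
  divides the \<open>p - 1\<close> units by it. The number agrees with that in
  \<open>card_pm_orientations\<close>, so both sides carry the same factor for each member of a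
  flag.\<close>

lemma card_units_mod_sign:
  assumes p: "prime p" "3 \<le> p"
  shows "card (carrier (units_of (Fp p) Mod {\<one>\<^bsub>Fp p\<^esub>, \<ominus>\<^bsub>Fp p\<^esub> \<one>\<^bsub>Fp p\<^esub>})) = (p - 1) div 2"
proof -
  interpret Fp: residues_prime p "Fp p"
    by unfold_locales (use p in auto)
  let ?G = "units_of (Fp p)" and ?H = "{\<one>\<^bsub>Fp p\<^esub>, \<ominus>\<^bsub>Fp p\<^esub> \<one>\<^bsub>Fp p\<^esub>}"
  interpret G: group ?G by (rule Fp.units_group)
  have U: "carrier ?G = {1..int p - 1}" using p(2) by (simp add: units_of_def Fp.res_prime_units_eq of_nat_diff)
  have one: "\<one>\<^bsub>Fp p\<^esub> = 1" by (rule Fp.res_one_eq)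
  have neg: "\<ominus>\<^bsub>Fp p\<^esub> \<one>\<^bsub>Fp p\<^esub> = int p - 1"
    unfolding one Fp.res_neg_eq by (rule zmod_minus1) (use p(2) in simp)
  have sq: "(int p - 1) \<otimes>\<^bsub>Fp p\<^esub> (int p - 1) = 1"
  proof -
    have "(int p - 1) * (int p - 1) = 1 + int p * (int p - 2)" by (simp add: algebra_simps)
    then show ?thesis using p(2) by (simp add: Fp.res_mult_eq)
  qed
  have mul: "x \<otimes>\<^bsub>?G\<^esub> y = x \<otimes>\<^bsub>Fp p\<^esub> y" "\<one>\<^bsub>?G\<^esub> = 1" for x y by (simp_all add: units_of_def one)
  have inG: "1 \<in> carrier ?G" "int p - 1 \<in> carrier ?G" unfolding U using p(2) by auto
  have inv: "inv\<^bsub>?G\<^esub> (int p - 1) = int p - 1"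
    by (rule G.inv_equality) (use sq inG in \<open>simp_all add: mul\<close>)
  have "subgroup ?H ?G"
    unfolding neg unfolding one
  proof (rule G.subgroupI)
    show "{1, int p - 1} \<subseteq> carrier ?G" using inG by simp
    show "inv\<^bsub>?G\<^esub> a \<in> {1, int p - 1}" if "a \<in> {1, int p - 1}" for a
      using that inv G.inv_one unfolding mul by auto
    show "a \<otimes>\<^bsub>?G\<^esub> b \<in> {1, int p - 1}" if "a \<in> {1, int p - 1}" "b \<in> {1, int p - 1}" for a b
      using that sq G.l_one[OF inG(1)] G.l_one[OF inG(2)] G.r_one[OF inG(2)] unfolding mul by auto
  qed simp
  then have "card (rcosets\<^bsub>?G\<^esub> ?H) * card ?H = card (carrier ?G)"
    using G.lagrange_finite[of ?H] by (simp add: Coset.order_def U)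
  moreover have "card ?H = 2" unfolding neg unfolding one using p(2) by simp
  moreover have "card (carrier ?G) = p - 1" unfolding U by simp
  ultimately show ?thesis by (simp add: FactGroup_def)
qed

theorem theorem8p3:
  fixes p n :: nat
  assumes "prime p" and "3 \<le> p" and "1 \<le> n"
  shows "pm_oriented_symp_steinberg p n \<cong> sum_group (isotropic_flags p n) (flag_summand p n)"
proof -
  interpret Fp: residues_prime p "Fp p"
    by unfold_locales (use assms in auto)
  have "finite (carrier (Fp p))" unfolding Fp.res_carrier_eq by simp
  from field.std_symplectic_form_space[OF Fp.is_field this]
  interpret V: form_space "Fp p" "Fp_space p n" "Fp_form p n" .
  have cK: "card (carrier (Fp p)) = p" unfolding Fp.res_carrier_eq by simp
  have dim: "V.dim = 2 * n"
  proof -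
    have "carrier (Fp_space p n) = {..<2 * n} \<rightarrow>\<^sub>E carrier (Fp p)" by (simp add: Fp.func_space_def)
    then have "p ^ V.dim = p ^ (2 * n)"
      using V.card_eq_power_dim[OF V.finite_V] by (simp add: card_PiE cK)
    then show ?thesis using assms(2) by (simp add: power_inject_exp)
  qed
  interpret P: graded_poset V.isotropics "(\<subset>)" V.sdim 0 n by (rule V.graded_isotropics[OF dim])
  define m where "m = (p - 1) div 2"
  have m: "m \<ge> 1" using assms(2) unfolding m_def by simp
  define g where "g \<sigma> = (m - 1) ^ card \<sigma> * linkrank V.isotropics (\<subset>) n \<sigma>" for \<sigma>
  let ?C = "{\<sigma>. \<sigma> \<subseteq> V.isotropics \<and> lt_chain (\<subset>) \<sigma>}" and ?F = "isotropic_flags p n"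
  have F: "Vs \<in> ?F \<longleftrightarrow> set Vs \<subseteq> V.isotropics \<and> sorted_wrt (\<subset>) Vs" for Vs
    by (simp add: isotropic_flags_def)
  \<comment> \<open>The left side is summed over chains as sets, the right side over flags as lists;
    each chain has a unique increasing enumeration.\<close>
  have bij: "bij_betw set ?F ?C"
  proof (rule bij_betw_imageI)
    show "inj_on set ?F"
      by (rule inj_onI) (metis F P.sorted_set_unique)
    show "set ` ?F = ?C"
    proof (intro equalityI subsetI)
      show "\<sigma> \<in> ?C" if "\<sigma> \<in> set ` ?F" for \<sigma>
        using that F P.sorted_chain by auto
      show "\<sigma> \<in> set ` ?F" if "\<sigma> \<in> ?C" for \<sigma>
        using P.chain_sorted_list[of \<sigma>] that F by auto
    qed
  qed
  have "finite ?C" using V.finite_isotropics by simp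
  then have finF: "finite ?F" using bij_betw_finite[OF bij] by simp
  have "card (pm_orientations (Fp p) (Fp_space p n\<lparr>carrier := U\<rparr>)) = m" if "U \<in> V.isotropics" for U
    unfolding m_def using V.isotropicsD(1)[OF that] V.finite_V
    by (intro card_pm_orientations assms V.subspace_is_vs) (auto intro: finite_subset dest: subspaceD(2))
  from V.free_rank_labelled_isotropics[OF dim m this]
  have L: "free_rank (pm_oriented_symp_steinberg p n) (\<Sum>\<sigma>\<in>?C. g \<sigma>)"
    unfolding pm_oriented_symp_steinberg_def oriented_isotropics_def g_def .
  have R: "free_rank (flag_summand p n Vs) (g (set Vs))" if "Vs \<in> ?F" for Vs
  proof -
    have Vs: "set Vs \<subseteq> V.isotropics" "sorted_wrt (\<subset>) Vs" using that unfolding F by auto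
    let ?Z = "{\<zero>\<^bsub>Fp_space p n\<^esub>}"
    let ?Ws = "?Z # Vs"
    note Ws = V.flag_members[OF Vs]
    have Ws_nth: "VectorSpace.subspace (Fp p) (?Ws ! i) (Fp_space p n)" "?Ws ! i \<subset> Vs ! i" "Vs ! i \<in> V.isotropics"
      if "i < length Vs" for i
    proof -
      have "?Ws ! i \<in> set ?Ws" using that by (intro nth_mem) simp
      then show "VectorSpace.subspace (Fp p) (?Ws ! i) (Fp_space p n)" using Ws(2) by blast
      show "?Ws ! i \<subset> Vs ! i" using sorted_wrt_nth_less[OF Ws(1), of i "Suc i"] that by simp
      show "Vs ! i \<in> V.isotropics" using Vs(1) that by auto
    qed
    have "last ?Ws \<in> set ?Ws" by (rule last_in_set) simp
    note last = Ws(2)[OF this]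
    define A where "A i = linkrank {W \<in> V.isotropics. ?Ws ! i \<subset> W \<and> W \<subset> Vs ! i} (\<subset>)
      (V.sdim (Vs ! i) - V.sdim (?Ws ! i) - 1) {}" for i
    define B where "B = linkrank {W \<in> V.isotropics. last ?Ws \<subset> W} (\<subset>) (n - V.sdim (last ?Ws)) {}"
    have "card (carrier (units_of (Fp p) Mod {\<one>\<^bsub>Fp p\<^esub>, \<ominus>\<^bsub>Fp p\<^esub> \<one>\<^bsub>Fp p\<^esub>})) = m"
      unfolding m_def by (rule card_units_mod_sign[OF assms(1,2)])
    \<comment> \<open>\<open>m \<ge> 1\<close> rules out an empty and an infinite set of points at
      once, since both have cardinality 0.\<close>
    then have H: "free_rank (reduced_homology_group 0 (Fp_units_mod_sign p)) (m - 1)"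
      unfolding Fp_units_mod_sign_def
      using free_rank_reduced_homology_discrete m by (metis card.empty card.infinite not_one_le_zero)
    have "free_rank (flag_summand p n Vs) ((\<Prod>i<length Vs. A i) * (B * (\<Prod>i<length Vs. m - 1)))"
      unfolding flag_summand_def Let_def A_def B_def
      using Ws_nth last H dim
      by (intro free_rank_tensor_group free_rank_tensor_family V.free_rank_steinberg V.free_rank_symp_steinberg) auto
    \<comment> \<open>\<open>linkrank_flag\<close> splits the link of the flag recursively and
      \<open>flagrank_eq_prod\<close> reads the recursion as a product. The prepended zero space has
      dimension 0, the lower rank bound, and lies strictly below every member of the poset.\<close>
    moreover have "(\<Prod>i<length Vs. A i) * B = linkrank V.isotropics (\<subset>) n (set Vs)"
    proof -
      have Z: "{W \<in> V.isotropics. ?Z \<subset> W} = V.isotropics"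
        using V.isotropicsD(1,3) V.zero_psubset by auto
      have "linkrank V.isotropics (\<subset>) (n - 0) (set Vs) = flagrank (\<subset>) V.sdim n V.isotropics 0 Vs"
        by (rule linkrank_flag[OF P.graded_poset_axioms _ Vs]) (rule psubset_trans)
      also have "\<dots> = (\<Prod>i<length Vs. A i) * B"
        using flagrank_eq_prod[OF Ws(1), of V.sdim n V.isotropics] unfolding Z V.sdim_zero A_def B_def .
      finally show ?thesis by simp
    qed
    moreover have "card (set Vs) = length Vs"
      using P.sorted_distinct[OF Vs] by (rule distinct_card)
    moreover have "(\<Prod>i<length Vs. A i) * (B * (\<Prod>i<length Vs. m - 1)) =
      (m - 1) ^ length Vs * ((\<Prod>i<length Vs. A i) * B)"
      by (simp only: prod_constant card_lessThan ac_simps)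
    ultimately show ?thesis by (simp only: g_def)
  qed
  have "free_rank (sum_group ?F (flag_summand p n)) (\<Sum>Vs\<in>?F. g (set Vs))"
    by (rule free_rank_sum_group[OF finF R])
  then have "free_rank (sum_group ?F (flag_summand p n)) (\<Sum>\<sigma>\<in>?C. g \<sigma>)"
    unfolding sum.reindex_bij_betw[OF bij] .
  with L show ?thesis by (rule free_rank_iso)
qed

end
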